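(* Let $(\xi,\eta)\in L^2_{\mathcal F}(T,T+u)\times L^2_{\mathcal F}(T,T+u;\mathbf R^d)$ with $\xi_T\in L^2(\mathcal F_T)$. Let $b,\bar b,\underline b,c\in L^2_{\mathcal F}(0,T+u+l)$ and $\sigma,\bar\sigma,\underline\sigma\in L^2_{\mathcal F}(0,T+u+l;\mathbf R^d)$ all be uniformly bounded. Consider the linear BSDE $$Y_t=\xi_T+\int_t^T\big(b_sY_s+\bar b_sY_{s-l}+E[\underline b_{s+u}Y_{s+u}|\mathcal F_s]+\sigma_sZ_s+\bar\sigma_sZ_{s-l}+E[\underline\sigma_{s+u}Z_{s+u}|\mathcal F_s]+c_s\big)ds-\int_t^TZ_s\,dB_s,\quad t\in[0,T),$$ $$(Y_t,Z_t)=(\xi_t,\eta_t),\ t\in[T,T+u],\qquad (Y_t,Z_t)=(Y_0,0),\ t\in[-l,0),$$ and, for $t\in[0,T]$, the linear SDE $$X_r=X_t+\int_t^r\big(b_sX_s+\underline b_sX_{s-u}+E[\bar b_{s+l}X_{s+l}|\mathcal F_s]\big)ds+\int_t^r\big(\sigma_sX_s+\underline\sigma_sX_{s-u}+E[\bar\sigma_{s+l}X_{s+l}|\mathcal F_s]\big)dB_s,\quad r\in(t,T],$$ $$X_t=1,\qquad X_r=0,\ r\in(T,T+l],\qquad X_r=0,\ r\in[t-u,t).$$ Suppose that this BSDE and this SDE both have a unique solution. Then $$Y_t=E\Big[X_T\xi_T+\int_T^{T+u}X_{s-u}(\underline b_s\xi_s+\underline\sigma_s\eta_s)\,ds+\int_t^{t+l}X_s(\bar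 b_sY_{s-l}+\bar\sigma_sZ_{s-l})\,ds+\int_t^Tc_sX_s\,ds\,\Big|\,\mathcal F_t\Big].$$ In particular, taking $t=0$, if $E\int_0^lX_s\bar b_s\,ds\ne1$, then $$Y_0=\Big(1-E\Big[\int_0^lX_s\bar b_s\,ds\Big]\Big)^{-1}E\Big[X_T\xi_T+\int_T^{T+u}X_{s-u}(\underline b_s\xi_s+\underline\sigma_s\eta_s)\,ds+\int_0^Tc_sX_s\,ds\Big].$$
   Context: $(\Omega,\mathcal F,P)$ is a complete probability space with a $d$-dimensional standard Brownian motion $(B_t)_{t\ge0}$; $(\mathcal F_t)_{t\ge0}$ is its natural filtration augmented by the $P$-null sets. $T>0$, $l\ge0$, $u\ge0$ are given constants. $L^2(\mathcal F_t)$: real $\mathcal F_t$-measurable square integrable random variables. $L^2_{\mathcal F}(a,b;\mathbf R^d)$: $\mathbf R^d$-valued progressively measurable processes $\psi$ on $[a,b]$ with $E\int_a^b|\psi_r|^2dr<\infty$ (the target is omitted when $d=1$). $\mathcal S^2_{\mathcal F}(a,b)$: real continuous processes in $L^2_{\mathcal F}(a,b)$ with $E[\sup_{r\in[a,b]}|\psi_r|^2]<\infty$. Products such as $\sigma_sZ_s$ of $\mathbf R^d$-valued quantities are inner products. A solution of the BSDE is a pair $(Y,Z)$ on $[-l,T+u]$ satisfying it with $(Y_t,Z_t)_{t\in[0,T]}\in\mathcal S^2_{\mathcal F}(0,T)\times L^2_{\mathcal F}(0,T;\mathbf R^d)$. A solution of the SDE started at $t$ is a process $X$ on $[t-u,T+l]$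 satisfying it with $(X_r)_{r\in[t,T]}\in\mathcal S^2_{\mathcal F}(t,T)$. *)

theory Defs
  imports "HOL-Probability.Probability"
begin

definition standard_brownian_motion ::
  "'w measure \<Rightarrow> (real \<Rightarrow> 'w \<Rightarrow> real ^ 'd) \<Rightarrow> bool" where
  "standard_brownian_motion M B \<longleftrightarrow>
     (\<forall>t\<ge>0. B t \<in> borel_measurable M) \<and>
     (AE \<omega> in M. B 0 \<omega> = 0) \<and>
     (AE \<omega> in M. continuous_on {0..} (\<lambda>t. B t \<omega>)) \<and>
     (\<forall>s t. 0 \<le> s \<longrightarrow> s < t \<longrightarrow>
        distributed M lborel (\<lambda>\<omega>. B t \<omega> - B s \<omega>)
          (\<lambda>x. ennreal (\<Prod>i\<in>UNIV. normal_density 0 (sqrt (t - s)) (x $ i)))) \<and>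
     (\<forall>n (\<tau> :: nat \<Rightarrow> real). 0 \<le> \<tau> 0 \<longrightarrow> (\<forall>i<n. \<tau> i \<le> \<tau> (Suc i)) \<longrightarrow>
        prob_space.indep_vars M (\<lambda>_. borel) (\<lambda>i \<omega>. B (\<tau> (Suc i)) \<omega> - B (\<tau> i) \<omega>) {..<n})"

definition aug_filtration ::
  "'w measure \<Rightarrow> (real \<Rightarrow> 'w \<Rightarrow> real ^ 'd) \<Rightarrow> real \<Rightarrow> 'w measure" where
  "aug_filtration M B t =
     sigma (space M)
       ({B s -` A \<inter> space M | s A. 0 \<le> s \<and> s \<le> t \<and> A \<in> sets borel} \<union> null_sets M)"

definition prog_measurable ::
  "(real \<Rightarrow> 'w measure) \<Rightarrow> real \<Rightarrow> real \<Rightarrow> (real \<Rightarrow> 'w \<Rightarrow> 'b::topological_space) \<Rightarrow> bool" where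
  "prog_measurable F a b \<psi> \<longleftrightarrow>
     (\<forall>r\<in>{a..b}. (\<lambda>(s, \<omega>). \<psi> s \<omega>) \<in> borel_measurable (restrict_space borel {a..r} \<Otimes>\<^sub>M F r))"

definition L2_rv :: "'w measure \<Rightarrow> 'w measure \<Rightarrow> ('w \<Rightarrow> real) \<Rightarrow> bool" where
  "L2_rv M G \<zeta> \<longleftrightarrow> \<zeta> \<in> borel_measurable G \<and> integrable M (\<lambda>\<omega>. (\<zeta> \<omega>)\<^sup>2)"

definition L2_proc ::
  "'w measure \<Rightarrow> (real \<Rightarrow> 'w measure) \<Rightarrow> real \<Rightarrow> real \<Rightarrow> (real \<Rightarrow> 'w \<Rightarrow> 'b::real_normed_vector) \<Rightarrow> bool" where
  "L2_proc M F a b \<psi> \<longleftrightarrow> prog_measurable F a b \<psi> \<and>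
     (\<integral>\<^sup>+\<omega>. (\<integral>\<^sup>+s\<in>{a..b}. ennreal ((norm (\<psi> s \<omega>))\<^sup>2) \<partial>lborel) \<partial>M) < \<infinity>"

definition S2_proc ::
  "'w measure \<Rightarrow> (real \<Rightarrow> 'w measure) \<Rightarrow> real \<Rightarrow> real \<Rightarrow> (real \<Rightarrow> 'w \<Rightarrow> real) \<Rightarrow> bool" where
  "S2_proc M F a b \<psi> \<longleftrightarrow> L2_proc M F a b \<psi> \<and>
     (AE \<omega> in M. continuous_on {a..b} (\<lambda>s. \<psi> s \<omega>)) \<and>
     (\<integral>\<^sup>+\<omega>. (SUP s\<in>{a..b}. ennreal ((\<psi> s \<omega>)\<^sup>2)) \<partial>M) < \<infinity>"

definition unif_bounded ::
  "'w measure \<Rightarrow> real \<Rightarrow> real \<Rightarrow> (real \<Rightarrow> 'w \<Rightarrow> 'b::real_normed_vector) \<Rightarrow> bool" where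
  "unif_bounded M a b \<psi> \<longleftrightarrow> (\<exists>K. \<forall>s\<in>{a..b}. \<forall>\<omega>\<in>space M. norm (\<psi> s \<omega>) \<le> K)"

(* A choice of E[G_s | F_s] made separately for each s need not be jointly measurable in
   (s, omega), so the process s |-> E[G_s | F_s] is a progressively measurable V that is a
   version of the conditional expectation (componentwise) for almost every s. By Fubini such a V
   is unique ds x dP-almost everywhere. "Almost every s" is all one can ask when G_s is
   integrable only for almost every s. *)
definition cond_exp_process ::
  "'w measure \<Rightarrow> (real \<Rightarrow> 'w measure) \<Rightarrow> real \<Rightarrow> real \<Rightarrow>
   (real \<Rightarrow> 'w \<Rightarrow> 'b::euclidean_space) \<Rightarrow> (real \<Rightarrow> 'w \<Rightarrow> 'b) \<Rightarrow> bool" where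
  "cond_exp_process M F a b G V \<longleftrightarrow> prog_measurable F a b V \<and>
     (AE s in lborel. s \<in> {a..b} \<longrightarrow>
        (AE \<omega> in M. \<forall>i\<in>Basis. V s \<omega> \<bullet> i = real_cond_exp M (F s) (\<lambda>\<omega>'. G s \<omega>' \<bullet> i) \<omega>))"

(* Step integrands: the value phi i on the interval (tau i, tau (i+1)], for i < n. *)
definition step_integrand ::
  "'w measure \<Rightarrow> (real \<Rightarrow> 'w measure) \<Rightarrow> real \<Rightarrow> real \<Rightarrow>
   nat \<Rightarrow> (nat \<Rightarrow> real) \<Rightarrow> (nat \<Rightarrow> 'w \<Rightarrow> real ^ 'd) \<Rightarrow> bool" where
  "step_integrand M F a b n \<tau> \<phi> \<longleftrightarrow>
     (\<forall>i\<le>n. \<tau> i \<in> {a..b}) \<and> (\<forall>i<n. \<tau> i \<le> \<tau> (Suc i)) \<and>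
     (\<forall>i<n. \<phi> i \<in> borel_measurable (F (\<tau> i)) \<and> (\<exists>K. \<forall>\<omega>\<in>space M. norm (\<phi> i \<omega>) \<le> K))"

definition step_process ::
  "nat \<Rightarrow> (nat \<Rightarrow> real) \<Rightarrow> (nat \<Rightarrow> 'w \<Rightarrow> real ^ 'd) \<Rightarrow> real \<Rightarrow> 'w \<Rightarrow> real ^ 'd" where
  "step_process n \<tau> \<phi> s \<omega> = (\<Sum>i<n. indicator {\<tau> i<..\<tau> (Suc i)} s *\<^sub>R \<phi> i \<omega>)"

definition step_ito_integral ::
  "(real \<Rightarrow> 'w \<Rightarrow> real ^ 'd) \<Rightarrow> nat \<Rightarrow> (nat \<Rightarrow> real) \<Rightarrow> (nat \<Rightarrow> 'w \<Rightarrow> real ^ 'd) \<Rightarrow> 'w \<Rightarrow> real" where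
  "step_ito_integral B n \<tau> \<phi> \<omega> = (\<Sum>i<n. \<phi> i \<omega> \<bullet> (B (\<tau> (Suc i)) \<omega> - B (\<tau> i) \<omega>))"

(* I is (a version of) the Ito integral of psi with respect to B over [a, b]: the L^2(P)-limit
   of the elementary integrals of step integrands that converge to psi in L^2(ds x dP). By the
   Ito isometry I is unique almost surely. *)
definition has_ito_integral ::
  "'w measure \<Rightarrow> (real \<Rightarrow> 'w \<Rightarrow> real ^ 'd) \<Rightarrow> real \<Rightarrow> real \<Rightarrow>
   (real \<Rightarrow> 'w \<Rightarrow> real ^ 'd) \<Rightarrow> ('w \<Rightarrow> real) \<Rightarrow> bool" where
  "has_ito_integral M B a b \<psi> I \<longleftrightarrow>
     L2_proc M (aug_filtration M B) a b \<psi> \<and> I \<in> borel_measurable M \<and>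
     (\<exists>n \<tau> \<phi>.
        (\<forall>k. step_integrand M (aug_filtration M B) a b (n k) (\<tau> k) (\<phi> k)) \<and>
        (\<lambda>k. \<integral>\<^sup>+\<omega>. (\<integral>\<^sup>+s\<in>{a..b}.
           ennreal ((norm (\<psi> s \<omega> - step_process (n k) (\<tau> k) (\<phi> k) s \<omega>))\<^sup>2) \<partial>lborel) \<partial>M)
          \<longlonglongrightarrow> 0 \<and>
        (\<lambda>k. \<integral>\<^sup>+\<omega>. ennreal ((I \<omega> - step_ito_integral B (n k) (\<tau> k) (\<phi> k) \<omega>)\<^sup>2) \<partial>M)
          \<longlonglongrightarrow> 0)"

(* Here and below _bar and _low stand for over- and underlined coefficients. Outside [0, T] the
   processes are prescribed pointwise; for each t in [0, T) the equation holds almost surely. *)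
definition bsde_solution ::
  "'w measure \<Rightarrow> (real \<Rightarrow> 'w \<Rightarrow> real ^ 'd) \<Rightarrow> real \<Rightarrow> real \<Rightarrow> real \<Rightarrow>
   (real \<Rightarrow> 'w \<Rightarrow> real) \<Rightarrow> (real \<Rightarrow> 'w \<Rightarrow> real) \<Rightarrow> (real \<Rightarrow> 'w \<Rightarrow> real) \<Rightarrow>
   (real \<Rightarrow> 'w \<Rightarrow> real ^ 'd) \<Rightarrow> (real \<Rightarrow> 'w \<Rightarrow> real ^ 'd) \<Rightarrow> (real \<Rightarrow> 'w \<Rightarrow> real ^ 'd) \<Rightarrow>
   (real \<Rightarrow> 'w \<Rightarrow> real) \<Rightarrow> (real \<Rightarrow> 'w \<Rightarrow> real) \<Rightarrow> (real \<Rightarrow> 'w \<Rightarrow> real ^ 'd) \<Rightarrow>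
   (real \<Rightarrow> 'w \<Rightarrow> real) \<Rightarrow> (real \<Rightarrow> 'w \<Rightarrow> real ^ 'd) \<Rightarrow> bool" where
  "bsde_solution M B T l u b b_bar b_low \<sigma> \<sigma>_bar \<sigma>_low c \<xi> \<eta> Y Z \<longleftrightarrow>
     S2_proc M (aug_filtration M B) 0 T Y \<and>
     L2_proc M (aug_filtration M B) 0 T Z \<and>
     (\<exists>V W.
        cond_exp_process M (aug_filtration M B) 0 T (\<lambda>s \<omega>. b_low (s + u) \<omega> * Y (s + u) \<omega>) V \<and>
        cond_exp_process M (aug_filtration M B) 0 T (\<lambda>s \<omega>. \<sigma>_low (s + u) \<omega> \<bullet> Z (s + u) \<omega>) W \<and>
        (\<forall>t\<in>{0..<T}. \<exists>I. has_ito_integral M B t T Z I \<and>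
           (AE \<omega> in M. Y t \<omega> = \<xi> T \<omega>
              + (LINT s:{t..T}|lborel.
                   b s \<omega> * Y s \<omega> + b_bar s \<omega> * Y (s - l) \<omega> + V s \<omega>
                   + \<sigma> s \<omega> \<bullet> Z s \<omega> + \<sigma>_bar s \<omega> \<bullet> Z (s - l) \<omega> + W s \<omega> + c s \<omega>)
              - I \<omega>))) \<and>
     (\<forall>t\<in>{T..T + u}. \<forall>\<omega>\<in>space M. Y t \<omega> = \<xi> t \<omega> \<and> Z t \<omega> = \<eta> t \<omega>) \<and>
     (\<forall>t\<in>{-l..<0}. \<forall>\<omega>\<in>space M. Y t \<omega> = Y 0 \<omega> \<and> Z t \<omega> = 0)"

(* Y is unique up to indistinguishability, Z up to ds x dP-null sets. *)
definition bsde_unique_solution ::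
  "'w measure \<Rightarrow> (real \<Rightarrow> 'w \<Rightarrow> real ^ 'd) \<Rightarrow> real \<Rightarrow> real \<Rightarrow> real \<Rightarrow>
   (real \<Rightarrow> 'w \<Rightarrow> real) \<Rightarrow> (real \<Rightarrow> 'w \<Rightarrow> real) \<Rightarrow> (real \<Rightarrow> 'w \<Rightarrow> real) \<Rightarrow>
   (real \<Rightarrow> 'w \<Rightarrow> real ^ 'd) \<Rightarrow> (real \<Rightarrow> 'w \<Rightarrow> real ^ 'd) \<Rightarrow> (real \<Rightarrow> 'w \<Rightarrow> real ^ 'd) \<Rightarrow>
   (real \<Rightarrow> 'w \<Rightarrow> real) \<Rightarrow> (real \<Rightarrow> 'w \<Rightarrow> real) \<Rightarrow> (real \<Rightarrow> 'w \<Rightarrow> real ^ 'd) \<Rightarrow>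
   (real \<Rightarrow> 'w \<Rightarrow> real) \<Rightarrow> (real \<Rightarrow> 'w \<Rightarrow> real ^ 'd) \<Rightarrow> bool" where
  "bsde_unique_solution M B T l u b b_bar b_low \<sigma> \<sigma>_bar \<sigma>_low c \<xi> \<eta> Y Z \<longleftrightarrow>
     bsde_solution M B T l u b b_bar b_low \<sigma> \<sigma>_bar \<sigma>_low c \<xi> \<eta> Y Z \<and>
     (\<forall>Y' Z'. bsde_solution M B T l u b b_bar b_low \<sigma> \<sigma>_bar \<sigma>_low c \<xi> \<eta> Y' Z' \<longrightarrow>
        (AE \<omega> in M. \<forall>s\<in>{-l..T + u}. Y' s \<omega> = Y s \<omega>) \<and>
        (AE \<omega> in M. AE s in lborel. s \<in> {-l..T + u} \<longrightarrow> Z' s \<omega> = Z s \<omega>))"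

definition sde_solution ::
  "'w measure \<Rightarrow> (real \<Rightarrow> 'w \<Rightarrow> real ^ 'd) \<Rightarrow> real \<Rightarrow> real \<Rightarrow> real \<Rightarrow>
   (real \<Rightarrow> 'w \<Rightarrow> real) \<Rightarrow> (real \<Rightarrow> 'w \<Rightarrow> real) \<Rightarrow> (real \<Rightarrow> 'w \<Rightarrow> real) \<Rightarrow>
   (real \<Rightarrow> 'w \<Rightarrow> real ^ 'd) \<Rightarrow> (real \<Rightarrow> 'w \<Rightarrow> real ^ 'd) \<Rightarrow> (real \<Rightarrow> 'w \<Rightarrow> real ^ 'd) \<Rightarrow>
   real \<Rightarrow> (real \<Rightarrow> 'w \<Rightarrow> real) \<Rightarrow> bool" where
  "sde_solution M B T l u b b_bar b_low \<sigma> \<sigma>_bar \<sigma>_low t X \<longleftrightarrow>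
     S2_proc M (aug_filtration M B) t T X \<and>
     (\<exists>V W.
        cond_exp_process M (aug_filtration M B) t T (\<lambda>s \<omega>. b_bar (s + l) \<omega> * X (s + l) \<omega>) V \<and>
        cond_exp_process M (aug_filtration M B) t T (\<lambda>s \<omega>. X (s + l) \<omega> *\<^sub>R \<sigma>_bar (s + l) \<omega>) W \<and>
        (\<forall>r\<in>{t<..T}. \<exists>I.
           has_ito_integral M B t r
             (\<lambda>s \<omega>. X s \<omega> *\<^sub>R \<sigma> s \<omega> + X (s - u) \<omega> *\<^sub>R \<sigma>_low s \<omega> + W s \<omega>) I \<and>
           (AE \<omega> in M. X r \<omega> = X t \<omega>
              + (LINT s:{t..r}|lborel. b s \<omega> * X s \<omega> + b_low s \<omega> * X (s - u) \<omega> + V s \<omega>)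
              + I \<omega>))) \<and>
     (\<forall>\<omega>\<in>space M. X t \<omega> = 1) \<and>
     (\<forall>r\<in>{T<..T + l}. \<forall>\<omega>\<in>space M. X r \<omega> = 0) \<and>
     (\<forall>r\<in>{t - u..<t}. \<forall>\<omega>\<in>space M. X r \<omega> = 0)"

definition sde_unique_solution ::
  "'w measure \<Rightarrow> (real \<Rightarrow> 'w \<Rightarrow> real ^ 'd) \<Rightarrow> real \<Rightarrow> real \<Rightarrow> real \<Rightarrow>
   (real \<Rightarrow> 'w \<Rightarrow> real) \<Rightarrow> (real \<Rightarrow> 'w \<Rightarrow> real) \<Rightarrow> (real \<Rightarrow> 'w \<Rightarrow> real) \<Rightarrow>
   (real \<Rightarrow> 'w \<Rightarrow> real ^ 'd) \<Rightarrow> (real \<Rightarrow> 'w \<Rightarrow> real ^ 'd) \<Rightarrow> (real \<Rightarrow> 'w \<Rightarrow> real ^ 'd) \<Rightarrow>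
   real \<Rightarrow> (real \<Rightarrow> 'w \<Rightarrow> real) \<Rightarrow> bool" where
  "sde_unique_solution M B T l u b b_bar b_low \<sigma> \<sigma>_bar \<sigma>_low t X \<longleftrightarrow>
     sde_solution M B T l u b b_bar b_low \<sigma> \<sigma>_bar \<sigma>_low t X \<and>
     (\<forall>X'. sde_solution M B T l u b b_bar b_low \<sigma> \<sigma>_bar \<sigma>_low t X' \<longrightarrow>
        (AE \<omega> in M. \<forall>r\<in>{t - u..T + l}. X' r \<omega> = X r \<omega>))"

end

theory Submission
  imports Defs
begin

text \<open>Write the two equations as \<open>dX = a ds + \<alpha> dB\<close> and \<open>dY = - f ds + Z dB\<close>.  For \<open>A\<close> in \<open>F\<^sub>t\<close>,
integration by parts gives

\<open>E[1\<^sub>A X\<^sub>T Y\<^sub>T] - E[1\<^sub>A X\<^sub>t Y\<^sub>t] = E \<integral>\<^sub>t\<^sup>T 1\<^sub>A (a Y - f X + \<alpha> \<bullet> Z) ds\<close>.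

The theorem follows by writing out \<open>a\<close>, \<open>f\<close> and \<open>\<alpha>\<close>.  The terms with \<open>b Y X\<close> and \<open>\<sigma> X Z\<close> cancel.
A conditional expectation \<open>E[G\<^sub>s | F\<^sub>s]\<close> that is multiplied by an \<open>F\<^sub>s\<close>-measurable factor may be replaced by
\<open>G\<^sub>s\<close>; after a translation of time by \<open>u\<close>, the advanced terms of \<open>f\<close> then are the delayed terms of
\<open>a\<close> and \<open>\<alpha>\<close>, and after a translation by \<open>l\<close> the advanced terms of \<open>a\<close> and \<open>\<alpha>\<close> are the delayed
terms of \<open>f\<close>.  The two equations are adjoint to each other in this sense.  As \<open>X\<close> vanishes before \<open>t\<close> and
after \<open>T\<close>, the translated integrals cancel except over \<open>[T, T + u]\<close> and \<open>[t, t + l]\<close>, and with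
\<open>X\<^sub>t = 1\<close> the identity says that \<open>Y\<^sub>t\<close> and the random variable under the conditional expectation have
the same integral over every \<open>A\<close> (lemmas \<open>duality\<close> and \<open>representation\<close>).

Integration by parts is needed in expectation only, and this is a statement about \<open>L\<^sup>2\<close> (lemma
\<open>product_rule\<close>).  Say that \<open>X\<close> has drift \<open>a\<close> if \<open>X\<^sub>T - X\<^sub>s - \<integral>\<^sub>s\<^sup>T a\<^sub>r dr\<close> is orthogonal to
\<open>L\<^sup>2(F\<^sub>s)\<close> for every \<open>s\<close>.  Then \<open>X\<^sub>s\<close> may be replaced by \<open>X\<^sub>T - \<integral>\<^sub>s\<^sup>T a\<^sub>r dr\<close> in the
integral of \<open>f\<^sub>s X\<^sub>s\<close>, likewise for \<open>Y\<close>, and the two double integrals that arise add up to the product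
of the full drift integrals by Fubini on a triangle.  What is left is the expectation of the product of two
stochastic integrals, which the Ito isometry evaluates.

The Ito integral is given as an \<open>L\<^sup>2\<close> limit of integrals of step integrands.  Isometry and martingale
property are therefore proved for step integrands, from the independence of the increment \<open>B\<^sub>t - B\<^sub>s\<close> and the
augmented sigma-algebra \<open>F\<^sub>s\<close>, and carried over to the limit.

At \<open>t = 0\<close> the sigma-algebra \<open>F\<^sub>0\<close> is trivial, so \<open>Y\<^sub>0\<close> is almost surely constant.  On
\<open>[0, l)\<close> the delayed values are \<open>Y\<^sub>0\<close> and \<open>0\<close>, hence the representation becomes a linear equation for
this constant (lemma \<open>initial_value\<close>).\<close>

section \<open>Square integrable functions\<close>

definition L2_fun :: "'a measure \<Rightarrow> ('a \<Rightarrow> 'b::euclidean_space) \<Rightarrow> bool" where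
  "L2_fun N f \<longleftrightarrow> f \<in> borel_measurable N \<and> integrable N (\<lambda>x. (norm (f x))\<^sup>2)"

lemma L2_fun_measurable [measurable_dest]: "L2_fun N f \<Longrightarrow> f \<in> borel_measurable N"
  by (simp add: L2_fun_def)

lemma L2_fun_bound:
  fixes f :: "'a \<Rightarrow> 'b::euclidean_space" and g :: "'a \<Rightarrow> 'c::euclidean_space"
  assumes f: "L2_fun N f" and g: "g \<in> borel_measurable N"
    and le: "AE x in N. norm (g x) \<le> K * norm (f x)"
  shows "L2_fun N g"
  unfolding L2_fun_def
proof (intro conjI g)
  have 1: "integrable N (\<lambda>x. K\<^sup>2 * (norm (f x))\<^sup>2)"
    using f by (simp add: L2_fun_def)
  show "integrable N (\<lambda>x. (norm (g x))\<^sup>2)"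
  proof (rule Bochner_Integration.integrable_bound[OF 1])
    show "(\<lambda>x. (norm (g x))\<^sup>2) \<in> borel_measurable N" using g by measurable
    show "AE x in N. norm ((norm (g x))\<^sup>2) \<le> norm (K\<^sup>2 * (norm (f x))\<^sup>2)"
      using le
    proof eventually_elim
      case (elim x)
      then have "(norm (g x))\<^sup>2 \<le> (K * norm (f x))\<^sup>2"
        by (intro power_mono) auto
      then show "norm ((norm (g x))\<^sup>2) \<le> norm (K\<^sup>2 * (norm (f x))\<^sup>2)"
        by (simp add: power_mult_distrib)
    qed
  qed
qed

lemma L2_fun_cong:
  assumes "\<And>x. x \<in> space N \<Longrightarrow> f x = g x"
  shows "L2_fun N f \<longleftrightarrow> L2_fun N g"
proof -
  have 1: "f \<in> borel_measurable N \<longleftrightarrow> g \<in> borel_measurable N"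
    using assms by (rule measurable_cong)
  have 2: "integrable N (\<lambda>x. (norm (f x))\<^sup>2) \<longleftrightarrow> integrable N (\<lambda>x. (norm (g x))\<^sup>2)"
    using assms by (intro Bochner_Integration.integrable_cong) auto
  show ?thesis unfolding L2_fun_def 1 2 ..
qed

lemma L2_fun_zero [simp]: "L2_fun N (\<lambda>x. 0)"
  by (simp add: L2_fun_def)

lemma L2_fun_add:
  fixes f g :: "'a \<Rightarrow> 'b::euclidean_space"
  assumes f: "L2_fun N f" and g: "L2_fun N g"
  shows "L2_fun N (\<lambda>x. f x + g x)"
  unfolding L2_fun_def
proof
  have [measurable]: "f \<in> borel_measurable N" "g \<in> borel_measurable N"
    using f g by (auto simp: L2_fun_def)
  show "(\<lambda>x. f x + g x) \<in> borel_measurable N" by measurable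
  have 1: "integrable N (\<lambda>x. 2 * (norm (f x))\<^sup>2 + 2 * (norm (g x))\<^sup>2)"
    using f g by (simp add: L2_fun_def)
  show "integrable N (\<lambda>x. (norm (f x + g x))\<^sup>2)"
  proof (rule Bochner_Integration.integrable_bound[OF 1])
    show "AE x in N. norm ((norm (f x + g x))\<^sup>2) \<le> norm (2 * (norm (f x))\<^sup>2 + 2 * (norm (g x))\<^sup>2)"
    proof (rule AE_I2)
      fix x
      have "(norm (f x + g x))\<^sup>2 \<le> (norm (f x) + norm (g x))\<^sup>2"
        by (intro power_mono norm_triangle_ineq) auto
      also have "\<dots> \<le> 2 * (norm (f x))\<^sup>2 + 2 * (norm (g x))\<^sup>2"
        using sum_squares_bound[of "norm (f x)" "norm (g x)"] by (simp add: power2_sum)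
      finally show "norm ((norm (f x + g x))\<^sup>2) \<le> norm (2 * (norm (f x))\<^sup>2 + 2 * (norm (g x))\<^sup>2)"
        by simp
    qed
  qed simp
qed

lemma L2_fun_bounded_scaleR:
  fixes f :: "'a \<Rightarrow> 'b::euclidean_space"
  assumes f: "L2_fun N f" and h: "h \<in> borel_measurable N"
    and le: "\<And>x. x \<in> space N \<Longrightarrow> \<bar>h x\<bar> \<le> K"
  shows "L2_fun N (\<lambda>x. h x *\<^sub>R f x)"
proof (rule L2_fun_bound[OF f])
  have [measurable]: "f \<in> borel_measurable N" using f by (simp add: L2_fun_def)
  show "(\<lambda>x. h x *\<^sub>R f x) \<in> borel_measurable N" using h by measurable
  show "AE x in N. norm (h x *\<^sub>R f x) \<le> K * norm (f x)"
    using le by (intro AE_I2) (simp add: mult_right_mono)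
qed

lemma L2_fun_uminus:
  fixes f :: "'a \<Rightarrow> 'b::euclidean_space"
  shows "L2_fun N f \<Longrightarrow> L2_fun N (\<lambda>x. - f x)"
  using L2_fun_bounded_scaleR[of N f "\<lambda>_. -1" 1] by simp

lemma L2_fun_diff:
  fixes f g :: "'a \<Rightarrow> 'b::euclidean_space"
  assumes "L2_fun N f" "L2_fun N g"
  shows "L2_fun N (\<lambda>x. f x - g x)"
  using L2_fun_add[OF assms(1) L2_fun_uminus[OF assms(2)]] by simp

lemma L2_fun_sum:
  fixes f :: "'i \<Rightarrow> 'a \<Rightarrow> 'b::euclidean_space"
  assumes "\<And>i. i \<in> I \<Longrightarrow> L2_fun N (f i)"
  shows "L2_fun N (\<lambda>x. \<Sum>i\<in>I. f i x)"
  using assms by (induction I rule: infinite_finite_induct) (auto intro: L2_fun_add)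

lemma integrable_inner_L2:
  fixes f g :: "'a \<Rightarrow> 'b::euclidean_space"
  assumes f: "L2_fun N f" and g: "L2_fun N g"
  shows "integrable N (\<lambda>x. f x \<bullet> g x)"
proof -
  have [measurable]: "f \<in> borel_measurable N" "g \<in> borel_measurable N"
    using f g by (auto simp: L2_fun_def)
  have 1: "integrable N (\<lambda>x. (norm (f x))\<^sup>2 + (norm (g x))\<^sup>2)"
    using f g by (simp add: L2_fun_def)
  show ?thesis
  proof (rule Bochner_Integration.integrable_bound[OF 1])
    show "AE x in N. norm (f x \<bullet> g x) \<le> norm ((norm (f x))\<^sup>2 + (norm (g x))\<^sup>2)"
    proof (rule AE_I2)
      fix x
      have "\<bar>f x \<bullet> g x\<bar> \<le> norm (f x) * norm (g x)" by (rule Cauchy_Schwarz_ineq2)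
      also have "\<dots> \<le> (norm (f x))\<^sup>2 + (norm (g x))\<^sup>2"
        using sum_squares_bound[of "norm (f x)" "norm (g x)"]
          mult_nonneg_nonneg[OF norm_ge_zero[of "f x"] norm_ge_zero[of "g x"]] by linarith
      finally show "norm (f x \<bullet> g x) \<le> norm ((norm (f x))\<^sup>2 + (norm (g x))\<^sup>2)" by simp
    qed
  qed simp
qed

lemma integrable_mult_L2:
  fixes f g :: "'a \<Rightarrow> real"
  assumes "L2_fun N f" "L2_fun N g"
  shows "integrable N (\<lambda>x. f x * g x)"
  using integrable_inner_L2[OF assms] by simp

lemma Cauchy_Schwarz_L2:
  fixes f g :: "'a \<Rightarrow> 'b::euclidean_space"
  assumes f: "L2_fun N f" and g: "L2_fun N g"
  shows "\<bar>\<integral>x. f x \<bullet> g x \<partial>N\<bar> \<le> sqrt (\<integral>x. (norm (f x))\<^sup>2 \<partial>N) * sqrt (\<integral>x. (norm (g x))\<^sup>2 \<partial>N)"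
proof -
  define A B C where "A = (\<integral>x. (norm (f x))\<^sup>2 \<partial>N)" and "B = (\<integral>x. f x \<bullet> g x \<partial>N)"
    and "C = (\<integral>x. (norm (g x))\<^sup>2 \<partial>N)"
  have quad: "0 \<le> A + 2 * c * B + c\<^sup>2 * C" for c
  proof -
    have "0 \<le> (\<integral>x. (norm (f x + c *\<^sub>R g x))\<^sup>2 \<partial>N)" by simp
    also have "\<dots> = (\<integral>x. (norm (f x))\<^sup>2 + 2 * c * (f x \<bullet> g x) + c\<^sup>2 * (norm (g x))\<^sup>2 \<partial>N)"
      unfolding power2_norm_eq_inner
      by (intro Bochner_Integration.integral_cong)
        (simp_all add: inner_add_left inner_add_right inner_commute algebra_simps power2_eq_square
          del: dot_square_norm)
    also have "\<dots> = A + 2 * c * B + c\<^sup>2 * C"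
      using f g integrable_inner_L2[OF f g] unfolding A_def B_def C_def by (simp add: L2_fun_def)
    finally show ?thesis .
  qed
  have A0: "A \<ge> 0" and C0: "C \<ge> 0" unfolding A_def C_def by auto
  \<comment> \<open>the quadratic is nonnegative at its minimum \<open>c = - B / C\<close>; if \<open>C = 0\<close> it is affine\<close>
  have "B\<^sup>2 \<le> A * C"
  proof (cases "C = 0")
    case True
    have "B = 0"
    proof (rule ccontr)
      assume "B \<noteq> 0"
      then show False using quad[of "- (A + 1) / (2 * B)"] True A0 by (simp add: field_simps)
    qed
    then show ?thesis using True by simp
  next
    case False
    then have "0 < C" using C0 by simp
    have "0 \<le> A - B\<^sup>2 / C"
      using quad[of "- B / C"] \<open>0 < C\<close> by (simp add: field_simps power2_eq_square)
    then show ?thesis using \<open>0 < C\<close> by (simp add: field_simps)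
  qed
  then have "sqrt (B\<^sup>2) \<le> sqrt (A * C)" by (rule real_sqrt_le_mono)
  then show ?thesis unfolding A_def B_def C_def by (simp add: real_sqrt_mult)
qed

definition L2_tendsto :: "'a measure \<Rightarrow> (nat \<Rightarrow> 'a \<Rightarrow> 'b::euclidean_space) \<Rightarrow> ('a \<Rightarrow> 'b) \<Rightarrow> bool" where
  "L2_tendsto N f g \<longleftrightarrow> (\<forall>k. L2_fun N (f k)) \<and> L2_fun N g \<and>
     (\<lambda>k. \<integral>x. (norm (f k x - g x))\<^sup>2 \<partial>N) \<longlonglongrightarrow> 0"

lemma tendsto_zero_bound:
  fixes f g :: "nat \<Rightarrow> real"
  assumes "\<And>k. \<bar>f k\<bar> \<le> g k" "g \<longlonglongrightarrow> 0"
  shows "f \<longlonglongrightarrow> 0"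
  using assms by (intro Lim_null_comparison[of f g sequentially]) auto

lemma L2_tendsto_nn_integral:
  fixes f :: "nat \<Rightarrow> 'a \<Rightarrow> 'b::euclidean_space"
  assumes f: "\<And>k. L2_fun N (f k)" and g: "L2_fun N g"
    and lim: "(\<lambda>k. \<integral>\<^sup>+x. ennreal ((norm (f k x - g x))\<^sup>2) \<partial>N) \<longlonglongrightarrow> 0"
  shows "L2_tendsto N f g"
proof -
  have "(\<integral>\<^sup>+x. ennreal ((norm (f k x - g x))\<^sup>2) \<partial>N) = ennreal (\<integral>x. (norm (f k x - g x))\<^sup>2 \<partial>N)" for k
    using L2_fun_diff[OF f[of k] g] by (intro nn_integral_eq_integral) (auto simp: L2_fun_def)
  then have "(\<lambda>k. ennreal (\<integral>x. (norm (f k x - g x))\<^sup>2 \<partial>N)) \<longlonglongrightarrow> ennreal 0"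
    using lim by simp
  then have "(\<lambda>k. \<integral>x. (norm (f k x - g x))\<^sup>2 \<partial>N) \<longlonglongrightarrow> 0"
    by (rule tendsto_ennrealD) auto
  with f g show ?thesis by (simp add: L2_tendsto_def)
qed

text \<open>Identities for step integrands pass to their limits in this way.\<close>

lemma tendsto_integral_inner_L2:
  fixes f g :: "nat \<Rightarrow> 'a \<Rightarrow> 'b::euclidean_space"
  assumes f: "L2_tendsto N f F" and g: "L2_tendsto N g G"
  shows "(\<lambda>k. \<integral>x. f k x \<bullet> g k x \<partial>N) \<longlonglongrightarrow> (\<integral>x. F x \<bullet> G x \<partial>N)"
proof -
  have [intro]: "L2_fun N (f k)" "L2_fun N (g k)" and F: "L2_fun N F" and G: "L2_fun N G" for k
    using f g by (auto simp: L2_tendsto_def)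
  let ?n = "\<lambda>h. sqrt (\<integral>x. (norm (h x))\<^sup>2 \<partial>N)"
  define a b where "a k = ?n (\<lambda>x. f k x - F x)" and "b k = ?n (\<lambda>x. g k x - G x)" for k
  have a: "a \<longlonglongrightarrow> 0" and b: "b \<longlonglongrightarrow> 0"
    using f g tendsto_real_sqrt[of "\<lambda>k. \<integral>x. (norm (f k x - F x))\<^sup>2 \<partial>N" 0 sequentially]
      tendsto_real_sqrt[of "\<lambda>k. \<integral>x. (norm (g k x - G x))\<^sup>2 \<partial>N" 0 sequentially]
    by (simp_all add: a_def[abs_def] b_def[abs_def] L2_tendsto_def)
  have le: "\<bar>(\<integral>x. f k x \<bullet> g k x \<partial>N) - (\<integral>x. F x \<bullet> G x \<partial>N)\<bar> \<le> a k * b k + a k * ?n G + ?n F * b k" for k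
  proof -
    have df: "L2_fun N (\<lambda>x. f k x - F x)" and dg: "L2_fun N (\<lambda>x. g k x - G x)"
      using F G by (auto intro!: L2_fun_diff)
    have "(\<integral>x. f k x \<bullet> g k x \<partial>N) - (\<integral>x. F x \<bullet> G x \<partial>N) =
        (\<integral>x. f k x \<bullet> g k x - F x \<bullet> G x \<partial>N)"
      by (intro Bochner_Integration.integral_diff[symmetric] integrable_inner_L2 F G) auto
    also have "\<dots> = (\<integral>x. (f k x - F x) \<bullet> (g k x - G x) + (f k x - F x) \<bullet> G x + F x \<bullet> (g k x - G x) \<partial>N)"
      by (intro Bochner_Integration.integral_cong) (auto simp: algebra_simps)
    also have "\<dots> = (\<integral>x. (f k x - F x) \<bullet> (g k x - G x) \<partial>N) + (\<integral>x. (f k x - F x) \<bullet> G x \<partial>N)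
        + (\<integral>x. F x \<bullet> (g k x - G x) \<partial>N)"
      using integrable_inner_L2[OF df dg] integrable_inner_L2[OF df G] integrable_inner_L2[OF F dg]
      by simp
    finally show ?thesis
      using Cauchy_Schwarz_L2[OF df dg] Cauchy_Schwarz_L2[OF df G] Cauchy_Schwarz_L2[OF F dg]
      unfolding a_def b_def by linarith
  qed
  have lim: "(\<lambda>k. a k * b k + a k * ?n G + ?n F * b k) \<longlonglongrightarrow> 0 * 0 + 0 * ?n G + ?n F * 0"
    by (intro tendsto_intros a b)
  have "(\<lambda>k. (\<integral>x. f k x \<bullet> g k x \<partial>N) - (\<integral>x. F x \<bullet> G x \<partial>N)) \<longlonglongrightarrow> 0"
    by (rule tendsto_zero_bound[OF _ lim[simplified]]) (use le in simp)
  then show ?thesis by (rule LIM_zero_cancel)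
qed

lemma L2_tendsto_const: "L2_fun N f \<Longrightarrow> L2_tendsto N (\<lambda>k. f) f"
  by (simp add: L2_tendsto_def)

lemma L2_tendsto_bounded_scaleR:
  fixes f :: "nat \<Rightarrow> 'a \<Rightarrow> 'b::euclidean_space"
  assumes f: "L2_tendsto N f F" and h: "h \<in> borel_measurable N"
    and h_le: "\<And>x. x \<in> space N \<Longrightarrow> \<bar>h x\<bar> \<le> K"
  shows "L2_tendsto N (\<lambda>k x. h x *\<^sub>R f k x) (\<lambda>x. h x *\<^sub>R F x)"
proof -
  have [intro]: "L2_fun N (f k)" "L2_fun N F" for k using f by (auto simp: L2_tendsto_def)
  have le: "(\<integral>x. (norm (h x *\<^sub>R f k x - h x *\<^sub>R F x))\<^sup>2 \<partial>N) \<le> K\<^sup>2 * (\<integral>x. (norm (f k x - F x))\<^sup>2 \<partial>N)" for k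
  proof -
    have d: "L2_fun N (\<lambda>x. f k x - F x)" by (auto intro!: L2_fun_diff)
    have "(\<integral>x. (norm (h x *\<^sub>R (f k x - F x)))\<^sup>2 \<partial>N) \<le> (\<integral>x. K\<^sup>2 * (norm (f k x - F x))\<^sup>2 \<partial>N)"
    proof (rule integral_mono)
      show "integrable N (\<lambda>x. (norm (h x *\<^sub>R (f k x - F x)))\<^sup>2)"
        using L2_fun_bounded_scaleR[OF d h h_le] by (simp add: L2_fun_def)
      show "integrable N (\<lambda>x. K\<^sup>2 * (norm (f k x - F x))\<^sup>2)" using d by (simp add: L2_fun_def)
      fix x assume "x \<in> space N"
      then have "\<bar>h x\<bar>\<^sup>2 \<le> K\<^sup>2" using h_le by (intro power_mono) auto
      then show "(norm (h x *\<^sub>R (f k x - F x)))\<^sup>2 \<le> K\<^sup>2 * (norm (f k x - F x))\<^sup>2"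
        by (simp add: power_mult_distrib mult_right_mono)
    qed
    then show ?thesis by (simp add: scaleR_diff_right)
  qed
  have lim: "(\<lambda>k. K\<^sup>2 * (\<integral>x. (norm (f k x - F x))\<^sup>2 \<partial>N)) \<longlonglongrightarrow> K\<^sup>2 * 0"
    using f by (intro tendsto_intros) (simp add: L2_tendsto_def)
  have "(\<lambda>k. \<integral>x. (norm (h x *\<^sub>R f k x - h x *\<^sub>R F x))\<^sup>2 \<partial>N) \<longlonglongrightarrow> 0"
    by (rule tendsto_zero_bound[OF _ lim[simplified]]) (use le in simp)
  then show ?thesis
    unfolding L2_tendsto_def using L2_fun_bounded_scaleR[OF _ h h_le] by auto
qed

lemma L2_tendsto_triangle:
  fixes f g :: "nat \<Rightarrow> 'a \<Rightarrow> 'b::euclidean_space"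
  assumes f: "L2_tendsto N f F" and g: "\<And>k. L2_fun N (g k)"
    and d: "(\<lambda>k. \<integral>x. (norm (g k x - f k x))\<^sup>2 \<partial>N) \<longlonglongrightarrow> 0"
  shows "L2_tendsto N g F"
proof -
  have [intro]: "L2_fun N (f k)" "L2_fun N F" for k using f by (auto simp: L2_tendsto_def)
  have le: "(\<integral>x. (norm (g k x - F x))\<^sup>2 \<partial>N)
      \<le> 2 * (\<integral>x. (norm (g k x - f k x))\<^sup>2 \<partial>N) + 2 * (\<integral>x. (norm (f k x - F x))\<^sup>2 \<partial>N)" for k
  proof -
    have i: "integrable N (\<lambda>x. (norm (g k x - f k x))\<^sup>2)" "integrable N (\<lambda>x. (norm (f k x - F x))\<^sup>2)"
      "integrable N (\<lambda>x. (norm (g k x - F x))\<^sup>2)"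
      using L2_fun_diff[OF g[of k], of "f k"] L2_fun_diff[of N "f k" F] L2_fun_diff[OF g[of k], of F]
      by (auto simp: L2_fun_def[of N "\<lambda>x. _ x - _ x"])
    have "(\<integral>x. (norm (g k x - F x))\<^sup>2 \<partial>N)
        \<le> (\<integral>x. 2 * (norm (g k x - f k x))\<^sup>2 + 2 * (norm (f k x - F x))\<^sup>2 \<partial>N)"
    proof (rule integral_mono)
      fix x
      have "(norm (g k x - F x))\<^sup>2 \<le> (norm (g k x - f k x) + norm (f k x - F x))\<^sup>2"
        using norm_triangle_ineq[of "g k x - f k x" "f k x - F x"] by (intro power_mono) auto
      also have "\<dots> \<le> 2 * (norm (g k x - f k x))\<^sup>2 + 2 * (norm (f k x - F x))\<^sup>2"
        using sum_squares_bound[of "norm (g k x - f k x)" "norm (f k x - F x)"]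
        by (simp add: power2_sum)
      finally show "(norm (g k x - F x))\<^sup>2 \<le> 2 * (norm (g k x - f k x))\<^sup>2 + 2 * (norm (f k x - F x))\<^sup>2" .
    qed (use i in auto)
    also have "\<dots> = 2 * (\<integral>x. (norm (g k x - f k x))\<^sup>2 \<partial>N) + 2 * (\<integral>x. (norm (f k x - F x))\<^sup>2 \<partial>N)"
      using i by simp
    finally show ?thesis .
  qed
  have lim: "(\<lambda>k. 2 * (\<integral>x. (norm (g k x - f k x))\<^sup>2 \<partial>N) + 2 * (\<integral>x. (norm (f k x - F x))\<^sup>2 \<partial>N))
      \<longlonglongrightarrow> 2 * 0 + 2 * 0"
    using f by (intro tendsto_intros d) (simp add: L2_tendsto_def)
  have "(\<lambda>k. \<integral>x. (norm (g k x - F x))\<^sup>2 \<partial>N) \<longlonglongrightarrow> 0"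
    by (rule tendsto_zero_bound[OF _ lim[simplified]]) (use le in simp)
  then show ?thesis unfolding L2_tendsto_def using g by auto
qed

section \<open>Processes as functions on the product of time and probability space\<close>

text \<open>A process on a time set \<open>S\<close> is cut off outside \<open>S\<close> and regarded as one function on the product of
Lebesgue measure and \<open>M\<close>.  Processes over different intervals then live on the same sigma-finite measure
space, and splitting, translating and interchanging integrals are operations on one Bochner integral.\<close>

definition meas_on :: "'w measure \<Rightarrow> real set \<Rightarrow> (real \<Rightarrow> 'w \<Rightarrow> 'b::euclidean_space) \<Rightarrow> bool" where
  "meas_on M S \<psi> \<longleftrightarrow>
     (\<lambda>x. indicat_real S (fst x) *\<^sub>R \<psi> (fst x) (snd x)) \<in> borel_measurable (lborel \<Otimes>\<^sub>M M)"

definition sq_on :: "'w measure \<Rightarrow> real set \<Rightarrow> (real \<Rightarrow> 'w \<Rightarrow> 'b::euclidean_space) \<Rightarrow> bool" where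
  "sq_on M S \<psi> \<longleftrightarrow> L2_fun (lborel \<Otimes>\<^sub>M M) (\<lambda>x. indicat_real S (fst x) *\<^sub>R \<psi> (fst x) (snd x))"

definition bdd_on :: "'w measure \<Rightarrow> real set \<Rightarrow> (real \<Rightarrow> 'w \<Rightarrow> 'b::euclidean_space) \<Rightarrow> bool" where
  "bdd_on M S \<psi> \<longleftrightarrow> meas_on M S \<psi> \<and> (\<exists>K. \<forall>s\<in>S. \<forall>\<omega>\<in>space M. norm (\<psi> s \<omega>) \<le> K)"

definition int_on :: "'w measure \<Rightarrow> real set \<Rightarrow> (real \<Rightarrow> 'w \<Rightarrow> real) \<Rightarrow> bool" where
  "int_on M S p \<longleftrightarrow> integrable (lborel \<Otimes>\<^sub>M M) (\<lambda>x. indicat_real S (fst x) * p (fst x) (snd x))"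

text \<open>The expectation of \<open>\<integral>\<^sub>S p\<^sub>s ds\<close>, as lemma \<open>pint_eq_LINT\<close> shows.\<close>

definition pint :: "'w measure \<Rightarrow> real set \<Rightarrow> (real \<Rightarrow> 'w \<Rightarrow> real) \<Rightarrow> real" where
  "pint M S p = (\<integral>x. indicat_real S (fst x) * p (fst x) (snd x) \<partial>(lborel \<Otimes>\<^sub>M M))"

lemma sq_on_meas: "sq_on M S \<psi> \<Longrightarrow> meas_on M S \<psi>"
  by (simp add: sq_on_def meas_on_def L2_fun_def)

lemma bdd_on_meas: "bdd_on M S \<psi> \<Longrightarrow> meas_on M S \<psi>"
  by (simp add: bdd_on_def)

lemma meas_on_subset:
  assumes "meas_on M S \<psi>" "S' \<subseteq> S" "S' \<in> sets borel"
  shows "meas_on M S' \<psi>"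
proof -
  have "(\<lambda>x. indicat_real S' (fst x) *\<^sub>R (indicat_real S (fst x) *\<^sub>R \<psi> (fst x) (snd x)))
      \<in> borel_measurable (lborel \<Otimes>\<^sub>M M)"
    using assms unfolding meas_on_def by measurable
  also have "(\<lambda>x. indicat_real S' (fst x) *\<^sub>R (indicat_real S (fst x) *\<^sub>R \<psi> (fst x) (snd x))) =
      (\<lambda>x. indicat_real S' (fst x) *\<^sub>R \<psi> (fst x) (snd x))"
    using assms(2) by (auto simp: fun_eq_iff indicator_def)
  finally show ?thesis by (simp add: meas_on_def)
qed

lemma bdd_on_subset: "bdd_on M S \<psi> \<Longrightarrow> S' \<subseteq> S \<Longrightarrow> S' \<in> sets borel \<Longrightarrow> bdd_on M S' \<psi>"
  unfolding bdd_on_def using meas_on_subset by blast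

lemma sq_on_bound:
  fixes \<psi> :: "real \<Rightarrow> 'w \<Rightarrow> 'b::euclidean_space" and \<theta> :: "real \<Rightarrow> 'w \<Rightarrow> 'c::euclidean_space"
  assumes "sq_on M S \<psi>" "meas_on M S \<theta>"
    and "\<And>s \<omega>. s \<in> S \<Longrightarrow> \<omega> \<in> space M \<Longrightarrow> norm (\<theta> s \<omega>) \<le> K * norm (\<psi> s \<omega>)"
  shows "sq_on M S \<theta>"
  unfolding sq_on_def
proof (rule L2_fun_bound)
  show "L2_fun (lborel \<Otimes>\<^sub>M M) (\<lambda>x. indicat_real S (fst x) *\<^sub>R \<psi> (fst x) (snd x))"
    using assms(1) by (simp add: sq_on_def)
  show "(\<lambda>x. indicat_real S (fst x) *\<^sub>R \<theta> (fst x) (snd x)) \<in> borel_measurable (lborel \<Otimes>\<^sub>M M)"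
    using assms(2) by (simp add: meas_on_def)
  show "AE x in lborel \<Otimes>\<^sub>M M. norm (indicat_real S (fst x) *\<^sub>R \<theta> (fst x) (snd x))
      \<le> K * norm (indicat_real S (fst x) *\<^sub>R \<psi> (fst x) (snd x))"
    using assms(3) by (intro AE_I2) (auto simp: space_pair_measure indicator_def)
qed

lemma sq_on_subset:
  assumes "sq_on M S \<psi>" "S' \<subseteq> S" "S' \<in> sets borel"
  shows "sq_on M S' \<psi>"
  unfolding sq_on_def
proof (rule L2_fun_bound)
  show "L2_fun (lborel \<Otimes>\<^sub>M M) (\<lambda>x. indicat_real S (fst x) *\<^sub>R \<psi> (fst x) (snd x))"
    using assms(1) by (simp add: sq_on_def)
  show "(\<lambda>x. indicat_real S' (fst x) *\<^sub>R \<psi> (fst x) (snd x)) \<in> borel_measurable (lborel \<Otimes>\<^sub>M M)"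
    using meas_on_subset[OF sq_on_meas[OF assms(1)] assms(2,3)] by (simp add: meas_on_def)
  show "AE x in lborel \<Otimes>\<^sub>M M. norm (indicat_real S' (fst x) *\<^sub>R \<psi> (fst x) (snd x))
      \<le> 1 * norm (indicat_real S (fst x) *\<^sub>R \<psi> (fst x) (snd x))"
    using assms(2) by (intro AE_I2) (auto simp: indicator_def)
qed

lemma sq_on_cong:
  assumes "\<And>s \<omega>. s \<in> S \<Longrightarrow> \<omega> \<in> space M \<Longrightarrow> \<psi> s \<omega> = \<theta> s \<omega>"
  shows "sq_on M S \<psi> \<longleftrightarrow> sq_on M S \<theta>"
  unfolding sq_on_def using assms
  by (intro L2_fun_cong) (auto simp: space_pair_measure indicator_def)

lemma sq_on_Un:
  assumes "sq_on M S \<psi>" "sq_on M S' \<psi>" "S \<in> sets borel" "S' \<in> sets borel"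
  shows "sq_on M (S \<union> S') \<psi>"
proof -
  have "L2_fun (lborel \<Otimes>\<^sub>M M) (\<lambda>x. indicat_real S (fst x) *\<^sub>R \<psi> (fst x) (snd x) +
      indicat_real (S' - S) (fst x) *\<^sub>R \<psi> (fst x) (snd x))"
    using assms(1) sq_on_subset[OF assms(2), of "S' - S"] assms(3,4)
    by (intro L2_fun_add) (auto simp: sq_on_def)
  then show ?thesis
    unfolding sq_on_def
    by (rule L2_fun_cong[THEN iffD1, rotated]) (auto simp: indicator_def)
qed

lemma sq_on_zero [simp]: "sq_on M S (\<lambda>s \<omega>. 0)"
  by (simp add: sq_on_def)

lemma sq_on_add: "sq_on M S \<psi> \<Longrightarrow> sq_on M S \<theta> \<Longrightarrow> sq_on M S (\<lambda>s \<omega>. \<psi> s \<omega> + \<theta> s \<omega>)"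
  unfolding sq_on_def using L2_fun_add by (fastforce simp: scaleR_add_right)

lemma sq_on_uminus: "sq_on M S \<psi> \<Longrightarrow> sq_on M S (\<lambda>s \<omega>. - \<psi> s \<omega>)"
  unfolding sq_on_def using L2_fun_uminus by fastforce

lemma sq_on_diff: "sq_on M S \<psi> \<Longrightarrow> sq_on M S \<theta> \<Longrightarrow> sq_on M S (\<lambda>s \<omega>. \<psi> s \<omega> - \<theta> s \<omega>)"
  using sq_on_add[of M S \<psi> "\<lambda>s \<omega>. - \<theta> s \<omega>"] sq_on_uminus[of M S \<theta>] by simp

lemma meas_on_scaleR:
  assumes "meas_on M S h" "meas_on M S \<psi>"
  shows "meas_on M S (\<lambda>s \<omega>. h s \<omega> *\<^sub>R \<psi> s \<omega>)"
proof -
  have "(\<lambda>x. (indicat_real S (fst x) *\<^sub>R h (fst x) (snd x)) *\<^sub>R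
      (indicat_real S (fst x) *\<^sub>R \<psi> (fst x) (snd x))) \<in> borel_measurable (lborel \<Otimes>\<^sub>M M)"
    using assms unfolding meas_on_def by (rule borel_measurable_scaleR)
  then show ?thesis unfolding meas_on_def
    by (rule measurable_cong[THEN iffD1, rotated]) (auto simp: indicator_def)
qed

lemma meas_on_inner:
  assumes "meas_on M S \<phi>" "meas_on M S \<psi>"
  shows "meas_on M S (\<lambda>s \<omega>. \<phi> s \<omega> \<bullet> \<psi> s \<omega>)"
proof -
  have "(\<lambda>x. (indicat_real S (fst x) *\<^sub>R \<phi> (fst x) (snd x)) \<bullet>
      (indicat_real S (fst x) *\<^sub>R \<psi> (fst x) (snd x))) \<in> borel_measurable (lborel \<Otimes>\<^sub>M M)"
    using assms unfolding meas_on_def by (rule borel_measurable_inner)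
  then show ?thesis unfolding meas_on_def
    by (rule measurable_cong[THEN iffD1, rotated]) (auto simp: indicator_def)
qed

lemma sq_on_inner_bdd:
  assumes "bdd_on M S \<phi>" "sq_on M S \<psi>"
  shows "sq_on M S (\<lambda>s \<omega>. \<phi> s \<omega> \<bullet> \<psi> s \<omega>)"
proof -
  obtain K where K: "\<And>s \<omega>. s \<in> S \<Longrightarrow> \<omega> \<in> space M \<Longrightarrow> norm (\<phi> s \<omega>) \<le> K"
    using assms(1) by (auto simp: bdd_on_def)
  show ?thesis
  proof (rule sq_on_bound[OF assms(2)])
    show "meas_on M S (\<lambda>s \<omega>. \<phi> s \<omega> \<bullet> \<psi> s \<omega>)"
      by (intro meas_on_inner bdd_on_meas sq_on_meas assms)
    show "norm (\<phi> s \<omega> \<bullet> \<psi> s \<omega>) \<le> K * norm (\<psi> s \<omega>)" if "s \<in> S" "\<omega> \<in> space M" for s \<omega>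
      using Cauchy_Schwarz_ineq2[of "\<phi> s \<omega>" "\<psi> s \<omega>"] mult_right_mono[OF K[OF that], of "norm (\<psi> s \<omega>)"]
      by simp
  qed
qed

lemma sq_on_mult_bdd:
  fixes \<phi> \<psi> :: "real \<Rightarrow> 'w \<Rightarrow> real"
  assumes "bdd_on M S \<phi>" "sq_on M S \<psi>"
  shows "sq_on M S (\<lambda>s \<omega>. \<phi> s \<omega> * \<psi> s \<omega>)"
  using sq_on_inner_bdd[OF assms] by simp

lemma sq_on_scaleR_bdd:
  assumes "sq_on M S X" "bdd_on M S \<phi>"
  shows "sq_on M S (\<lambda>s \<omega>. X s \<omega> *\<^sub>R \<phi> s \<omega>)"
proof -
  obtain K where K: "\<And>s \<omega>. s \<in> S \<Longrightarrow> \<omega> \<in> space M \<Longrightarrow> norm (\<phi> s \<omega>) \<le> K"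
    using assms(2) by (auto simp: bdd_on_def)
  show ?thesis
  proof (rule sq_on_bound[OF assms(1)])
    show "meas_on M S (\<lambda>s \<omega>. X s \<omega> *\<^sub>R \<phi> s \<omega>)"
      by (intro meas_on_scaleR bdd_on_meas sq_on_meas assms)
    show "norm (X s \<omega> *\<^sub>R \<phi> s \<omega>) \<le> K * norm (X s \<omega>)" if "s \<in> S" "\<omega> \<in> space M" for s \<omega>
      using mult_right_mono[OF K[OF that], of "norm (X s \<omega>)"] by (simp add: mult.commute)
  qed
qed

lemma bdd_on_const:
  fixes h :: "'w \<Rightarrow> real"
  assumes h: "h \<in> borel_measurable M" and "\<And>\<omega>. \<omega> \<in> space M \<Longrightarrow> \<bar>h \<omega>\<bar> \<le> K" and "S \<in> sets borel"
  shows "bdd_on M S (\<lambda>s. h)"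
  unfolding bdd_on_def meas_on_def using assms by auto

lemma int_on_inner:
  assumes "sq_on M S \<phi>" "sq_on M S \<psi>"
  shows "int_on M S (\<lambda>s \<omega>. \<phi> s \<omega> \<bullet> \<psi> s \<omega>)"
  unfolding int_on_def
  by (rule Bochner_Integration.integrable_cong[THEN iffD1, OF refl _
        integrable_inner_L2[OF assms[unfolded sq_on_def]]])
     (auto simp: indicator_def)

lemma int_on_mult:
  fixes \<phi> \<psi> :: "real \<Rightarrow> 'w \<Rightarrow> real"
  assumes "sq_on M S \<phi>" "sq_on M S \<psi>"
  shows "int_on M S (\<lambda>s \<omega>. \<phi> s \<omega> * \<psi> s \<omega>)"
  using int_on_inner[OF assms] by simp

lemma int_on_add: "int_on M S p \<Longrightarrow> int_on M S q \<Longrightarrow> int_on M S (\<lambda>s \<omega>. p s \<omega> + q s \<omega>)"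
  unfolding int_on_def by (simp add: distrib_left)

lemma int_on_diff: "int_on M S p \<Longrightarrow> int_on M S q \<Longrightarrow> int_on M S (\<lambda>s \<omega>. p s \<omega> - q s \<omega>)"
  unfolding int_on_def by (simp add: right_diff_distrib)

lemma pint_add: "int_on M S p \<Longrightarrow> int_on M S q \<Longrightarrow>
    pint M S (\<lambda>s \<omega>. p s \<omega> + q s \<omega>) = pint M S p + pint M S q"
  unfolding int_on_def pint_def by (simp add: distrib_left)

lemma pint_diff: "int_on M S p \<Longrightarrow> int_on M S q \<Longrightarrow>
    pint M S (\<lambda>s \<omega>. p s \<omega> - q s \<omega>) = pint M S p - pint M S q"
  unfolding int_on_def pint_def by (simp add: right_diff_distrib)

lemma int_on_cong:
  assumes "\<And>s \<omega>. s \<in> S \<Longrightarrow> \<omega> \<in> space M \<Longrightarrow> p s \<omega> = q s \<omega>"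
  shows "int_on M S p \<longleftrightarrow> int_on M S q"
  unfolding int_on_def using assms
  by (intro Bochner_Integration.integrable_cong) (auto simp: space_pair_measure indicator_def)

lemma pint_cong:
  assumes "\<And>s \<omega>. s \<in> S \<Longrightarrow> \<omega> \<in> space M \<Longrightarrow> p s \<omega> = q s \<omega>"
  shows "pint M S p = pint M S q"
  unfolding pint_def using assms
  by (intro Bochner_Integration.integral_cong) (auto simp: space_pair_measure indicator_def)

lemma int_on_subset:
  assumes "int_on M S p" "S' \<subseteq> S" "S' \<in> sets borel"
  shows "int_on M S' p"
proof -
  have "integrable (lborel \<Otimes>\<^sub>M M) (\<lambda>x. indicat_real (S' \<times> space M) x *\<^sub>R (indicat_real S (fst x) * p (fst x) (snd x)))"
    using assms by (intro integrable_mult_indicator) (auto simp: int_on_def)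
  then show ?thesis
    unfolding int_on_def
    by (rule Bochner_Integration.integrable_cong[THEN iffD1, OF refl, rotated])
       (use assms(2) in \<open>auto simp: indicator_def space_pair_measure\<close>)
qed

context prob_space
begin

sublocale time: pair_sigma_finite lborel M ..

text \<open>The exceptional set depends on time only, so \<open>P s\<close> may be non-measurable in \<open>\<omega>\<close>.\<close>

lemma AE_lborel_pair:
  assumes "AE s in lborel. \<forall>\<omega>\<in>space M. P s \<omega>"
  shows "AE x in lborel \<Otimes>\<^sub>M M. P (fst x) (snd x)"
proof -
  obtain N where N: "N \<in> null_sets lborel" "{s\<in>space lborel. \<not> (\<forall>\<omega>\<in>space M. P s \<omega>)} \<subseteq> N"
    using assms unfolding eventually_ae_filter by blast
  have "N \<times> space M \<in> null_sets (lborel \<Otimes>\<^sub>M M)"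
    using N(1) by (intro null_setsI) (auto simp: emeasure_pair_measure_Times null_sets_def)
  then show ?thesis
    by (rule AE_I') (use N(2) in \<open>fastforce simp: space_pair_measure\<close>)
qed

lemma
  assumes p: "int_on M S p"
  shows AE_set_integrable_int_on: "AE \<omega> in M. set_integrable lborel S (\<lambda>s. p s \<omega>)"
    and integrable_LINT_int_on: "integrable M (\<lambda>\<omega>. LINT s:S|lborel. p s \<omega>)"
    and pint_eq_LINT: "pint M S p = (\<integral>\<omega>. (LINT s:S|lborel. p s \<omega>) \<partial>M)"
    and AE_integrable_int_on: "AE s in lborel. s \<in> S \<longrightarrow> integrable M (p s)"
    and pint_eq_LINT_expectation: "pint M S p = (LINT s:S|lborel. (\<integral>\<omega>. p s \<omega> \<partial>M))"
proof -
  let ?f = "\<lambda>s \<omega>. indicat_real S s * p s \<omega>"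
  have i: "integrable (lborel \<Otimes>\<^sub>M M) (case_prod ?f)"
    using p by (simp add: int_on_def split_beta')
  show "AE \<omega> in M. set_integrable lborel S (\<lambda>s. p s \<omega>)"
    using time.AE_integrable_snd[OF i] by (simp add: set_integrable_def)
  show "integrable M (\<lambda>\<omega>. LINT s:S|lborel. p s \<omega>)"
    using time.integrable_snd[OF i] by (simp add: set_lebesgue_integral_def)
  show "pint M S p = (\<integral>\<omega>. (LINT s:S|lborel. p s \<omega>) \<partial>M)"
    using time.integral_snd[OF i] by (simp add: set_lebesgue_integral_def pint_def split_beta')
  show "AE s in lborel. s \<in> S \<longrightarrow> integrable M (p s)"
    using time.AE_integrable_fst[OF i] by eventually_elim (auto simp: indicator_def)
  show "pint M S p = (LINT s:S|lborel. (\<integral>\<omega>. p s \<omega> \<partial>M))"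
    using time.integral_fst[OF i] by (simp add: set_lebesgue_integral_def pint_def split_beta')
qed

text \<open>Orthogonality and conditional expectation are statements about one fixed time.  This lemma integrates them over
time.\<close>

lemma pint_cong_expectation:
  assumes "int_on M S p" "int_on M S q"
    and "AE s in lborel. s \<in> S \<longrightarrow> (\<integral>\<omega>. p s \<omega> \<partial>M) = (\<integral>\<omega>. q s \<omega> \<partial>M)"
  shows "pint M S p = pint M S q"
proof -
  have "(LINT s:S|lborel. (\<integral>\<omega>. p s \<omega> \<partial>M)) = (LINT s:S|lborel. (\<integral>\<omega>. q s \<omega> \<partial>M))"
    unfolding set_lebesgue_integral_def
  proof (rule integral_cong_AE)
    have i: "integrable (lborel \<Otimes>\<^sub>M M) (\<lambda>(s, \<omega>). indicat_real S s * p s \<omega>)"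
      "integrable (lborel \<Otimes>\<^sub>M M) (\<lambda>(s, \<omega>). indicat_real S s * q s \<omega>)"
      using assms(1,2) by (simp_all add: int_on_def split_beta')
    show "(\<lambda>s. indicat_real S s *\<^sub>R (\<integral>\<omega>. p s \<omega> \<partial>M)) \<in> borel_measurable lborel"
      using time.integrable_fst[OF i(1)] by simp
    show "(\<lambda>s. indicat_real S s *\<^sub>R (\<integral>\<omega>. q s \<omega> \<partial>M)) \<in> borel_measurable lborel"
      using time.integrable_fst[OF i(2)] by simp
    show "AE s in lborel. indicat_real S s *\<^sub>R (\<integral>\<omega>. p s \<omega> \<partial>M) = indicat_real S s *\<^sub>R (\<integral>\<omega>. q s \<omega> \<partial>M)"
      using assms(3) by eventually_elim (auto simp: indicator_def)
  qed
  then show ?thesis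
    by (simp add: pint_eq_LINT_expectation[OF assms(1)] pint_eq_LINT_expectation[OF assms(2)])
qed

lemma sq_on_AE_L2:
  fixes \<psi> :: "real \<Rightarrow> 'a \<Rightarrow> 'b::euclidean_space"
  assumes "sq_on M S \<psi>"
  shows "AE s in lborel. s \<in> S \<longrightarrow> L2_fun M (\<psi> s)"
proof -
  have m: "(\<lambda>x. indicat_real S (fst x) *\<^sub>R \<psi> (fst x) (snd x)) \<in> borel_measurable (lborel \<Otimes>\<^sub>M M)"
    using sq_on_meas[OF assms] by (simp add: meas_on_def)
  have "int_on M S (\<lambda>s \<omega>. (norm (\<psi> s \<omega>))\<^sup>2)"
    using int_on_inner[OF assms assms] by (simp add: power2_norm_eq_inner)
  from AE_integrable_int_on[OF this] show ?thesis
  proof eventually_elim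
    case (elim s)
    show ?case
    proof
      assume "s \<in> S"
      then have "(\<lambda>\<omega>. \<psi> s \<omega>) \<in> borel_measurable M"
        using measurable_compose[OF measurable_Pair1'[of s lborel M] m] by simp
      then show "L2_fun M (\<psi> s)" using elim \<open>s \<in> S\<close> by (simp add: L2_fun_def)
    qed
  qed
qed

lemma sq_on_const:
  fixes \<zeta> :: "'a \<Rightarrow> 'b::euclidean_space"
  assumes "L2_fun M \<zeta>"
  shows "sq_on M {a..b} (\<lambda>s. \<zeta>)"
proof -
  have [measurable]: "\<zeta> \<in> borel_measurable M" using assms by (simp add: L2_fun_def)
  have "integrable (lborel \<Otimes>\<^sub>M M) (\<lambda>x. indicat_real {a..b} (fst x) * (norm (\<zeta> (snd x)))\<^sup>2)"
  proof (rule time.Fubini_integrable)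
    show "integrable lborel (\<lambda>s. \<integral>\<omega>. norm (indicat_real {a..b} (fst (s, \<omega>)) * (norm (\<zeta> (snd (s, \<omega>))))\<^sup>2) \<partial>M)"
    proof -
      have "integrable lborel (indicat_real {a..b})"
        by (intro integrable_real_indicator) (auto simp: emeasure_lborel_Icc_eq)
      then show ?thesis by (simp add: abs_mult)
    qed
    show "AE s in lborel. integrable M (\<lambda>\<omega>. indicat_real {a..b} (fst (s, \<omega>)) * (norm (\<zeta> (snd (s, \<omega>))))\<^sup>2)"
      using assms by (simp add: L2_fun_def)
  qed simp
  then have "integrable (lborel \<Otimes>\<^sub>M M) (\<lambda>x. (norm (indicat_real {a..b} (fst x) *\<^sub>R \<zeta> (snd x)))\<^sup>2)"
    by (rule Bochner_Integration.integrable_cong[THEN iffD1, OF refl, rotated])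
       (auto simp: indicator_def)
  then show ?thesis by (simp add: sq_on_def L2_fun_def)
qed

lemma distr_shift: "distr (lborel \<Otimes>\<^sub>M M) (lborel \<Otimes>\<^sub>M M) (\<lambda>x. (fst x - h, snd x)) = lborel \<Otimes>\<^sub>M M"
  for h :: real
proof (rule pair_measure_eqI[symmetric])
  show "sets (lborel \<Otimes>\<^sub>M M) = sets (distr (lborel \<Otimes>\<^sub>M M) (lborel \<Otimes>\<^sub>M M) (\<lambda>x. (fst x - h, snd x)))"
    by simp
  fix A B assume A: "A \<in> sets (lborel::real measure)" and B: "B \<in> sets M"
  have A': "(\<lambda>s. s - h) -` A \<in> sets lborel"
    using measurable_sets[of "\<lambda>s. s - h" lborel lborel A] A by simp
  have "emeasure (distr (lborel \<Otimes>\<^sub>M M) (lborel \<Otimes>\<^sub>M M) (\<lambda>x. (fst x - h, snd x))) (A \<times> B) =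
      emeasure (lborel \<Otimes>\<^sub>M M) ((\<lambda>x. (fst x - h, snd x)) -` (A \<times> B) \<inter> space (lborel \<Otimes>\<^sub>M M))"
    using A B by (intro emeasure_distr) auto
  also have "(\<lambda>x. (fst x - h, snd x)) -` (A \<times> B) \<inter> space (lborel \<Otimes>\<^sub>M M) = ((\<lambda>s. s - h) -` A) \<times> B"
    using sets.sets_into_space[OF B] by (auto simp: space_pair_measure)
  also have "emeasure (lborel \<Otimes>\<^sub>M M) (((\<lambda>s. s - h) -` A) \<times> B) = emeasure lborel ((\<lambda>s. s - h) -` A) * emeasure M B"
    using A' B by (rule emeasure_pair_measure_Times)
  also have "emeasure lborel ((\<lambda>s. s - h) -` A) = emeasure (distr lborel borel ((+) (- h))) A"
    using A by (subst emeasure_distr) (auto intro!: arg_cong[where f = "emeasure lborel"])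
  also have "\<dots> = emeasure lborel A" by (simp add: lborel_distr_plus)
  finally show "emeasure lborel A * emeasure M B =
      emeasure (distr (lborel \<Otimes>\<^sub>M M) (lborel \<Otimes>\<^sub>M M) (\<lambda>x. (fst x - h, snd x))) (A \<times> B)" ..
qed (auto intro: lborel.sigma_finite_measure_axioms sigma_finite_measure_axioms)

lemma
  fixes f :: "real \<times> 'a \<Rightarrow> 'b::euclidean_space"
  assumes f[measurable]: "f \<in> borel_measurable (lborel \<Otimes>\<^sub>M M)"
  shows integrable_shift: "integrable (lborel \<Otimes>\<^sub>M M) (\<lambda>x. f (fst x - h, snd x)) \<longleftrightarrow> integrable (lborel \<Otimes>\<^sub>M M) f"
    and integral_shift: "(\<integral>x. f (fst x - h, snd x) \<partial>(lborel \<Otimes>\<^sub>M M)) = (\<integral>x. f x \<partial>(lborel \<Otimes>\<^sub>M M))"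
proof -
  let ?Q = "lborel \<Otimes>\<^sub>M M" and ?\<phi> = "\<lambda>x. (fst x - h, snd x)"
  have m: "?\<phi> \<in> measurable ?Q ?Q" by measurable
  show "integrable ?Q (\<lambda>x. f (?\<phi> x)) \<longleftrightarrow> integrable ?Q f"
    using integrable_distr_eq[OF m f] by (simp add: distr_shift)
  show "(\<integral>x. f (?\<phi> x) \<partial>?Q) = (\<integral>x. f x \<partial>?Q)"
    using integral_distr[OF m f] by (simp add: distr_shift)
qed

lemma sq_on_shift:
  fixes \<psi> :: "real \<Rightarrow> 'a \<Rightarrow> 'b::euclidean_space"
  assumes "sq_on M {a - h..b - h} \<psi>"
  shows "sq_on M {a..b} (\<lambda>s. \<psi> (s - h))"
proof -
  let ?f = "\<lambda>x. indicat_real {a - h..b - h} (fst x) *\<^sub>R \<psi> (fst x) (snd x)"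
  have m[measurable]: "?f \<in> borel_measurable (lborel \<Otimes>\<^sub>M M)" and
    i: "integrable (lborel \<Otimes>\<^sub>M M) (\<lambda>x. (norm (?f x))\<^sup>2)"
    using assms by (auto simp: sq_on_def L2_fun_def)
  have "L2_fun (lborel \<Otimes>\<^sub>M M) (\<lambda>x. ?f (fst x - h, snd x))"
    unfolding L2_fun_def
  proof
    show "(\<lambda>x. ?f (fst x - h, snd x)) \<in> borel_measurable (lborel \<Otimes>\<^sub>M M)"
      by (rule measurable_compose[OF _ m]) measurable
    show "integrable (lborel \<Otimes>\<^sub>M M) (\<lambda>x. (norm (?f (fst x - h, snd x)))\<^sup>2)"
      using i by (subst integrable_shift[of "\<lambda>x. (norm (?f x))\<^sup>2"]) (use m in measurable)
  qed
  then show ?thesis unfolding sq_on_def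
    by (rule L2_fun_cong[THEN iffD1, rotated]) (auto simp: indicator_def)
qed

lemma pint_shift:
  assumes "int_on M {a - h..b - h} p"
  shows "pint M {a..b} (\<lambda>s. p (s - h)) = pint M {a - h..b - h} p"
proof -
  let ?f = "\<lambda>x. indicat_real {a - h..b - h} (fst x) * p (fst x) (snd x)"
  have i: "integrable (lborel \<Otimes>\<^sub>M M) ?f" using assms by (simp add: int_on_def)
  have eq: "?f (fst x - h, snd x) = indicat_real {a..b} (fst x) * p (fst x - h) (snd x)" for x
    by (auto simp: indicator_def)
  show ?thesis
    using integral_shift[of ?f h] i unfolding pint_def eq by auto
qed

lemma pint_split:
  assumes "int_on M {a..c} p" "a \<le> b" "b \<le> c"
  shows "pint M {a..c} p = pint M {a..b} p + pint M {b..c} p"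
proof -
  have i: "int_on M {a..b} p" "int_on M {b..c} p"
    using assms by (auto intro: int_on_subset[OF assms(1)])
  have "pint M {a..c} p = (\<integral>x. indicat_real {a..b} (fst x) * p (fst x) (snd x)
      + indicat_real {b..c} (fst x) * p (fst x) (snd x) \<partial>(lborel \<Otimes>\<^sub>M M))"
    unfolding pint_def
  proof (rule integral_cong_AE)
    have "AE s in lborel. \<forall>\<omega>\<in>space M. indicat_real {a..c} s * p s \<omega> =
        indicat_real {a..b} s * p s \<omega> + indicat_real {b..c} s * p s \<omega>"
      using AE_lborel_singleton[of b] by eventually_elim (use assms in \<open>auto simp: indicator_def\<close>)
    then show "AE x in lborel \<Otimes>\<^sub>M M. indicat_real {a..c} (fst x) * p (fst x) (snd x) =
        indicat_real {a..b} (fst x) * p (fst x) (snd x) + indicat_real {b..c} (fst x) * p (fst x) (snd x)"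
      by (rule AE_lborel_pair)
  qed (use assms(1) i in \<open>auto simp: int_on_def\<close>)
  also have "\<dots> = pint M {a..b} p + pint M {b..c} p"
    using i unfolding pint_def int_on_def by (rule Bochner_Integration.integral_add)
  finally show ?thesis .
qed

end

lemma LINT_singleton: "(LINT s:{a..a}|lborel. f s) = (0::real)" for a :: real
proof -
  have "AE s in lborel. indicat_real {a..a} s *\<^sub>R f s = 0"
    using AE_lborel_singleton[of a] by eventually_elim (auto simp: indicator_def)
  then show ?thesis unfolding set_lebesgue_integral_def by (rule integral_eq_zero_AE)
qed

lemma LINT_zero:
  fixes f :: "real \<Rightarrow> real"
  assumes "\<And>s. a < s \<Longrightarrow> s < b \<Longrightarrow> f s = 0"
  shows "(LINT s:{a..b}|lborel. f s) = 0"
proof -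
  have "AE s in lborel. indicat_real {a..b} s *\<^sub>R f s = 0"
    using AE_lborel_singleton[of a] AE_lborel_singleton[of b]
    by eventually_elim (use assms in \<open>auto simp: indicator_def\<close>)
  then show ?thesis unfolding set_lebesgue_integral_def by (rule integral_eq_zero_AE)
qed

lemma LINT_split:
  fixes f :: "real \<Rightarrow> real"
  assumes f: "set_integrable lborel {a..c} f" and "a \<le> b" "b \<le> c"
  shows "(LINT s:{a..c}|lborel. f s) = (LINT s:{a..b}|lborel. f s) + (LINT s:{b..c}|lborel. f s)"
proof -
  have i: "set_integrable lborel {a..b} f" "set_integrable lborel {b..c} f"
    using assms by (auto intro: set_integrable_subset)
  have "(\<integral>s. indicat_real {a..c} s *\<^sub>R f s \<partial>lborel) = (\<integral>s. indicat_real {a..b} s *\<^sub>R f s + indicat_real {b..c} s *\<^sub>R f s \<partial>lborel)"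
  proof (rule integral_cong_AE)
    show "AE s in lborel. indicat_real {a..c} s *\<^sub>R f s = indicat_real {a..b} s *\<^sub>R f s + indicat_real {b..c} s *\<^sub>R f s"
      using AE_lborel_singleton[of b] by eventually_elim (use assms in \<open>auto simp: indicator_def\<close>)
  qed (use f i in \<open>auto simp: set_integrable_def\<close>)
  also have "\<dots> = (\<integral>s. indicat_real {a..b} s *\<^sub>R f s \<partial>lborel) + (\<integral>s. indicat_real {b..c} s *\<^sub>R f s \<partial>lborel)"
    using i unfolding set_integrable_def by (rule Bochner_Integration.integral_add)
  finally show ?thesis by (simp add: set_lebesgue_integral_def)
qed

lemma adapted_of_prog:
  assumes "prog_measurable F a b \<psi>" "s \<in> {a..b}"
  shows "\<psi> s \<in> borel_measurable (F s)"
proof -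
  have m: "(\<lambda>(r, \<omega>). \<psi> r \<omega>) \<in> borel_measurable (restrict_space borel {a..s} \<Otimes>\<^sub>M F s)"
    using assms by (auto simp: prog_measurable_def)
  have "s \<in> space (restrict_space borel {a..s})" using assms(2) by (simp add: space_restrict_space)
  from measurable_compose[OF measurable_Pair1'[OF this] m] show ?thesis by simp
qed

text \<open>Clamping time to \<open>[a, b]\<close> extends a progressively measurable process to a jointly measurable function on the
whole line, which agrees with the process on \<open>[a, b]\<close>.\<close>

lemma meas_on_of_prog:
  fixes \<psi> :: "real \<Rightarrow> 'w \<Rightarrow> 'b::euclidean_space"
  assumes p: "prog_measurable F a b \<psi>" and F: "subalgebra M (F b)"
  shows "meas_on M {a..b} \<psi>"
proof (cases "a \<le> b")
  case False
  then show ?thesis by (simp add: meas_on_def)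
next
  case True
  have m: "(\<lambda>(r, \<omega>). \<psi> r \<omega>) \<in> borel_measurable (restrict_space borel {a..b} \<Otimes>\<^sub>M F b)"
    using p True by (auto simp: prog_measurable_def)
  have "(\<lambda>x. (max a (min b (fst x)), snd x)) \<in> measurable (lborel \<Otimes>\<^sub>M M) (restrict_space borel {a..b} \<Otimes>\<^sub>M F b)"
  proof (rule measurable_Pair)
    show "(\<lambda>x. max a (min b (fst x))) \<in> measurable (lborel \<Otimes>\<^sub>M M) (restrict_space borel {a..b})"
      using True by (intro measurable_restrict_space2) auto
    have "(\<lambda>\<omega>. \<omega>) \<in> measurable M (F b)"
      using measurable_from_subalg[OF F measurable_ident] by (simp add: id_def)
    then show "(\<lambda>x. snd x) \<in> measurable (lborel \<Otimes>\<^sub>M M) (F b)"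
      by (rule measurable_compose[OF measurable_snd])
  qed
  from measurable_compose[OF this m]
  have "(\<lambda>x. \<psi> (max a (min b (fst x))) (snd x)) \<in> borel_measurable (lborel \<Otimes>\<^sub>M M)" by simp
  then have "(\<lambda>x. indicat_real {a..b} (fst x) *\<^sub>R \<psi> (max a (min b (fst x))) (snd x)) \<in> borel_measurable (lborel \<Otimes>\<^sub>M M)"
    by measurable
  then show ?thesis unfolding meas_on_def
    by (rule measurable_cong[THEN iffD1, rotated]) (auto simp: indicator_def)
qed

lemma bdd_on_of_prog:
  fixes \<psi> :: "real \<Rightarrow> 'w \<Rightarrow> 'b::euclidean_space"
  assumes "prog_measurable F a b \<psi>" "subalgebra M (F b)" "unif_bounded M a b \<psi>"
  shows "bdd_on M {a..b} \<psi>"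
  using meas_on_of_prog[OF assms(1,2)] assms(3) by (auto simp: bdd_on_def unif_bounded_def)

context prob_space
begin

lemma pint_zero:
  assumes "\<And>s \<omega>. a < s \<Longrightarrow> s < b \<Longrightarrow> \<omega> \<in> space M \<Longrightarrow> p s \<omega> = 0"
  shows "pint M {a..b} p = 0"
  unfolding pint_def
proof (rule integral_eq_zero_AE)
  have "AE s in lborel. \<forall>\<omega>\<in>space M. indicat_real {a..b} s * p s \<omega> = 0"
    using AE_lborel_singleton[of a] AE_lborel_singleton[of b]
    by eventually_elim (use assms in \<open>auto simp: indicator_def\<close>)
  then show "AE x in lborel \<Otimes>\<^sub>M M. indicat_real {a..b} (fst x) * p (fst x) (snd x) = 0"
    by (rule AE_lborel_pair)
qed

lemma int_on_indicator:
  assumes A: "A \<in> events" and h: "int_on M S h"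
  shows "int_on M S (\<lambda>s \<omega>. indicat_real A \<omega> * h s \<omega>)"
proof -
  have "integrable (lborel \<Otimes>\<^sub>M M) (\<lambda>x. indicat_real (UNIV \<times> A) x *\<^sub>R (indicat_real S (fst x) * h (fst x) (snd x)))"
    using h A by (intro integrable_mult_indicator) (auto simp: int_on_def)
  then show ?thesis unfolding int_on_def
    by (rule Bochner_Integration.integrable_cong[THEN iffD1, OF refl, rotated]) (auto simp: indicator_def)
qed

lemma nn_integral_time_swap:
  assumes [measurable]: "f \<in> borel_measurable (lborel \<Otimes>\<^sub>M M)"
  shows "(\<integral>\<^sup>+\<omega>. (\<integral>\<^sup>+s. f (s, \<omega>) \<partial>lborel) \<partial>M) = (\<integral>\<^sup>+x. f x \<partial>(lborel \<Otimes>\<^sub>M M))"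
  by (rule time.nn_integral_snd) measurable

lemma sq_on_of_L2_proc:
  fixes \<psi> :: "real \<Rightarrow> 'a \<Rightarrow> 'b::euclidean_space"
  assumes p: "L2_proc M F a b \<psi>" and F: "subalgebra M (F b)"
  shows "sq_on M {a..b} \<psi>"
proof -
  let ?f = "\<lambda>x. indicat_real {a..b} (fst x) *\<^sub>R \<psi> (fst x) (snd x)"
  have m[measurable]: "?f \<in> borel_measurable (lborel \<Otimes>\<^sub>M M)"
    using meas_on_of_prog[of F a b \<psi> M] p F by (simp add: L2_proc_def meas_on_def)
  have "(\<integral>\<^sup>+x. ennreal ((norm (?f x))\<^sup>2) \<partial>(lborel \<Otimes>\<^sub>M M)) =
      (\<integral>\<^sup>+\<omega>. (\<integral>\<^sup>+s. ennreal ((norm (?f (s, \<omega>)))\<^sup>2) \<partial>lborel) \<partial>M)"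
    by (rule nn_integral_time_swap[symmetric]) measurable
  also have "\<dots> = (\<integral>\<^sup>+\<omega>. (\<integral>\<^sup>+s\<in>{a..b}. ennreal ((norm (\<psi> s \<omega>))\<^sup>2) \<partial>lborel) \<partial>M)"
    by (intro nn_integral_cong) (auto simp: indicator_def)
  also have "\<dots> < \<infinity>" using p by (simp add: L2_proc_def)
  finally have "integrable (lborel \<Otimes>\<^sub>M M) (\<lambda>x. (norm (?f x))\<^sup>2)"
    using m by (intro integrableI_bounded borel_measurable_power borel_measurable_norm) (simp_all del: norm_scaleR)
  with m show ?thesis unfolding sq_on_def L2_fun_def by blast
qed

text \<open>The supremum in the definition need not be measurable, but it bounds the value at each time pointwise, and this is
enough, as the nonnegative integral is monotone on all functions.\<close>

lemma L2_fun_of_S2_proc: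
  assumes p: "S2_proc M F a b \<psi>" and s: "s \<in> {a..b}" and F: "subalgebra M (F s)"
  shows "L2_fun M (\<psi> s)"
proof -
  have m[measurable]: "\<psi> s \<in> borel_measurable M"
    using adapted_of_prog[of F a b \<psi> s] p s measurable_from_subalg[OF F]
    by (auto simp: S2_proc_def L2_proc_def)
  have "(\<integral>\<^sup>+\<omega>. ennreal ((\<psi> s \<omega>)\<^sup>2) \<partial>M) \<le> (\<integral>\<^sup>+\<omega>. (SUP r\<in>{a..b}. ennreal ((\<psi> r \<omega>)\<^sup>2)) \<partial>M)"
    using s by (intro nn_integral_mono SUP_upper)
  also have "\<dots> < \<infinity>" using p by (simp add: S2_proc_def)
  finally show ?thesis
    unfolding L2_fun_def by (intro conjI m integrableI_bounded) auto
qed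

text \<open>Cauchy--Schwarz in time bounds the square of this integral by the length of the interval times the integral of the square.\<close>

lemma L2_fun_LINT_abs:
  fixes a :: "real \<Rightarrow> 'a \<Rightarrow> real"
  assumes a: "sq_on M {t..T} a"
  shows "L2_fun M (\<lambda>\<omega>. LINT s:{t..T}|lborel. \<bar>a s \<omega>\<bar>)"
proof -
  have one: "sq_on M {t..T} (\<lambda>s \<omega>. 1::real)" by (rule sq_on_const) (simp add: L2_fun_def)
  have aa: "sq_on M {t..T} (\<lambda>s \<omega>. \<bar>a s \<omega>\<bar>)"
  proof (rule sq_on_bound[OF a, where K = 1])
    have "(\<lambda>x. \<bar>indicat_real {t..T} (fst x) *\<^sub>R a (fst x) (snd x)\<bar>) \<in> borel_measurable (lborel \<Otimes>\<^sub>M M)"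
      using sq_on_meas[OF a] unfolding meas_on_def by (intro borel_measurable_abs)
    then show "meas_on M {t..T} (\<lambda>s \<omega>. \<bar>a s \<omega>\<bar>)"
      by (simp add: meas_on_def abs_mult)
  qed auto
  have i1: "int_on M {t..T} (\<lambda>s \<omega>. \<bar>a s \<omega>\<bar>)" using int_on_mult[OF aa one] by simp
  have i2: "int_on M {t..T} (\<lambda>s \<omega>. (a s \<omega>)\<^sup>2)" using int_on_mult[OF a a] by (simp add: power2_eq_square)
  have m: "AE \<omega> in M. (\<lambda>s. indicat_real {t..T} s *\<^sub>R \<bar>a s \<omega>\<bar>) \<in> borel_measurable lborel"
    using AE_set_integrable_int_on[OF i1] by eventually_elim (simp add: set_integrable_def)
  show ?thesis
    unfolding L2_fun_def
  proof
    show meas: "(\<lambda>\<omega>. LINT s:{t..T}|lborel. \<bar>a s \<omega>\<bar>) \<in> borel_measurable M"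
      using integrable_LINT_int_on[OF i1] by simp
    have i3: "integrable M (\<lambda>\<omega>. (measure lborel {t..T}) * (LINT s:{t..T}|lborel. (a s \<omega>)\<^sup>2))"
      using integrable_LINT_int_on[OF i2] by simp
    show "integrable M (\<lambda>\<omega>. (norm (LINT s:{t..T}|lborel. \<bar>a s \<omega>\<bar>))\<^sup>2)"
    proof (rule Bochner_Integration.integrable_bound[OF i3])
      show "AE \<omega> in M. norm ((norm (LINT s:{t..T}|lborel. \<bar>a s \<omega>\<bar>))\<^sup>2)
          \<le> norm (measure lborel {t..T} * (LINT s:{t..T}|lborel. (a s \<omega>)\<^sup>2))"
        using AE_set_integrable_int_on[OF i2] m
      proof eventually_elim
        case (elim \<omega>)
        let ?f = "\<lambda>s. indicat_real {t..T} s" and ?g = "\<lambda>s. indicat_real {t..T} s *\<^sub>R \<bar>a s \<omega>\<bar>"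
        have sq: "(norm (?g s))\<^sup>2 = indicat_real {t..T} s *\<^sub>R (a s \<omega>)\<^sup>2" "(norm (?f s))\<^sup>2 = ?f s" for s
          by (auto simp: indicator_def)
        have f: "L2_fun lborel ?f" and g: "L2_fun lborel ?g"
          using elim by (simp_all only: L2_fun_def sq) (auto simp: set_integrable_def emeasure_lborel_Icc_eq intro!: integrable_real_indicator)
        have "?f s \<bullet> ?g s = ?g s" for s by (auto simp: indicator_def)
        then have "\<bar>LINT s:{t..T}|lborel. \<bar>a s \<omega>\<bar>\<bar> \<le> sqrt (measure lborel {t..T}) * sqrt (LINT s:{t..T}|lborel. (a s \<omega>)\<^sup>2)"
          using Cauchy_Schwarz_L2[OF f g] by (simp only: sq set_lebesgue_integral_def) simp
        then have "\<bar>LINT s:{t..T}|lborel. \<bar>a s \<omega>\<bar>\<bar>\<^sup>2 \<le> (sqrt (measure lborel {t..T}) * sqrt (LINT s:{t..T}|lborel. (a s \<omega>)\<^sup>2))\<^sup>2"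
          by (rule power_mono) simp
        moreover have "0 \<le> (LINT s:{t..T}|lborel. (a s \<omega>)\<^sup>2)"
          by (simp add: set_lebesgue_integral_def)
        ultimately show ?case by (simp add: power_mult_distrib)
      qed
    qed (use meas in measurable)
  qed
qed

lemma LINT_tail_meas:
  fixes a :: "real \<Rightarrow> 'a \<Rightarrow> real"
  assumes a: "meas_on M {t..T} a"
  shows "meas_on M {t..T} (\<lambda>s \<omega>. LINT r:{s..T}|lborel. a r \<omega>)"
proof -
  define a' where "a' x = indicat_real {t..T} (fst x) *\<^sub>R a (fst x) (snd x)" for x
  let ?a = a'
  have a'[measurable]: "a' \<in> borel_measurable (lborel \<Otimes>\<^sub>M M)"
    using a by (simp add: meas_on_def a'_def[abs_def])
  have [measurable]: "(\<lambda>y. indicat_real {fst (fst y)..T} (snd y)) \<in> borel_measurable ((lborel \<Otimes>\<^sub>M M) \<Otimes>\<^sub>M lborel)"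
    unfolding indicator_def atLeastAtMost_iff by measurable
  have "(\<lambda>y. indicat_real {fst (fst y)..T} (snd y) *\<^sub>R ?a (snd y, snd (fst y)))
      \<in> borel_measurable ((lborel \<Otimes>\<^sub>M M) \<Otimes>\<^sub>M lborel)" by (intro borel_measurable_scaleR) measurable
  then have "(\<lambda>x. \<integral>r. indicat_real {fst x..T} r *\<^sub>R ?a (r, snd x) \<partial>lborel) \<in> borel_measurable (lborel \<Otimes>\<^sub>M M)"
    by (intro lborel.borel_measurable_lebesgue_integral) (simp add: split_beta')
  then have "(\<lambda>x. indicat_real {t..T} (fst x) *\<^sub>R (\<integral>r. indicat_real {fst x..T} r *\<^sub>R ?a (r, snd x) \<partial>lborel)) \<in> borel_measurable (lborel \<Otimes>\<^sub>M M)"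
    by (intro borel_measurable_scaleR) measurable
  then show ?thesis
    unfolding meas_on_def set_lebesgue_integral_def
    by (rule measurable_cong[THEN iffD1, rotated])
       (auto simp: indicator_def a'_def intro!: Bochner_Integration.integral_cong)
qed

text \<open>For all lower limits \<open>s\<close> the integral is dominated by the integral of \<open>\<bar>a\<bar>\<close> over the whole interval.\<close>

lemma sq_on_LINT_tail:
  fixes a :: "real \<Rightarrow> 'a \<Rightarrow> real"
  assumes a: "sq_on M {t..T} a"
  shows "sq_on M {t..T} (\<lambda>s \<omega>. LINT r:{s..T}|lborel. a r \<omega>)"
  unfolding sq_on_def
proof (rule L2_fun_bound[where K = 1])
  let ?A = "\<lambda>\<omega>. LINT s:{t..T}|lborel. \<bar>a s \<omega>\<bar>"
  have Ai: "sq_on M {t..T} (\<lambda>s. ?A)"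
    by (intro sq_on_const L2_fun_LINT_abs a)
  show "L2_fun (lborel \<Otimes>\<^sub>M M) (\<lambda>x. indicat_real {t..T} (fst x) *\<^sub>R ?A (snd x))"
    using Ai by (simp add: sq_on_def)
  have tm: "(\<lambda>x. indicat_real {t..T} (fst x) *\<^sub>R (LINT r:{fst x..T}|lborel. a r (snd x))) \<in> borel_measurable (lborel \<Otimes>\<^sub>M M)"
    using LINT_tail_meas[OF sq_on_meas[OF a]] by (simp add: meas_on_def)
  then show "(\<lambda>x. indicat_real {t..T} (fst x) *\<^sub>R (LINT r:{fst x..T}|lborel. a r (snd x))) \<in> borel_measurable (lborel \<Otimes>\<^sub>M M)" .
  have one: "sq_on M {t..T} (\<lambda>s \<omega>. 1::real)" by (rule sq_on_const) (simp add: L2_fun_def)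
  have i1: "int_on M {t..T} a" using int_on_mult[OF a one] by simp
  have "AE x in lborel \<Otimes>\<^sub>M M. set_integrable lborel {t..T} (\<lambda>r. a r (snd x))"
  proof -
    obtain N where N: "N \<in> null_sets M" "{\<omega>\<in>space M. \<not> set_integrable lborel {t..T} (\<lambda>r. a r \<omega>)} \<subseteq> N"
      using AE_set_integrable_int_on[OF i1] unfolding eventually_ae_filter by blast
    have "UNIV \<times> N \<in> null_sets (lborel \<Otimes>\<^sub>M M)"
      using N(1) by (intro null_setsI) (auto simp: emeasure_pair_measure_Times null_sets_def)
    then show ?thesis by (rule AE_I') (use N(2) in \<open>fastforce simp: space_pair_measure\<close>)
  qed
  then show "AE x in lborel \<Otimes>\<^sub>M M. norm (indicat_real {t..T} (fst x) *\<^sub>R (LINT r:{fst x..T}|lborel. a r (snd x)))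
      \<le> 1 * norm (indicat_real {t..T} (fst x) *\<^sub>R ?A (snd x))"
  proof eventually_elim
    case (elim x)
    have "\<bar>LINT r:{fst x..T}|lborel. a r (snd x)\<bar> \<le> ?A (snd x)" if x: "fst x \<in> {t..T}"
    proof -
      have s: "set_integrable lborel {fst x..T} (\<lambda>r. a r (snd x))"
        using elim by (rule set_integrable_subset) (use x in auto)
      have "\<bar>LINT r:{fst x..T}|lborel. a r (snd x)\<bar> \<le> (LINT r:{fst x..T}|lborel. \<bar>a r (snd x)\<bar>)"
        using set_integral_norm_bound[OF s] by simp
      also have "\<dots> \<le> ?A (snd x)"
        unfolding set_lebesgue_integral_def
      proof (rule integral_mono)
        show "integrable lborel (\<lambda>r. indicat_real {fst x..T} r *\<^sub>R \<bar>a r (snd x)\<bar>)"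
          "integrable lborel (\<lambda>r. indicat_real {t..T} r *\<^sub>R \<bar>a r (snd x)\<bar>)"
          using set_integrable_abs[OF s] set_integrable_abs[OF elim] by (simp_all add: set_integrable_def)
      qed (use x in \<open>auto simp: indicator_def\<close>)
      finally show ?thesis .
    qed
    then show ?case by (auto simp: indicator_def)
  qed
qed

text \<open>Integration by parts for absolutely continuous functions: the two summands are the integrals of
\<open>f s * a r\<close> over the triangles \<open>s \<le> r\<close> and \<open>r < s\<close>.\<close>

lemma LINT_triangle:
  fixes a f :: "real \<Rightarrow> real"
  assumes a: "set_integrable lborel {t..T} a" and f: "set_integrable lborel {t..T} f"
  shows "(LINT s:{t..T}|lborel. f s * (LINT r:{s..T}|lborel. a r))
       + (LINT s:{t..T}|lborel. a s * (LINT r:{s..T}|lborel. f r))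
       = (LINT s:{t..T}|lborel. a s) * (LINT s:{t..T}|lborel. f s)"
proof -
  define a' f' where "a' = (\<lambda>s. indicat_real {t..T} s * a s)" and "f' = (\<lambda>s. indicat_real {t..T} s * f s)"
  have ia: "integrable lborel a'" and if': "integrable lborel f'"
    using a f by (simp_all add: set_integrable_def a'_def f'_def)
  have [measurable]: "a' \<in> borel_measurable borel" "f' \<in> borel_measurable borel"
    using ia if' by auto
  have prod: "integrable (lborel \<Otimes>\<^sub>M lborel) (\<lambda>x. g (fst x) * h (snd x))"
    if "integrable lborel g" "integrable lborel h" for g h :: "real \<Rightarrow> real"
  proof (rule lborel_pair.Fubini_integrable)
    have [measurable]: "g \<in> borel_measurable borel" "h \<in> borel_measurable borel" using that by auto
    show "(\<lambda>x. g (fst x) * h (snd x)) \<in> borel_measurable (lborel \<Otimes>\<^sub>M lborel)" by measurable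
    show "integrable lborel (\<lambda>s. \<integral>r. norm (g (fst (s, r)) * h (snd (s, r))) \<partial>lborel)"
      using that by (simp add: abs_mult)
    show "AE s in lborel. integrable lborel (\<lambda>r. g (fst (s, r)) * h (snd (s, r)))"
      using that by simp
  qed
  let ?U = "\<lambda>x. indicat_real {x. fst x \<le> snd x} x" and ?L = "\<lambda>x. indicat_real {x. snd x < fst x} x"
  have sU: "{x. fst x \<le> snd x} \<in> sets (lborel \<Otimes>\<^sub>M (lborel::real measure))"
    and sU': "{x. fst x < snd x} \<in> sets (lborel \<Otimes>\<^sub>M (lborel::real measure))"
    and sL: "{x. snd x < fst x} \<in> sets (lborel \<Otimes>\<^sub>M (lborel::real measure))"
  proof -
    have "{x \<in> space (lborel \<Otimes>\<^sub>M (lborel::real measure)). fst x \<le> snd x} \<in> sets (lborel \<Otimes>\<^sub>M (lborel::real measure))"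
      "{x \<in> space (lborel \<Otimes>\<^sub>M (lborel::real measure)). fst x < snd x} \<in> sets (lborel \<Otimes>\<^sub>M (lborel::real measure))"
      "{x \<in> space (lborel \<Otimes>\<^sub>M (lborel::real measure)). snd x < fst x} \<in> sets (lborel \<Otimes>\<^sub>M (lborel::real measure))"
      by measurable
    then show "{x. fst x \<le> snd x} \<in> sets (lborel \<Otimes>\<^sub>M (lborel::real measure))"
      "{x. fst x < snd x} \<in> sets (lborel \<Otimes>\<^sub>M (lborel::real measure))"
      "{x. snd x < fst x} \<in> sets (lborel \<Otimes>\<^sub>M (lborel::real measure))"
      by (simp_all add: space_pair_measure)
  qed
  note fa = prod[OF if' ia]
  have i1: "integrable (lborel \<Otimes>\<^sub>M lborel) (\<lambda>x. ?U x *\<^sub>R (f' (fst x) * a' (snd x)))"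
    by (rule integrable_mult_indicator[OF sU fa])
  have i2: "integrable (lborel \<Otimes>\<^sub>M lborel) (\<lambda>x. ?L x *\<^sub>R (f' (fst x) * a' (snd x)))"
    by (rule integrable_mult_indicator[OF sL fa])
  have e1: "(LINT s:{t..T}|lborel. f s * (LINT r:{s..T}|lborel. a r)) = (\<integral>x. ?U x *\<^sub>R (f' (fst x) * a' (snd x)) \<partial>(lborel \<Otimes>\<^sub>M lborel))"
  proof -
    have "(\<integral>s. (\<integral>r. ?U (s, r) *\<^sub>R (f' s * a' r) \<partial>lborel) \<partial>lborel) = (\<integral>x. ?U x *\<^sub>R (f' (fst x) * a' (snd x)) \<partial>(lborel \<Otimes>\<^sub>M lborel))"
      using lborel_pair.integral_fst'[OF i1] by simp
    moreover have "(\<integral>r. ?U (s, r) *\<^sub>R (f' s * a' r) \<partial>lborel) = indicat_real {t..T} s *\<^sub>R (f s * (LINT r:{s..T}|lborel. a r))" for s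
    proof -
      have "(\<integral>r. ?U (s, r) *\<^sub>R (f' s * a' r) \<partial>lborel) = (\<integral>r. f' s * (indicat_real {s..T} r *\<^sub>R a r) \<partial>lborel)"
        by (intro Bochner_Integration.integral_cong) (auto simp: f'_def a'_def indicator_def)
      then show ?thesis by (simp add: set_lebesgue_integral_def f'_def)
    qed
    ultimately show ?thesis by (simp add: set_lebesgue_integral_def)
  qed
  have e2: "(LINT s:{t..T}|lborel. a s * (LINT r:{s..T}|lborel. f r)) = (\<integral>x. ?L x *\<^sub>R (f' (fst x) * a' (snd x)) \<partial>(lborel \<Otimes>\<^sub>M lborel))"
  proof -
    have "(\<integral>r. (\<integral>s. ?L (s, r) *\<^sub>R (f' s * a' r) \<partial>lborel) \<partial>lborel) = (\<integral>x. ?L x *\<^sub>R (f' (fst x) * a' (snd x)) \<partial>(lborel \<Otimes>\<^sub>M lborel))"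
      using lborel_pair.integral_snd[of "\<lambda>s r. ?L (s, r) *\<^sub>R (f' s * a' r)"] i2 by (simp add: split_beta')
    moreover have "(\<integral>s. ?L (s, r) *\<^sub>R (f' s * a' r) \<partial>lborel) = indicat_real {t..T} r *\<^sub>R (a r * (LINT s:{r..T}|lborel. f s))" for r
    proof -
      have "(\<integral>s. ?L (s, r) *\<^sub>R (f' s * a' r) \<partial>lborel) = (\<integral>s. a' r * (indicat_real {r..T} s *\<^sub>R f s) \<partial>lborel)"
      proof (rule integral_cong_AE)
        show "(\<lambda>s. ?L (s, r) *\<^sub>R (f' s * a' r)) \<in> borel_measurable lborel"
          by (simp add: indicator_def) measurable
        have "(\<lambda>s. a' r * (indicat_real {r..T} s *\<^sub>R f' s)) \<in> borel_measurable lborel" by measurable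
        then show "(\<lambda>s. a' r * (indicat_real {r..T} s *\<^sub>R f s)) \<in> borel_measurable lborel"
          by (rule measurable_cong[THEN iffD1, rotated]) (auto simp: a'_def f'_def indicator_def)
        show "AE s in lborel. ?L (s, r) *\<^sub>R (f' s * a' r) = a' r * (indicat_real {r..T} s *\<^sub>R f s)"
          using AE_lborel_singleton[of r] by eventually_elim (auto simp: f'_def a'_def indicator_def)
      qed
      then show ?thesis by (simp add: set_lebesgue_integral_def a'_def)
    qed
    ultimately show ?thesis by (simp add: set_lebesgue_integral_def)
  qed
  have "(LINT s:{t..T}|lborel. f s * (LINT r:{s..T}|lborel. a r))
       + (LINT s:{t..T}|lborel. a s * (LINT r:{s..T}|lborel. f r))
     = (\<integral>x. ?U x *\<^sub>R (f' (fst x) * a' (snd x)) + ?L x *\<^sub>R (f' (fst x) * a' (snd x)) \<partial>(lborel \<Otimes>\<^sub>M lborel))"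
    unfolding e1 e2 by (rule Bochner_Integration.integral_add[symmetric, OF i1 i2])
  also have "\<dots> = (\<integral>x. f' (fst x) * a' (snd x) \<partial>(lborel \<Otimes>\<^sub>M lborel))"
    by (intro Bochner_Integration.integral_cong) (auto simp: indicator_def)
  also have "\<dots> = (\<integral>s. (\<integral>r. f' s * a' r \<partial>lborel) \<partial>lborel)"
    using lborel_pair.integral_fst'[OF fa] by simp
  also have "\<dots> = (LINT s:{t..T}|lborel. a s) * (LINT s:{t..T}|lborel. f s)"
    by (simp add: set_lebesgue_integral_def a'_def f'_def mult.commute)
  finally show ?thesis .
qed

end

section \<open>Independence and moments of Brownian increments\<close>

lemma
  fixes f :: "'b::euclidean_space \<Rightarrow> real \<Rightarrow> real"
  assumes i: "\<And>b. b \<in> Basis \<Longrightarrow> integrable lborel (f b)"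
  shows integrable_lborel_prod: "integrable (lborel :: 'b measure) (\<lambda>x. \<Prod>b\<in>Basis. f b (x \<bullet> b))"
    and integral_lborel_prod:
      "(\<integral>x. (\<Prod>b\<in>Basis. f b (x \<bullet> b)) \<partial>(lborel :: 'b measure)) = (\<Prod>b\<in>Basis. \<integral>y. f b y \<partial>lborel)"
proof -
  interpret P: product_sigma_finite "\<lambda>_::'b. lborel :: real measure" ..
  have [measurable]: "f b \<in> borel_measurable borel" if "b \<in> Basis" for b
    using i[OF that] by auto
  let ?e = "\<lambda>g::'b \<Rightarrow> real. \<Sum>b\<in>Basis. g b *\<^sub>R b"
  have e: "?e \<in> measurable (\<Pi>\<^sub>M b\<in>Basis. lborel) borel" by measurable
  have m: "(\<lambda>x::'b. \<Prod>b\<in>Basis. f b (x \<bullet> b)) \<in> borel_measurable borel" by measurable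
  have eq: "(\<Prod>b\<in>Basis. f b (?e g \<bullet> b)) = (\<Prod>b\<in>Basis. f b (g b))" for g
    by (intro prod.cong) (auto simp: inner_sum_left inner_Basis if_distrib sum.delta cong: if_cong)
  show "integrable lborel (\<lambda>x::'b. \<Prod>b\<in>Basis. f b (x \<bullet> b))"
    by (subst lborel_eq, subst integrable_distr_eq[OF e m], unfold eq)
       (rule P.product_integrable_prod[OF finite_Basis i])
  show "(\<integral>x. (\<Prod>b\<in>Basis. f b (x \<bullet> b)) \<partial>(lborel :: 'b measure)) = (\<Prod>b\<in>Basis. \<integral>y. f b y \<partial>lborel)"
    by (subst lborel_eq, subst integral_distr[OF e m], unfold eq)
       (rule P.product_integral_prod[OF finite_Basis i])
qed

lemma prod_Basis_vec: "(\<Prod>b\<in>(Basis :: (real ^ 'd) set). h b) = (\<Prod>i\<in>UNIV. h (axis i (1::real)))"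
proof -
  have "Basis = range (\<lambda>i::'d. axis i (1::real))" by (auto simp: Basis_vec_def)
  moreover have "inj (\<lambda>i::'d. axis i (1::real))" by (auto simp: inj_on_def axis_eq_axis)
  ultimately show ?thesis using prod.reindex[of "\<lambda>i::'d. axis i (1::real)" UNIV h] by (simp add: comp_def)
qed

text \<open>Lebesgue measure on vectors is a product over the coordinates, so Gaussian moments factor into one-dimensional ones.\<close>

lemma
  fixes f :: "'d::finite \<Rightarrow> real \<Rightarrow> real"
  assumes i: "\<And>k. integrable lborel (f k)"
  shows integrable_lborel_vec_prod: "integrable lborel (\<lambda>x::real^'d. \<Prod>k\<in>UNIV. f k (x $ k))"
    and integral_lborel_vec_prod:
      "(\<integral>x. (\<Prod>k\<in>UNIV. f k (x $ k)) \<partial>(lborel :: (real^'d) measure)) = (\<Prod>k\<in>UNIV. \<integral>y. f k y \<partial>lborel)"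
proof -
  define g where "g b = f (THE k. b = axis k (1::real))" for b :: "real^'d"
  have g: "g (axis k 1) = f k" for k
    unfolding g_def by (rule arg_cong[where f = f]) (auto simp: axis_eq_axis)
  have gi: "integrable lborel (g b)" for b unfolding g_def by (rule i)
  show "integrable lborel (\<lambda>x::real^'d. \<Prod>k\<in>UNIV. f k (x $ k))"
    using integrable_lborel_prod[of g, OF gi] by (simp add: prod_Basis_vec g inner_axis)
  show "(\<integral>x. (\<Prod>k\<in>UNIV. f k (x $ k)) \<partial>(lborel :: (real^'d) measure)) = (\<Prod>k\<in>UNIV. \<integral>y. f k y \<partial>lborel)"
    using integral_lborel_prod[of g, OF gi] by (simp add: prod_Basis_vec g inner_axis)
qed

lemma
  assumes "\<sigma> > 0"
  shows integrable_normal_square: "integrable lborel (\<lambda>x. normal_density 0 \<sigma> x * (x * x))"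
    and integral_normal_square: "(\<integral>x. normal_density 0 \<sigma> x * (x * x) \<partial>lborel) = \<sigma>\<^sup>2"
  using integrable_normal_moment[OF assms, of 0 2] integral_normal_moment_even[OF assms, of 0 1] assms
  by (simp_all add: power2_eq_square)

lemma
  fixes i j :: "'d::finite"
  assumes \<sigma>: "\<sigma> > 0"
  defines "f \<equiv> \<lambda>x::real^'d. \<Prod>k\<in>UNIV. normal_density 0 \<sigma> (x $ k)"
  shows integrable_gauss_coord: "integrable lborel (\<lambda>x. f x * x $ i)"
    and integral_gauss_coord: "(\<integral>x. f x * x $ i \<partial>lborel) = 0"
    and integrable_gauss_coord2: "integrable lborel (\<lambda>x. f x * (x $ i * x $ j))"
    and integral_gauss_coord2: "(\<integral>x. f x * (x $ i * x $ j) \<partial>lborel) = (if i = j then \<sigma>\<^sup>2 else 0)"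
proof -
  let ?n = "normal_density 0 \<sigma>"
  define g where "g k y = ?n y * (if k = i then y else 1)" for k y
  define h where "h k y = ?n y * ((if k = i then y else 1) * (if k = j then y else 1))" for k y
  have one: "integrable lborel (\<lambda>y. ?n y * y)" "(\<integral>y. ?n y * y \<partial>lborel) = 0"
    using integrable_normal_moment_nz_1[OF \<sigma>] integral_normal_moment_nz_1[OF \<sigma>] by auto
  have two: "integrable lborel (\<lambda>y. ?n y * (y * y))" "(\<integral>y. ?n y * (y * y) \<partial>lborel) = \<sigma>\<^sup>2"
    using integrable_normal_square[OF \<sigma>] integral_normal_square[OF \<sigma>] by auto
  have zero: "integrable lborel ?n" "(\<integral>y. ?n y \<partial>lborel) = 1" using \<sigma> by auto
  have gi: "integrable lborel (g k)" for k unfolding g_def using one zero by (cases "k = i") auto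
  have hi: "integrable lborel (h k)" for k
    unfolding h_def using one two zero by (cases "k = i"; cases "k = j") auto
  have fg: "f x * x $ i = (\<Prod>k\<in>UNIV. g k (x $ k))" for x
    by (simp add: f_def g_def prod.distrib prod.delta)
  have fh: "f x * (x $ i * x $ j) = (\<Prod>k\<in>UNIV. h k (x $ k))" for x
    by (simp add: f_def h_def prod.distrib prod.delta)
  show "integrable lborel (\<lambda>x. f x * x $ i)"
    unfolding fg by (rule integrable_lborel_vec_prod[OF gi])
  show "integrable lborel (\<lambda>x. f x * (x $ i * x $ j))"
    unfolding fh by (rule integrable_lborel_vec_prod[OF hi])
  show "(\<integral>x. f x * x $ i \<partial>lborel) = 0"
    unfolding fg integral_lborel_vec_prod[OF gi] using one(2)
    by (intro prod_zero[of UNIV] bexI[of _ i]) (auto simp: g_def[abs_def])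
  show "(\<integral>x. f x * (x $ i * x $ j) \<partial>lborel) = (if i = j then \<sigma>\<^sup>2 else 0)"
  proof (cases "i = j")
    case True
    have "(\<integral>y. h k y \<partial>lborel) = (if k = i then \<sigma>\<^sup>2 else 1)" for k
      using True two(2) zero(2) by (simp add: h_def)
    then show ?thesis
      unfolding fh integral_lborel_vec_prod[OF hi] using True by (simp add: prod.delta)
  next
    case False
    then show ?thesis
      unfolding fh integral_lborel_vec_prod[OF hi] using one(2)
      by simp (intro exI[of _ i], simp add: h_def[abs_def])
  qed
qed

locale brownian_motion = prob_space M for M :: "'w measure" +
  fixes B :: "real \<Rightarrow> 'w \<Rightarrow> real ^ 'd"
  assumes bm: "standard_brownian_motion M B"
begin

abbreviation F :: "real \<Rightarrow> 'w measure" where "F \<equiv> aug_filtration M B"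

lemma B_measurable: "0 \<le> t \<Longrightarrow> B t \<in> borel_measurable M"
  using bm by (simp add: standard_brownian_motion_def)

lemma B_zero: "AE \<omega> in M. B 0 \<omega> = 0"
  using bm by (simp add: standard_brownian_motion_def)

definition F_gen :: "real \<Rightarrow> 'w set set" where
  "F_gen t = {B s -` A \<inter> space M | s A. 0 \<le> s \<and> s \<le> t \<and> A \<in> sets borel} \<union> null_sets M"

lemma F_gen_events: "F_gen t \<subseteq> events"
  using measurable_sets[OF B_measurable] by (auto simp: F_gen_def)

lemma space_F [simp]: "space (F t) = space M"
  by (simp add: aug_filtration_def space_measure_of_conv)

lemma sets_F: "sets (F t) = sigma_sets (space M) (F_gen t)"
  using F_gen_events sets.space_closed[of M] unfolding aug_filtration_def F_gen_def[symmetric]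
  by (intro sets_measure_of) blast

lemma subalgebra_F: "subalgebra M (F t)"
  using sets.sigma_sets_subset[OF F_gen_events, of t] by (simp add: subalgebra_def sets_F)

lemma subalgebra_F_mono: "s \<le> t \<Longrightarrow> subalgebra (F t) (F s)"
  unfolding subalgebra_def sets_F
  by (intro conjI sigma_sets_mono') (use order_trans in \<open>fastforce simp: F_gen_def\<close>)+

lemma measurable_F_mono: "f \<in> borel_measurable (F s) \<Longrightarrow> s \<le> t \<Longrightarrow> f \<in> borel_measurable (F t)"
  using measurable_from_subalg[OF subalgebra_F_mono] by blast

lemma measurable_F_M: "f \<in> borel_measurable (F s) \<Longrightarrow> f \<in> borel_measurable M"
  using measurable_from_subalg[OF subalgebra_F] by blast

lemma sets_F_M: "A \<in> sets (F t) \<Longrightarrow> A \<in> events"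
  using subalgebra_F[of t] by (auto simp: subalgebra_def)

lemma sets_F_mono: "A \<in> sets (F s) \<Longrightarrow> s \<le> t \<Longrightarrow> A \<in> sets (F t)"
  using subalgebra_F_mono[of s t] by (auto simp: subalgebra_def)

lemma measurable_F_cong:
  assumes "\<And>\<omega>. \<omega> \<in> space M \<Longrightarrow> f \<omega> = g \<omega>" "g \<in> borel_measurable (F s)"
  shows "f \<in> borel_measurable (F s)"
  using assms by (subst measurable_cong[of "F s" f g]) auto

lemma B_adapted: assumes "0 \<le> s" "s \<le> t" shows "B s \<in> borel_measurable (F t)"
proof (rule measurableI)
  fix A :: "(real^'d) set" assume "A \<in> sets borel"
  then have "B s -` A \<inter> space M \<in> F_gen t" using assms by (auto simp: F_gen_def)
  then show "B s -` A \<inter> space (F t) \<in> sets (F t)" by (simp add: sets_F)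
qed simp

text \<open>Only increments are known to be independent, so \<open>B\<^sub>r\<close> is replaced by \<open>B\<^sub>r - B\<^sub>0\<close>, which agrees with
it almost surely.\<close>

definition incr_gen :: "real set \<Rightarrow> 'w set set" where
  "incr_gen R = {(\<lambda>\<omega>. B r \<omega> - B 0 \<omega>) -` A \<inter> space M | r A. r \<in> R \<and> A \<in> sets borel}"

lemma incr_gen_events: "R \<subseteq> {0..s} \<Longrightarrow> sigma_sets (space M) (incr_gen R) \<subseteq> events"
  by (intro sets.sigma_sets_subset)
     (auto simp: incr_gen_def intro!: measurable_sets borel_measurable_diff B_measurable)

text \<open>The finite time set, together with \<open>0\<close> in front and \<open>s\<close>, \<open>t\<close> at the end, is a grid whose increments are
independent.  All values \<open>B\<^sub>r - B\<^sub>0\<close> at grid points are sums of increments before the last one, which is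
\<open>B\<^sub>t - B\<^sub>s\<close>.\<close>

lemma indep_incr_finite:
  assumes R: "finite R" "R \<subseteq> {0..s}" and st: "0 \<le> s" "s \<le> t"
    and C: "C \<in> sigma_sets (space M) (incr_gen R)" and D: "D \<in> sets borel"
  shows "prob (C \<inter> ((\<lambda>\<omega>. B t \<omega> - B s \<omega>) -` D \<inter> space M)) =
    prob C * prob ((\<lambda>\<omega>. B t \<omega> - B s \<omega>) -` D \<inter> space M)"
proof -
  define xs where "xs = sorted_list_of_set (insert 0 R)"
  define m where "m = length xs"
  define \<tau> where "\<tau> i = (if i < m then xs ! i else if i = m then s else t)" for i
  have set_xs: "set xs = insert 0 R" using R unfolding xs_def by (intro set_sorted_list_of_set) simp
  have sorted: "sorted xs" unfolding xs_def by (rule sorted_sorted_list_of_set)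
  have m0: "0 < m" using set_xs by (auto simp: m_def)
  have xs_le: "xs ! i \<in> {0..s}" if "i < m" for i
    using nth_mem[of i xs] that set_xs R(2) st by (auto simp: m_def)
  have tau0: "\<tau> 0 = 0"
  proof -
    obtain k where k: "k < m" "xs ! k = 0" using set_xs by (metis insertI1 in_set_conv_nth m_def)
    have "xs ! 0 \<le> xs ! k" using sorted k(1) by (intro sorted_nth_mono) (auto simp: m_def)
    then show ?thesis using xs_le[OF m0] k m0 by (simp add: \<tau>_def)
  qed
  have mono: "\<forall>i<Suc m. \<tau> i \<le> \<tau> (Suc i)"
  proof (intro allI impI)
    fix i assume i: "i < Suc m"
    show "\<tau> i \<le> \<tau> (Suc i)"
      using sorted_nth_mono[OF sorted, of i "Suc i"] xs_le[of i] i st by (auto simp: \<tau>_def m_def)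
  qed
  let ?X = "\<lambda>i \<omega>. B (\<tau> (Suc i)) \<omega> - B (\<tau> i) \<omega>"
  have ind: "indep_vars (\<lambda>_. borel) ?X {..<Suc m}"
    using bm tau0 mono unfolding standard_brownian_motion_def by simp
  let ?f = "\<lambda>\<omega>. restrict (\<lambda>i. ?X i \<omega>) {..<m}" and ?g = "\<lambda>\<omega>. restrict (\<lambda>i. ?X i \<omega>) {m}"
  have iv: "indep_var (PiM {..<m} (\<lambda>_. borel)) ?f (PiM {m} (\<lambda>_. borel)) ?g"
    using indep_var_restrict[OF ind, of "{..<m}" "{m}"] by auto
  have C': "C \<in> sigma_sets (space M) {?f -` A \<inter> space M | A. A \<in> sets (PiM {..<m} (\<lambda>_. borel))}"
  proof (rule subsetD[OF sigma_sets_mono C], rule subsetI)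
    fix E assume "E \<in> incr_gen R"
    then obtain r A where E: "E = (\<lambda>\<omega>. B r \<omega> - B 0 \<omega>) -` A \<inter> space M" "r \<in> R" "A \<in> sets borel"
      by (auto simp: incr_gen_def)
    obtain j where j: "j < m" "xs ! j = r" using set_xs E(2) by (metis insertI2 in_set_conv_nth m_def)
    let ?s = "\<lambda>x::nat \<Rightarrow> real^'d. \<Sum>i<j. x i"
    have s: "?s \<in> borel_measurable (PiM {..<m} (\<lambda>_. borel))"
      by (intro borel_measurable_sum measurable_component_singleton) (use j in auto)
    have eq: "?s (?f \<omega>) = B r \<omega> - B 0 \<omega>" for \<omega>
    proof -
      have "?s (?f \<omega>) = (\<Sum>i<j. B (\<tau> (Suc i)) \<omega> - B (\<tau> i) \<omega>)" using j by (intro sum.cong) auto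
      also have "\<dots> = B (\<tau> j) \<omega> - B (\<tau> 0) \<omega>" by (rule sum_lessThan_telescope)
      finally show ?thesis using j tau0 by (simp add: \<tau>_def)
    qed
    have "E = ?f -` (?s -` A \<inter> space (PiM {..<m} (\<lambda>_. borel))) \<inter> space M"
      unfolding E(1) eq[symmetric] by (auto simp: space_PiM)
    moreover have "?s -` A \<inter> space (PiM {..<m} (\<lambda>_. borel)) \<in> sets (PiM {..<m} (\<lambda>_. borel))"
      using s E(3) by (rule measurable_sets)
    ultimately show "E \<in> sigma_sets (space M) {?f -` A \<inter> space M | A. A \<in> sets (PiM {..<m} (\<lambda>_. borel))}"
      by (intro sigma_sets.Basic) blast
  qed
  let ?D = "(\<lambda>\<omega>. B t \<omega> - B s \<omega>) -` D \<inter> space M"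
  have D': "?D \<in> sigma_sets (space M) {?g -` A \<inter> space M | A. A \<in> sets (PiM {m} (\<lambda>_. borel))}"
  proof (rule sigma_sets.Basic, rule CollectI, intro exI conjI)
    show "?D = ?g -` ((\<lambda>x. x m) -` D \<inter> space (PiM {m} (\<lambda>_. borel))) \<inter> space M"
      by (auto simp: space_PiM \<tau>_def)
    show "(\<lambda>x. x m) -` D \<inter> space (PiM {m} (\<lambda>_. borel)) \<in> sets (PiM {m} (\<lambda>_. borel))"
      using D by (intro measurable_sets[of _ _ borel] measurable_component_singleton) auto
  qed
  show ?thesis
    using indep_setD[OF _ C' D'] iv unfolding indep_var_eq by blast
qed

text \<open>The events that coincide almost surely with an event from finitely many values \<open>B\<^sub>r - B\<^sub>0\<close>,
\<open>r \<le> s\<close>, are closed under intersection, because two finite time sets may be united.  They contain the generators of \<open>F\<^sub>s\<close>,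
including the null sets, and each of them is independent of the increment.\<close>

lemma indep_incr:
  assumes st: "0 \<le> s" "s \<le> t"
  shows "indep_set (sets (F s))
    (sigma_sets (space M) {(\<lambda>\<omega>. B t \<omega> - B s \<omega>) -` D \<inter> space M | D. D \<in> sets borel})"
proof -
  let ?I = "{(\<lambda>\<omega>. B t \<omega> - B s \<omega>) -` D \<inter> space M | D. D \<in> sets (borel :: (real^'d) measure)}"
  define P where "P = {C \<in> events. \<exists>R C0. finite R \<and> R \<subseteq> {0..s} \<and>
    C0 \<in> sigma_sets (space M) (incr_gen R) \<and> (AE \<omega> in M. \<omega> \<in> C \<longleftrightarrow> \<omega> \<in> C0)}"
  have Iev: "?I \<subseteq> events"
    using st by (auto intro!: measurable_sets borel_measurable_diff B_measurable)
  have "indep_set P ?I"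
  proof (rule indep_setI[OF _ Iev])
    show "P \<subseteq> events" by (auto simp: P_def)
    fix a b assume "a \<in> P" and b: "b \<in> ?I"
    then obtain R C0 where a: "a \<in> events" "finite R" "R \<subseteq> {0..s}"
      "C0 \<in> sigma_sets (space M) (incr_gen R)" "AE \<omega> in M. \<omega> \<in> a \<longleftrightarrow> \<omega> \<in> C0"
      unfolding P_def by blast
    have C0: "C0 \<in> events" using incr_gen_events[OF a(3)] a(4) by auto
    obtain D where D: "D \<in> sets borel" "b = (\<lambda>\<omega>. B t \<omega> - B s \<omega>) -` D \<inter> space M" using b by auto
    have bev: "b \<in> events" using Iev b by auto
    have "prob (a \<inter> b) = prob (C0 \<inter> b)"
      by (rule measure_eq_AE) (use a C0 bev in auto)
    also have "\<dots> = prob C0 * prob b"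
      using indep_incr_finite[OF a(2,3) st a(4) D(1)] D(2) by simp
    also have "prob C0 = prob a"
      by (rule measure_eq_AE) (use a C0 in auto)
    finally show "prob (a \<inter> b) = prob a * prob b" .
  qed
  moreover have "Int_stable P"
  proof (rule Int_stableI)
    fix a b assume aP: "a \<in> P" and bP: "b \<in> P"
    from aP obtain R C0 where a: "a \<in> events" "finite R" "R \<subseteq> {0..s}"
      "C0 \<in> sigma_sets (space M) (incr_gen R)" "AE \<omega> in M. \<omega> \<in> a \<longleftrightarrow> \<omega> \<in> C0"
      unfolding P_def by blast
    from bP obtain R' C0' where b: "b \<in> events" "finite R'" "R' \<subseteq> {0..s}"
      "C0' \<in> sigma_sets (space M) (incr_gen R')" "AE \<omega> in M. \<omega> \<in> b \<longleftrightarrow> \<omega> \<in> C0'"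
      unfolding P_def by blast
    have "incr_gen (R \<union> R') \<subseteq> Pow (space M)" unfolding incr_gen_def by blast
    then have S: "sets (sigma (space M) (incr_gen (R \<union> R'))) = sigma_sets (space M) (incr_gen (R \<union> R'))"
      by (rule sets_measure_of)
    have "incr_gen R \<subseteq> incr_gen (R \<union> R')" "incr_gen R' \<subseteq> incr_gen (R \<union> R')"
      unfolding incr_gen_def by blast+
    note sub = this[THEN sigma_sets_mono', of "space M"]
    have "C0 \<inter> C0' \<in> sigma_sets (space M) (incr_gen (R \<union> R'))"
      using subsetD[OF sub(1) a(4)] subsetD[OF sub(2) b(4)] unfolding S[symmetric] by (rule sets.Int)
    moreover have "AE \<omega> in M. \<omega> \<in> a \<inter> b \<longleftrightarrow> \<omega> \<in> C0 \<inter> C0'"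
      using a(5) b(5) by eventually_elim auto
    ultimately show "a \<inter> b \<in> P"
      unfolding P_def using a(1-3) b(1-3)
      by (intro CollectI conjI exI[of _ "R \<union> R'"] exI[of _ "C0 \<inter> C0'"]) auto
  qed
  moreover have "Int_stable ?I"
  proof (rule Int_stableI, clarify)
    fix D D' :: "(real^'d) set" assume "D \<in> sets borel" "D' \<in> sets borel"
    then show "\<exists>E. ((\<lambda>\<omega>. B t \<omega> - B s \<omega>) -` D \<inter> space M) \<inter> ((\<lambda>\<omega>. B t \<omega> - B s \<omega>) -` D' \<inter> space M)
        = (\<lambda>\<omega>. B t \<omega> - B s \<omega>) -` E \<inter> space M \<and> E \<in> sets borel"
      by (intro exI[of _ "D \<inter> D'"]) auto
  qed
  ultimately have ind: "indep_set (sigma_sets (space M) P) (sigma_sets (space M) ?I)"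
    by (rule indep_set_sigma_sets)
  have "F_gen s \<subseteq> P"
  proof
    fix C assume C: "C \<in> F_gen s"
    then have ev: "C \<in> events" using F_gen_events by auto
    consider (B) r A where "C = B r -` A \<inter> space M" "0 \<le> r" "r \<le> s" "A \<in> sets borel"
      | (null) "C \<in> null_sets M" using C by (auto simp: F_gen_def)
    then show "C \<in> P"
    proof cases
      case B
      have "AE \<omega> in M. \<omega> \<in> C \<longleftrightarrow> \<omega> \<in> (\<lambda>\<omega>. B r \<omega> - B 0 \<omega>) -` A \<inter> space M"
        using B_zero by eventually_elim (simp add: B(1))
      moreover have "(\<lambda>\<omega>. B r \<omega> - B 0 \<omega>) -` A \<inter> space M \<in> sigma_sets (space M) (incr_gen {r})"
        using B(4) by (intro sigma_sets.Basic) (auto simp: incr_gen_def)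
      ultimately show ?thesis unfolding P_def using ev B
        by (intro CollectI conjI exI[of _ "{r}"] exI) auto
    next
      case null
      have "AE \<omega> in M. \<omega> \<in> C \<longleftrightarrow> \<omega> \<in> {}"
        using AE_not_in[OF null] by eventually_elim auto
      then show ?thesis unfolding P_def using ev
        by (intro CollectI conjI exI[of _ "{}"]) (auto intro: sigma_sets.Empty)
    qed
  qed
  then have sub: "sets (F s) \<subseteq> sigma_sets (space M) P"
    unfolding sets_F by (rule sigma_sets_mono')
  show ?thesis
    using ind unfolding indep_set_def
    by (rule indep_sets_mono_sets) (use sub in \<open>auto split: bool.splits\<close>)
qed

lemma
  fixes h :: "real^'d \<Rightarrow> real"
  assumes st: "0 \<le> s" "s \<le> t" and U: "U \<in> borel_measurable (F s)" "integrable M U"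
    and h: "h \<in> borel_measurable borel" "integrable M (\<lambda>\<omega>. h (B t \<omega> - B s \<omega>))"
  shows integrable_mult_incr: "integrable M (\<lambda>\<omega>. U \<omega> * h (B t \<omega> - B s \<omega>))"
    and expectation_mult_incr:
      "expectation (\<lambda>\<omega>. U \<omega> * h (B t \<omega> - B s \<omega>)) = expectation U * expectation (\<lambda>\<omega>. h (B t \<omega> - B s \<omega>))"
proof -
  let ?I = "{(\<lambda>\<omega>. B t \<omega> - B s \<omega>) -` D \<inter> space M | D. D \<in> sets (borel :: (real^'d) measure)}"
  have "indep_var borel U borel (\<lambda>\<omega>. h (B t \<omega> - B s \<omega>))"
    unfolding indep_var_eq
  proof (intro conjI)
    show "random_variable borel U" using U(1) by (rule measurable_F_M)
    show "random_variable borel (\<lambda>\<omega>. h (B t \<omega> - B s \<omega>))" using h(2) by auto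
    have 1: "sigma_sets (space M) {U -` A \<inter> space M |A. A \<in> sets borel} \<subseteq> sets (F s)"
      using sets.sigma_sets_subset[of "{U -` A \<inter> space M |A. A \<in> sets borel}" "F s"]
        measurable_sets[OF U(1)] by auto
    have 2: "sigma_sets (space M) {(\<lambda>\<omega>. h (B t \<omega> - B s \<omega>)) -` A \<inter> space M |A. A \<in> sets borel}
        \<subseteq> sigma_sets (space M) ?I"
    proof (rule sigma_sets_mono', safe)
      fix A :: "real set" assume A: "A \<in> sets borel"
      show "\<exists>D. (\<lambda>\<omega>. h (B t \<omega> - B s \<omega>)) -` A \<inter> space M = (\<lambda>\<omega>. B t \<omega> - B s \<omega>) -` D \<inter> space M \<and> D \<in> sets borel"
        using measurable_sets[OF h(1) A] by (intro exI[of _ "h -` A"]) auto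
    qed
    show "indep_set (sigma_sets (space M) {U -` A \<inter> space M |A. A \<in> sets borel})
        (sigma_sets (space M) {(\<lambda>\<omega>. h (B t \<omega> - B s \<omega>)) -` A \<inter> space M |A. A \<in> sets borel})"
      using indep_incr[OF st] unfolding indep_set_def
      by (rule indep_sets_mono_sets) (use 1 2 in \<open>auto split: bool.splits\<close>)
  qed
  then show "integrable M (\<lambda>\<omega>. U \<omega> * h (B t \<omega> - B s \<omega>))"
    "expectation (\<lambda>\<omega>. U \<omega> * h (B t \<omega> - B s \<omega>)) = expectation U * expectation (\<lambda>\<omega>. h (B t \<omega> - B s \<omega>))"
    using U(2) h(2) by (rule indep_var_integrable, rule indep_var_lebesgue_integral)
qed

lemma
  assumes st: "0 \<le> s" "s \<le> t"
  shows integrable_incr: "integrable M (\<lambda>\<omega>. (B t \<omega> - B s \<omega>) $ i)"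
    and expectation_incr: "expectation (\<lambda>\<omega>. (B t \<omega> - B s \<omega>) $ i) = 0"
    and integrable_incr2: "integrable M (\<lambda>\<omega>. (B t \<omega> - B s \<omega>) $ i * (B t \<omega> - B s \<omega>) $ j)"
    and expectation_incr2:
      "expectation (\<lambda>\<omega>. (B t \<omega> - B s \<omega>) $ i * (B t \<omega> - B s \<omega>) $ j) = (if i = j then t - s else 0)"
proof -
  have "integrable M (\<lambda>\<omega>. (B t \<omega> - B s \<omega>) $ i) \<and> expectation (\<lambda>\<omega>. (B t \<omega> - B s \<omega>) $ i) = 0 \<and>
    integrable M (\<lambda>\<omega>. (B t \<omega> - B s \<omega>) $ i * (B t \<omega> - B s \<omega>) $ j) \<and>
    expectation (\<lambda>\<omega>. (B t \<omega> - B s \<omega>) $ i * (B t \<omega> - B s \<omega>) $ j) = (if i = j then t - s else 0)"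
  proof (cases "s = t")
    case True then show ?thesis by simp
  next
    case False
    then have lt: "s < t" and sq: "0 < sqrt (t - s)" "(sqrt (t - s))\<^sup>2 = t - s" using st by auto
    let ?f = "\<lambda>x::real^'d. \<Prod>k\<in>UNIV. normal_density 0 (sqrt (t - s)) (x $ k)"
    have d: "distributed M lborel (\<lambda>\<omega>. B t \<omega> - B s \<omega>) (\<lambda>x. ennreal (?f x))"
      using bm st lt unfolding standard_brownian_motion_def by blast
    have f0: "0 \<le> ?f x" for x by (intro prod_nonneg) auto
    have m1: "(\<lambda>x::real^'d. x $ i) \<in> borel_measurable lborel"
      and m2: "(\<lambda>x::real^'d. x $ i * x $ j) \<in> borel_measurable lborel" by measurable
    show ?thesis
      using integrable_gauss_coord[OF sq(1), of i] integral_gauss_coord[OF sq(1), of i]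
        integrable_gauss_coord2[OF sq(1), of i j] integral_gauss_coord2[OF sq(1), of i j]
        distributed_integrable[OF d m1 f0] distributed_integral[OF d m1 f0]
        distributed_integrable[OF d m2 f0] distributed_integral[OF d m2 f0] sq(2)
      by simp
  qed
  then show "integrable M (\<lambda>\<omega>. (B t \<omega> - B s \<omega>) $ i)" "expectation (\<lambda>\<omega>. (B t \<omega> - B s \<omega>) $ i) = 0"
    "integrable M (\<lambda>\<omega>. (B t \<omega> - B s \<omega>) $ i * (B t \<omega> - B s \<omega>) $ j)"
    "expectation (\<lambda>\<omega>. (B t \<omega> - B s \<omega>) $ i * (B t \<omega> - B s \<omega>) $ j) = (if i = j then t - s else 0)"
    by blast+
qed

end

section \<open>The Ito isometry and the martingale property\<close>

lemma integral_sum2: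
  fixes f :: "'i \<Rightarrow> 'j \<Rightarrow> 'a \<Rightarrow> real"
  assumes "\<And>i j. i \<in> I \<Longrightarrow> j \<in> J \<Longrightarrow> integrable N (f i j)"
  shows "(\<integral>x. (\<Sum>i\<in>I. \<Sum>j\<in>J. f i j x) \<partial>N) = (\<Sum>i\<in>I. \<Sum>j\<in>J. \<integral>x. f i j x \<partial>N)"
  using assms by (simp add: Bochner_Integration.integral_sum Bochner_Integration.integrable_sum)

context brownian_motion
begin

definition bounded_F :: "real \<Rightarrow> ('w \<Rightarrow> 'b::euclidean_space) \<Rightarrow> bool" where
  "bounded_F s \<phi> \<longleftrightarrow> \<phi> \<in> borel_measurable (F s) \<and> (\<exists>K. \<forall>\<omega>\<in>space M. norm (\<phi> \<omega>) \<le> K)"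

definition L2_F :: "real \<Rightarrow> ('w \<Rightarrow> real) \<Rightarrow> bool" where
  "L2_F s g \<longleftrightarrow> g \<in> borel_measurable (F s) \<and> L2_fun M g"

lemma bounded_F_mono: "bounded_F s \<phi> \<Longrightarrow> s \<le> t \<Longrightarrow> bounded_F t \<phi>"
  unfolding bounded_F_def using measurable_F_mono by blast

lemma L2_F_mono: "L2_F s g \<Longrightarrow> s \<le> t \<Longrightarrow> L2_F t g"
  unfolding L2_F_def using measurable_F_mono by blast

lemma L2_fun_bounded_mult:
  fixes h g :: "'w \<Rightarrow> real"
  assumes "bounded_F s h" "L2_fun M g"
  shows "L2_fun M (\<lambda>\<omega>. h \<omega> * g \<omega>)"
proof -
  obtain K where "\<And>\<omega>. \<omega> \<in> space M \<Longrightarrow> \<bar>h \<omega>\<bar> \<le> K" using assms(1) by (auto simp: bounded_F_def)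
  moreover have "h \<in> borel_measurable M" using assms(1) measurable_F_M unfolding bounded_F_def by blast
  ultimately show ?thesis using L2_fun_bounded_scaleR[OF assms(2), of h K] by simp
qed

lemma L2_F_bounded_mult:
  fixes h g :: "'w \<Rightarrow> real"
  assumes "bounded_F s h" "L2_F s g"
  shows "L2_F s (\<lambda>\<omega>. h \<omega> * g \<omega>)"
  using L2_fun_bounded_mult[OF assms(1)] assms by (auto simp: L2_F_def bounded_F_def)

lemma bounded_F_indicator: "A \<in> sets (F s) \<Longrightarrow> bounded_F s (indicat_real A)"
  unfolding bounded_F_def by (auto intro!: exI[of _ 1] simp: indicator_def)

lemma bounded_F_nth:
  fixes \<phi> :: "'w \<Rightarrow> real^'d"
  assumes "bounded_F s \<phi>"
  shows "bounded_F s (\<lambda>\<omega>. \<phi> \<omega> $ i)"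
proof -
  obtain K where K: "\<And>\<omega>. \<omega> \<in> space M \<Longrightarrow> norm (\<phi> \<omega>) \<le> K" using assms by (auto simp: bounded_F_def)
  have "\<bar>\<phi> \<omega> $ i\<bar> \<le> K" if "\<omega> \<in> space M" for \<omega>
    using component_le_norm_cart[of "\<phi> \<omega>" i] K[OF that] by linarith
  moreover have "(\<lambda>\<omega>. \<phi> \<omega> $ i) \<in> borel_measurable (F s)"
  proof (rule measurable_compose[where f = \<phi> and N = borel])
    show "\<phi> \<in> borel_measurable (F s)" using assms unfolding bounded_F_def by blast
    show "(\<lambda>x::real^'d. x $ i) \<in> borel_measurable borel" by measurable
  qed
  ultimately show ?thesis unfolding bounded_F_def by auto
qed

lemma bounded_F_mult:
  fixes f g :: "'w \<Rightarrow> real"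
  assumes "bounded_F s f" "bounded_F s g"
  shows "bounded_F s (\<lambda>\<omega>. f \<omega> * g \<omega>)"
proof -
  obtain K L where K: "\<And>\<omega>. \<omega> \<in> space M \<Longrightarrow> \<bar>f \<omega>\<bar> \<le> K" and L: "\<And>\<omega>. \<omega> \<in> space M \<Longrightarrow> \<bar>g \<omega>\<bar> \<le> L"
    using assms by (auto simp: bounded_F_def)
  have "\<bar>f \<omega> * g \<omega>\<bar> \<le> K * L" if "\<omega> \<in> space M" for \<omega>
    using mult_mono[OF K[OF that] L[OF that]] K[OF that] by (simp add: abs_mult)
  then show ?thesis using assms unfolding bounded_F_def by auto
qed

lemma integrable_bounded_F:
  fixes f :: "'w \<Rightarrow> real"
  assumes "bounded_F s f"
  shows "integrable M f"
proof -
  obtain K where K: "\<And>\<omega>. \<omega> \<in> space M \<Longrightarrow> norm (f \<omega>) \<le> K" using assms by (auto simp: bounded_F_def)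
  show ?thesis
  proof (rule integrable_const_bound)
    show "AE \<omega> in M. norm (f \<omega>) \<le> K" using K by (intro AE_I2)
    show "f \<in> borel_measurable M" using assms measurable_F_M unfolding bounded_F_def by blast
  qed
qed

lemma L2_fun_bounded_F:
  fixes f :: "'w \<Rightarrow> real"
  assumes "bounded_F s f"
  shows "L2_fun M f"
  unfolding L2_fun_def
proof
  show "f \<in> borel_measurable M" using assms measurable_F_M unfolding bounded_F_def by blast
  show "integrable M (\<lambda>\<omega>. (norm (f \<omega>))\<^sup>2)"
    using integrable_bounded_F[OF bounded_F_mult[OF assms assms]] by (simp add: power2_eq_square)
qed

lemma L2_fun_incr:
  assumes "0 \<le> s" "s \<le> t"
  shows "L2_fun M (\<lambda>\<omega>. (B t \<omega> - B s \<omega>) $ i)"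
  unfolding L2_fun_def
proof
  show "(\<lambda>\<omega>. (B t \<omega> - B s \<omega>) $ i) \<in> borel_measurable M"
    using integrable_incr[OF assms] by (rule borel_measurable_integrable)
  show "integrable M (\<lambda>\<omega>. (norm ((B t \<omega> - B s \<omega>) $ i))\<^sup>2)"
    using integrable_incr2[OF assms, of i i]
    by (simp only: real_norm_def power2_abs) (simp only: power2_eq_square)
qed

lemma L2_fun_inner_incr:
  assumes st: "0 \<le> s" "s \<le> t" and \<phi>: "bounded_F r \<phi>"
  shows "L2_fun M (\<lambda>\<omega>. \<phi> \<omega> \<bullet> (B t \<omega> - B s \<omega>))"
proof -
  have "L2_fun M (\<lambda>\<omega>. \<Sum>i\<in>UNIV. \<phi> \<omega> $ i * (B t \<omega> - B s \<omega>) $ i)"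
    by (rule L2_fun_sum) (rule L2_fun_bounded_mult[OF bounded_F_nth[OF \<phi>] L2_fun_incr[OF st]])
  then show ?thesis by (simp only: inner_vec_def inner_real_def)
qed

lemma L2_F_inner_incr:
  assumes st: "0 \<le> s" "s \<le> t" and \<phi>: "bounded_F t \<phi>"
  shows "L2_F t (\<lambda>\<omega>. \<phi> \<omega> \<bullet> (B t \<omega> - B s \<omega>))"
proof -
  have 1: "\<phi> \<in> borel_measurable (F t)" using \<phi> by (simp add: bounded_F_def)
  have 2: "B t \<in> borel_measurable (F t)" by (rule B_adapted) (use st in auto)
  have 3: "B s \<in> borel_measurable (F t)" using st by (rule B_adapted)
  have "(\<lambda>\<omega>. \<phi> \<omega> \<bullet> (B t \<omega> - B s \<omega>)) \<in> borel_measurable (F t)"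
    using 1 2 3 by (intro borel_measurable_inner borel_measurable_diff)
  then show ?thesis using L2_fun_inner_incr[OF st \<phi>] unfolding L2_F_def by blast
qed

lemma expectation_inner_incr:
  assumes st: "0 \<le> s" "s \<le> t" and \<phi>: "bounded_F s \<phi>" and g: "L2_F s g"
  shows "expectation (\<lambda>\<omega>. g \<omega> * (\<phi> \<omega> \<bullet> (B t \<omega> - B s \<omega>))) = 0"
proof -
  have U: "L2_F s (\<lambda>\<omega>. \<phi> \<omega> $ i * g \<omega>)" for i
    by (rule L2_F_bounded_mult[OF bounded_F_nth[OF \<phi>] g])
  have int: "integrable M (\<lambda>\<omega>. \<phi> \<omega> $ i * g \<omega>)" for i
    using integrable_mult_L2[OF _ L2_fun_bounded_F[OF bounded_F_nth[OF \<phi>]], of g i] g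
    by (simp add: L2_F_def mult.commute)
  have m: "(\<lambda>x::real^'d. x $ i) \<in> borel_measurable borel" for i by measurable
  have "expectation (\<lambda>\<omega>. (\<phi> \<omega> $ i * g \<omega>) * (B t \<omega> - B s \<omega>) $ i) = 0" for i
    using expectation_mult_incr[OF st _ int m integrable_incr[OF st], of i i] U[of i]
      expectation_incr[OF st, of i] by (simp add: L2_F_def)
  moreover have "integrable M (\<lambda>\<omega>. (\<phi> \<omega> $ i * g \<omega>) * (B t \<omega> - B s \<omega>) $ i)" for i
    using integrable_mult_incr[OF st _ int m integrable_incr[OF st], of i i] U[of i]
    by (simp add: L2_F_def)
  moreover have "g \<omega> * (\<phi> \<omega> \<bullet> (B t \<omega> - B s \<omega>)) = (\<Sum>i\<in>UNIV. (\<phi> \<omega> $ i * g \<omega>) * (B t \<omega> - B s \<omega>) $ i)" for \<omega>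
    unfolding inner_vec_def inner_real_def sum_distrib_left by (intro sum.cong) auto
  ultimately show ?thesis by (simp add: Bochner_Integration.integral_sum)
qed

lemma expectation_inner_incr2:
  assumes st: "0 \<le> s" "s \<le> t" and \<phi>: "bounded_F s \<phi>" and \<psi>: "bounded_F s \<psi>" and h: "bounded_F s h"
  shows "expectation (\<lambda>\<omega>. h \<omega> * ((\<phi> \<omega> \<bullet> (B t \<omega> - B s \<omega>)) * (\<psi> \<omega> \<bullet> (B t \<omega> - B s \<omega>)))) =
    (t - s) * expectation (\<lambda>\<omega>. h \<omega> * (\<phi> \<omega> \<bullet> \<psi> \<omega>))"
proof -
  let ?U = "\<lambda>i j \<omega>. h \<omega> * (\<phi> \<omega> $ i * \<psi> \<omega> $ j)"
  let ?D = "\<lambda>\<omega>. B t \<omega> - B s \<omega>"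
  have U: "bounded_F s (?U i j)" for i j
    by (intro bounded_F_mult bounded_F_nth \<phi> \<psi> h)
  note Ui = integrable_bounded_F[OF U]
  have Um: "?U i j \<in> borel_measurable (F s)" for i j using U[of i j] unfolding bounded_F_def by blast
  have m: "(\<lambda>x::real^'d. x $ i * x $ j) \<in> borel_measurable borel" for i j by measurable
  have e: "expectation (\<lambda>\<omega>. ?U i j \<omega> * (?D \<omega> $ i * ?D \<omega> $ j)) =
      (if i = j then (t - s) * expectation (?U i j) else 0)" for i j
    using expectation_mult_incr[OF st Um Ui m integrable_incr2[OF st], of i j i j]
      expectation_incr2[OF st, of i j] by simp
  have i: "integrable M (\<lambda>\<omega>. ?U i j \<omega> * (?D \<omega> $ i * ?D \<omega> $ j))" for i j
    using integrable_mult_incr[OF st Um Ui m integrable_incr2[OF st], of i j i j] by simp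
  have eq: "h \<omega> * ((\<phi> \<omega> \<bullet> ?D \<omega>) * (\<psi> \<omega> \<bullet> ?D \<omega>)) =
      (\<Sum>i\<in>UNIV. \<Sum>j\<in>UNIV. ?U i j \<omega> * (?D \<omega> $ i * ?D \<omega> $ j))" for \<omega>
    unfolding inner_vec_def inner_real_def sum_product
    unfolding sum_distrib_left by (intro sum.cong refl) (simp only: mult_ac)
  have "expectation (\<lambda>\<omega>. h \<omega> * ((\<phi> \<omega> \<bullet> ?D \<omega>) * (\<psi> \<omega> \<bullet> ?D \<omega>))) =
      (\<Sum>i\<in>UNIV. \<Sum>j\<in>UNIV. expectation (\<lambda>\<omega>. ?U i j \<omega> * (?D \<omega> $ i * ?D \<omega> $ j)))"
    unfolding eq by (rule integral_sum2[OF i])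
  also have "\<dots> = (\<Sum>i\<in>UNIV. \<Sum>j\<in>UNIV. if i = j then (t - s) * expectation (?U i j) else 0)"
    unfolding e ..
  also have "\<dots> = (t - s) * (\<Sum>i\<in>UNIV. expectation (?U i i))"
    by (simp add: sum_distrib_left)
  also have "(\<Sum>i\<in>UNIV. expectation (?U i i)) = expectation (\<lambda>\<omega>. h \<omega> * (\<phi> \<omega> \<bullet> \<psi> \<omega>))"
    using Ui by (simp add: inner_vec_def sum_distrib_left Bochner_Integration.integral_sum)
  finally show ?thesis .
qed

text \<open>Only the overlap of the two intervals contributes to the covariance: every other pair of pieces contains an increment
that is independent of the past, in which the other factors are measurable.\<close>

lemma expectation_incr_overlap:
  assumes st: "0 \<le> s1" "s1 \<le> t1" "0 \<le> s2" "s2 \<le> t2"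
    and \<phi>: "bounded_F s1 \<phi>" and \<psi>: "bounded_F s2 \<psi>" and h: "bounded_F r h" "r \<le> s1" "r \<le> s2"
  shows "expectation (\<lambda>\<omega>. h \<omega> * ((\<phi> \<omega> \<bullet> (B t1 \<omega> - B s1 \<omega>)) * (\<psi> \<omega> \<bullet> (B t2 \<omega> - B s2 \<omega>)))) =
    max 0 (min t1 t2 - max s1 s2) * expectation (\<lambda>\<omega>. h \<omega> * (\<phi> \<omega> \<bullet> \<psi> \<omega>))"
  using st \<phi> \<psi> h(2,3)
proof (induction s1 s2 arbitrary: t1 t2 \<phi> \<psi> rule: linorder_wlog)
  case (sym s1 s2)
  from sym(1)[OF sym(4,5,2,3) sym(7,6) sym(9,8)] show ?case
    by (simp add: mult.commute[of "\<phi> _ \<bullet> _"] inner_commute min.commute max.commute)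
next
  case (le s1 s2)
  note \<phi> = le(6) and \<psi> = le(7)
  have \<phi>2: "bounded_F s2 \<phi>" using \<phi> le(1) by (rule bounded_F_mono)
  have h2: "bounded_F s2 h" using h(1) le(9) by (rule bounded_F_mono)
  show ?case
  proof (cases "t1 \<le> s2")
    case True
    have "L2_F s2 (\<lambda>\<omega>. h \<omega> * (\<phi> \<omega> \<bullet> (B t1 \<omega> - B s1 \<omega>)))"
      using \<phi> le h(1) True
      by (intro L2_F_bounded_mult[OF h2] L2_F_mono[OF L2_F_inner_incr]) (auto intro: bounded_F_mono)
    from expectation_inner_incr[OF le(4,5) \<psi> this] show ?thesis using True le(1) by (simp add: mult.assoc)
  next
    case False
    \<comment> \<open>cut both intervals at \<open>s2\<close> and \<open>m\<close>; \<open>[s2, m]\<close> is the overlap, and one of \<open>?a3\<close>, \<open>?b2\<close> is zero\<close>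
    define m where "m = min t1 t2"
    have m: "s2 \<le> m" "m \<le> t1" "m \<le> t2" "0 \<le> m" using False le by (auto simp: m_def)
    let ?a1 = "\<lambda>\<omega>. \<phi> \<omega> \<bullet> (B s2 \<omega> - B s1 \<omega>)" and ?a2 = "\<lambda>\<omega>. \<phi> \<omega> \<bullet> (B m \<omega> - B s2 \<omega>)"
      and ?a3 = "\<lambda>\<omega>. \<phi> \<omega> \<bullet> (B t1 \<omega> - B m \<omega>)"
      and ?b1 = "\<lambda>\<omega>. \<psi> \<omega> \<bullet> (B m \<omega> - B s2 \<omega>)" and ?b2 = "\<lambda>\<omega>. \<psi> \<omega> \<bullet> (B t2 \<omega> - B m \<omega>)"
    have \<phi>m: "bounded_F m \<phi>" and \<psi>m: "bounded_F m \<psi>" and hm: "bounded_F m h"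
      using \<phi>2 \<psi> h2 m(1) by (auto intro: bounded_F_mono)
    have A1: "L2_F s2 (\<lambda>\<omega>. h \<omega> * ?a1 \<omega>)"
      using le m by (intro L2_F_bounded_mult[OF h2] L2_F_inner_incr \<phi>2) auto
    have A1m: "L2_F m (\<lambda>\<omega>. h \<omega> * ?a1 \<omega>)" using A1 m(1) by (rule L2_F_mono)
    have A2: "L2_F m (\<lambda>\<omega>. h \<omega> * ?a2 \<omega>)"
      using le m by (intro L2_F_bounded_mult[OF hm] L2_F_inner_incr \<phi>m) auto
    have B1: "L2_F m (\<lambda>\<omega>. h \<omega> * ?b1 \<omega>)"
      using le m by (intro L2_F_bounded_mult[OF hm] L2_F_inner_incr \<psi>m) auto
    have L2a: "L2_fun M ?a1" "L2_fun M ?a2" "L2_fun M ?a3" and L2b: "L2_fun M ?b1" "L2_fun M ?b2"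
      using le m \<phi> \<psi> by (auto intro!: L2_fun_inner_incr)
    note ha = L2a[THEN L2_fun_bounded_mult[OF h(1)]]
    have e11: "expectation (\<lambda>\<omega>. h \<omega> * ?a1 \<omega> * ?b1 \<omega>) = 0"
      by (rule expectation_inner_incr[OF _ _ \<psi> A1]) (use le m in auto)
    have e12: "expectation (\<lambda>\<omega>. h \<omega> * ?a1 \<omega> * ?b2 \<omega>) = 0"
      by (rule expectation_inner_incr[OF _ _ \<psi>m A1m]) (use le m in auto)
    have e22: "expectation (\<lambda>\<omega>. h \<omega> * ?a2 \<omega> * ?b2 \<omega>) = 0"
      by (rule expectation_inner_incr[OF _ _ \<psi>m A2]) (use le m in auto)
    have e31: "expectation (\<lambda>\<omega>. h \<omega> * ?a3 \<omega> * ?b1 \<omega>) = 0"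
      using expectation_inner_incr[OF m(4,2) \<phi>m B1] by (simp add: mult.assoc mult.commute[of "?b1 _"])
    have "m = t1 \<or> m = t2" by (auto simp: m_def)
    then have e32: "expectation (\<lambda>\<omega>. h \<omega> * ?a3 \<omega> * ?b2 \<omega>) = 0" by (elim disjE) simp_all
    have e21: "expectation (\<lambda>\<omega>. h \<omega> * ?a2 \<omega> * ?b1 \<omega>) = (m - s2) * expectation (\<lambda>\<omega>. h \<omega> * (\<phi> \<omega> \<bullet> \<psi> \<omega>))"
      using expectation_inner_incr2[OF le(4) m(1) \<phi>2 \<psi> h2] by (simp add: mult.assoc)
    have "(\<lambda>\<omega>. h \<omega> * ((\<phi> \<omega> \<bullet> (B t1 \<omega> - B s1 \<omega>)) * (\<psi> \<omega> \<bullet> (B t2 \<omega> - B s2 \<omega>)))) =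
        (\<lambda>\<omega>. h \<omega> * ?a1 \<omega> * ?b1 \<omega> + h \<omega> * ?a1 \<omega> * ?b2 \<omega> + h \<omega> * ?a2 \<omega> * ?b1 \<omega> +
          h \<omega> * ?a2 \<omega> * ?b2 \<omega> + h \<omega> * ?a3 \<omega> * ?b1 \<omega> + h \<omega> * ?a3 \<omega> * ?b2 \<omega>)"
      by (simp add: fun_eq_iff inner_diff_right algebra_simps)
    then have "expectation (\<lambda>\<omega>. h \<omega> * ((\<phi> \<omega> \<bullet> (B t1 \<omega> - B s1 \<omega>)) * (\<psi> \<omega> \<bullet> (B t2 \<omega> - B s2 \<omega>)))) =
        expectation (\<lambda>\<omega>. h \<omega> * ?a1 \<omega> * ?b1 \<omega>) + expectation (\<lambda>\<omega>. h \<omega> * ?a1 \<omega> * ?b2 \<omega>) +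
        expectation (\<lambda>\<omega>. h \<omega> * ?a2 \<omega> * ?b1 \<omega>) + expectation (\<lambda>\<omega>. h \<omega> * ?a2 \<omega> * ?b2 \<omega>) +
        expectation (\<lambda>\<omega>. h \<omega> * ?a3 \<omega> * ?b1 \<omega>) + expectation (\<lambda>\<omega>. h \<omega> * ?a3 \<omega> * ?b2 \<omega>)"
      using integrable_mult_L2[OF ha(1) L2b(1)] integrable_mult_L2[OF ha(1) L2b(2)]
        integrable_mult_L2[OF ha(2) L2b(1)] integrable_mult_L2[OF ha(2) L2b(2)]
        integrable_mult_L2[OF ha(3) L2b(1)] integrable_mult_L2[OF ha(3) L2b(2)]
      by (simp only: Bochner_Integration.integral_add Bochner_Integration.integrable_add)
    also have "\<dots> = (m - s2) * expectation (\<lambda>\<omega>. h \<omega> * (\<phi> \<omega> \<bullet> \<psi> \<omega>))"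
      unfolding e11 e12 e21 e22 e31 e32 by simp
    finally show ?thesis using m le(1) by (simp add: m_def max_def)
  qed
qed

lemma step_integrandD:
  assumes "step_integrand M F a b n \<tau> \<phi>" "0 \<le> a" "i < n"
  shows "bounded_F (\<tau> i) (\<phi> i)" "0 \<le> \<tau> i" "a \<le> \<tau> i" "\<tau> i \<le> \<tau> (Suc i)" "\<tau> (Suc i) \<le> b"
  using assms by (auto simp: step_integrand_def bounded_F_def Suc_le_eq intro: order_trans)

lemma L2_step_ito_integral:
  assumes "step_integrand M F a b n \<tau> \<phi>" "0 \<le> a"
  shows "L2_fun M (step_ito_integral B n \<tau> \<phi>)"
  unfolding step_ito_integral_def[abs_def]
  using step_integrandD[OF assms] by (intro L2_fun_sum L2_fun_inner_incr) auto

lemma expectation_step_ito_integral: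
  assumes st: "step_integrand M F a b n \<tau> \<phi>" "0 \<le> a" and g: "L2_F a g"
  shows "expectation (\<lambda>\<omega>. g \<omega> * step_ito_integral B n \<tau> \<phi> \<omega>) = 0"
proof -
  have "expectation (\<lambda>\<omega>. g \<omega> * (\<phi> i \<omega> \<bullet> (B (\<tau> (Suc i)) \<omega> - B (\<tau> i) \<omega>))) = 0" if "i < n" for i
    using step_integrandD[OF st that] g by (intro expectation_inner_incr) (auto intro: L2_F_mono)
  moreover have "integrable M (\<lambda>\<omega>. g \<omega> * (\<phi> i \<omega> \<bullet> (B (\<tau> (Suc i)) \<omega> - B (\<tau> i) \<omega>)))" if "i < n" for i
    using step_integrandD[OF st that] g by (intro integrable_mult_L2 L2_fun_inner_incr) (auto simp: L2_F_def)
  ultimately show ?thesis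
    by (simp add: step_ito_integral_def sum_distrib_left Bochner_Integration.integral_sum)
qed

lemma L2_fun_vec_bounded_F:
  fixes \<phi> :: "'w \<Rightarrow> real^'d"
  assumes "bounded_F s \<phi>"
  shows "L2_fun M \<phi>"
proof -
  obtain K where K: "\<And>\<omega>. \<omega> \<in> space M \<Longrightarrow> norm (\<phi> \<omega>) \<le> K" using assms by (auto simp: bounded_F_def)
  show ?thesis
  proof (rule L2_fun_bound)
    show "L2_fun M (\<lambda>\<omega>. 1::real)" by (simp add: L2_fun_def)
    show "\<phi> \<in> borel_measurable M" using assms measurable_F_M unfolding bounded_F_def by blast
    show "AE \<omega> in M. norm (\<phi> \<omega>) \<le> K * norm (1::real)" using K by auto
  qed
qed

lemma L2_step_term:
  fixes \<zeta> :: "'w \<Rightarrow> real^'d"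
  assumes "L2_fun M \<zeta>"
  shows "L2_fun (lborel \<Otimes>\<^sub>M M) (\<lambda>x. indicat_real {s<..t::real} (fst x) *\<^sub>R \<zeta> (snd x))"
proof -
  have "sq_on M {s<..t} (\<lambda>_. \<zeta>)"
    by (rule sq_on_subset[OF sq_on_const[OF assms, of s t]]) auto
  then show ?thesis by (simp add: sq_on_def)
qed

lemma L2_step_process:
  fixes \<phi> :: "nat \<Rightarrow> 'w \<Rightarrow> real^'d"
  assumes "step_integrand M F a b n \<tau> \<phi>" "0 \<le> a"
  shows "L2_fun (lborel \<Otimes>\<^sub>M M) (\<lambda>x. step_process n \<tau> \<phi> (fst x) (snd x))"
  unfolding step_process_def
  by (intro L2_fun_sum L2_step_term L2_fun_vec_bounded_F[OF step_integrandD(1)[OF assms]]) simp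

lemma integral_step_term:
  fixes \<phi> \<psi> :: "'w \<Rightarrow> real^'d"
  assumes \<phi>: "L2_fun M \<phi>" and \<psi>: "L2_fun M \<psi>" and A: "A \<in> events"
    and st: "s1 \<le> t1" "s2 \<le> (t2::real)"
  shows "integrable (lborel \<Otimes>\<^sub>M M) (\<lambda>x. indicat_real A (snd x) *
      ((indicat_real {s1<..t1} (fst x) *\<^sub>R \<phi> (snd x)) \<bullet> (indicat_real {s2<..t2} (fst x) *\<^sub>R \<psi> (snd x))))" (is ?I)
    "(\<integral>x. indicat_real A (snd x) * ((indicat_real {s1<..t1} (fst x) *\<^sub>R \<phi> (snd x)) \<bullet>
      (indicat_real {s2<..t2} (fst x) *\<^sub>R \<psi> (snd x))) \<partial>(lborel \<Otimes>\<^sub>M M)) =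
      max 0 (min t1 t2 - max s1 s2) * expectation (\<lambda>\<omega>. indicat_real A \<omega> * (\<phi> \<omega> \<bullet> \<psi> \<omega>))" (is ?E)
proof -
  let ?f = "\<lambda>x. indicat_real A (snd x) * ((indicat_real {s1<..t1} (fst x) *\<^sub>R \<phi> (snd x)) \<bullet>
      (indicat_real {s2<..t2} (fst x) *\<^sub>R \<psi> (snd x)))"
  have "L2_fun (lborel \<Otimes>\<^sub>M M) (\<lambda>x. indicat_real A (snd x) *\<^sub>R (indicat_real {s1<..t1} (fst x) *\<^sub>R \<phi> (snd x)))"
    using A by (intro L2_fun_bounded_scaleR[OF L2_step_term[OF \<phi>], where K = 1]) (auto simp: indicator_def)
  from integrable_inner_L2[OF this L2_step_term[OF \<psi>, of s2 t2]]
  show I: ?I by (simp add: mult_ac)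
  have "(\<integral>x. ?f x \<partial>(lborel \<Otimes>\<^sub>M M)) = (\<integral>s. (\<integral>\<omega>. ?f (s, \<omega>) \<partial>M) \<partial>lborel)"
    using time.integral_fst'[OF I] by simp
  also have "\<dots> = (\<integral>s. indicat_real {max s1 s2<..min t1 t2} s * expectation (\<lambda>\<omega>. indicat_real A \<omega> * (\<phi> \<omega> \<bullet> \<psi> \<omega>)) \<partial>lborel)"
  proof (rule Bochner_Integration.integral_cong[OF refl])
    fix s
    have eq: "?f (s, \<omega>) = indicat_real {max s1 s2<..min t1 t2} s * (indicat_real A \<omega> * (\<phi> \<omega> \<bullet> \<psi> \<omega>))" for \<omega>
      by (auto simp: indicator_def)
    show "(\<integral>\<omega>. ?f (s, \<omega>) \<partial>M) = indicat_real {max s1 s2<..min t1 t2} s * expectation (\<lambda>\<omega>. indicat_real A \<omega> * (\<phi> \<omega> \<bullet> \<psi> \<omega>))"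
      unfolding eq by (rule Bochner_Integration.integral_mult_right_zero)
  qed
  also have "\<dots> = max 0 (min t1 t2 - max s1 s2) * expectation (\<lambda>\<omega>. indicat_real A \<omega> * (\<phi> \<omega> \<bullet> \<psi> \<omega>))"
    by (cases "max s1 s2 \<le> min t1 t2") (auto simp: max_def)
  finally show ?E .
qed

text \<open>Both sides are bilinear, so this is the covariance over overlapping intervals summed over all pairs of steps.\<close>

lemma step_ito_isometry:
  assumes st: "step_integrand M F a b n \<tau> \<phi>" "0 \<le> a"
    and st': "step_integrand M F a' b' n' \<tau>' \<phi>'" "0 \<le> a'"
    and A: "A \<in> sets (F r)" "r \<le> a" "r \<le> a'"
  shows "expectation (\<lambda>\<omega>. indicat_real A \<omega> * (step_ito_integral B n \<tau> \<phi> \<omega> * step_ito_integral B n' \<tau>' \<phi>' \<omega>)) =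
    (\<integral>x. indicat_real A (snd x) * (step_process n \<tau> \<phi> (fst x) (snd x) \<bullet> step_process n' \<tau>' \<phi>' (fst x) (snd x)) \<partial>(lborel \<Otimes>\<^sub>M M))"
proof -
  let ?d = "\<lambda>i \<omega>. \<phi> i \<omega> \<bullet> (B (\<tau> (Suc i)) \<omega> - B (\<tau> i) \<omega>)" and ?d' = "\<lambda>i \<omega>. \<phi>' i \<omega> \<bullet> (B (\<tau>' (Suc i)) \<omega> - B (\<tau>' i) \<omega>)"
  let ?p = "\<lambda>i x. indicat_real {\<tau> i<..\<tau> (Suc i)} (fst x) *\<^sub>R \<phi> i (snd x)"
  let ?p' = "\<lambda>i x. indicat_real {\<tau>' i<..\<tau>' (Suc i)} (fst x) *\<^sub>R \<phi>' i (snd x)"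
  note D = step_integrandD[OF st] and D' = step_integrandD[OF st']
  have h: "bounded_F r (indicat_real A)" by (rule bounded_F_indicator[OF A(1)])
  have i: "integrable M (\<lambda>\<omega>. indicat_real A \<omega> * (?d i \<omega> * ?d' j \<omega>))" if "i < n" "j < n'" for i j
    using integrable_mult_L2[OF L2_fun_bounded_mult[OF h L2_fun_inner_incr[OF D(2,4,1)[OF that(1)]]]
      L2_fun_inner_incr[OF D'(2,4,1)[OF that(2)]]] by (simp add: mult.assoc)
  have "expectation (\<lambda>\<omega>. indicat_real A \<omega> * (step_ito_integral B n \<tau> \<phi> \<omega> * step_ito_integral B n' \<tau>' \<phi>' \<omega>)) =
      expectation (\<lambda>\<omega>. \<Sum>i<n. \<Sum>j<n'. indicat_real A \<omega> * (?d i \<omega> * ?d' j \<omega>))"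
    unfolding step_ito_integral_def sum_product unfolding sum_distrib_left ..
  also have "\<dots> = (\<Sum>i<n. \<Sum>j<n'. expectation (\<lambda>\<omega>. indicat_real A \<omega> * (?d i \<omega> * ?d' j \<omega>)))"
    by (rule integral_sum2) (use i in simp)
  also have "\<dots> = (\<Sum>i<n. \<Sum>j<n'. \<integral>x. indicat_real A (snd x) * (?p i x \<bullet> ?p' j x) \<partial>(lborel \<Otimes>\<^sub>M M))"
  proof (intro sum.cong refl)
    fix i j assume "i \<in> {..<n}" "j \<in> {..<n'}"
    then have ij: "i < n" "j < n'" by auto
    show "expectation (\<lambda>\<omega>. indicat_real A \<omega> * (?d i \<omega> * ?d' j \<omega>)) = (\<integral>x. indicat_real A (snd x) * (?p i x \<bullet> ?p' j x) \<partial>(lborel \<Otimes>\<^sub>M M))"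
      unfolding integral_step_term(2)[OF L2_fun_vec_bounded_F[OF D(1)[OF ij(1)]]
          L2_fun_vec_bounded_F[OF D'(1)[OF ij(2)]] sets_F_M[OF A(1)] D(4)[OF ij(1)] D'(4)[OF ij(2)]]
      using D[OF ij(1)] D'[OF ij(2)] A(2,3) by (intro expectation_incr_overlap[OF _ _ _ _ _ _ h]) auto
  qed
  also have "\<dots> = (\<integral>x. (\<Sum>i<n. \<Sum>j<n'. indicat_real A (snd x) * (?p i x \<bullet> ?p' j x)) \<partial>(lborel \<Otimes>\<^sub>M M))"
  proof -
    have "integrable (lborel \<Otimes>\<^sub>M M) (\<lambda>x. indicat_real A (snd x) * (?p i x \<bullet> ?p' j x))" if "i < n" "j < n'" for i j
      by (rule integral_step_term(1)[OF L2_fun_vec_bounded_F[OF D(1)[OF that(1)]]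
          L2_fun_vec_bounded_F[OF D'(1)[OF that(2)]] sets_F_M[OF A(1)] D(4)[OF that(1)] D'(4)[OF that(2)]])
    then show ?thesis
      by (intro integral_sum2[symmetric]) simp
  qed
  also have "\<dots> = (\<integral>x. indicat_real A (snd x) * (step_process n \<tau> \<phi> (fst x) (snd x) \<bullet> step_process n' \<tau>' \<phi>' (fst x) (snd x)) \<partial>(lborel \<Otimes>\<^sub>M M))"
    unfolding step_process_def inner_sum_left unfolding inner_sum_right sum_distrib_left ..
  finally show ?thesis .
qed

end

context brownian_motion
begin

text \<open>The approximation in the definition, as convergence in two \<open>L\<^sup>2\<close> spaces.  Step processes vanish outside
\<open>[a, b]\<close>, so the limit may be taken over the whole time axis.\<close>

lemma has_ito_integral_approx:
  fixes \<psi> :: "real \<Rightarrow> 'w \<Rightarrow> real^'d"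
  assumes ito: "has_ito_integral M B a b \<psi> I" and a: "0 \<le> a"
  obtains n \<tau> \<phi> where "\<And>k. step_integrand M F a b (n k) (\<tau> k) (\<phi> k)"
    and "L2_tendsto (lborel \<Otimes>\<^sub>M M) (\<lambda>k x. step_process (n k) (\<tau> k) (\<phi> k) (fst x) (snd x))
      (\<lambda>x. indicat_real {a..b} (fst x) *\<^sub>R \<psi> (fst x) (snd x))"
    and "L2_tendsto M (\<lambda>k. step_ito_integral B (n k) (\<tau> k) (\<phi> k)) I"
proof -
  let ?Q = "lborel \<Otimes>\<^sub>M M"
  let ?\<psi> = "\<lambda>x. indicat_real {a..b} (fst x) *\<^sub>R \<psi> (fst x) (snd x)"
  note d = ito[unfolded has_ito_integral_def]
  note \<psi> = d[THEN conjunct1] and I = d[THEN conjunct2, THEN conjunct1]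
  from d[THEN conjunct2, THEN conjunct2] obtain n \<tau> \<phi>
    where c: "(\<forall>k. step_integrand M F a b (n k) (\<tau> k) (\<phi> k)) \<and>
      (\<lambda>k. \<integral>\<^sup>+\<omega>. (\<integral>\<^sup>+s\<in>{a..b}.
         ennreal ((norm (\<psi> s \<omega> - step_process (n k) (\<tau> k) (\<phi> k) s \<omega>))\<^sup>2) \<partial>lborel) \<partial>M) \<longlonglongrightarrow> 0 \<and>
      (\<lambda>k. \<integral>\<^sup>+\<omega>. ennreal ((I \<omega> - step_ito_integral B (n k) (\<tau> k) (\<phi> k) \<omega>)\<^sup>2) \<partial>M) \<longlonglongrightarrow> 0"
    by (elim exE) (rule that)
  note step = c[THEN conjunct1, THEN spec] and lim1 = c[THEN conjunct2, THEN conjunct1]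
    and lim2 = c[THEN conjunct2, THEN conjunct2]
  let ?p = "\<lambda>k x. step_process (n k) (\<tau> k) (\<phi> k) (fst x) (snd x)"
  let ?i = "\<lambda>k. step_ito_integral B (n k) (\<tau> k) (\<phi> k)"
  have p: "L2_fun ?Q (?p k)" and i: "L2_fun M (?i k)" for k
    by (rule L2_step_process[OF step a], rule L2_step_ito_integral[OF step a])
  have \<psi>L: "L2_fun ?Q ?\<psi>"
    using sq_on_of_L2_proc[OF \<psi> subalgebra_F] by (simp add: sq_on_def)
  have "L2_tendsto ?Q ?p ?\<psi>"
  proof (rule L2_tendsto_nn_integral[OF p \<psi>L])
    have "(\<integral>\<^sup>+x. ennreal ((norm (?p k x - ?\<psi> x))\<^sup>2) \<partial>?Q) = (\<integral>\<^sup>+\<omega>. (\<integral>\<^sup>+s\<in>{a..b}.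
           ennreal ((norm (\<psi> s \<omega> - step_process (n k) (\<tau> k) (\<phi> k) s \<omega>))\<^sup>2) \<partial>lborel) \<partial>M)" for k
    proof -
      have m: "(\<lambda>x. ennreal ((norm (?p k x - ?\<psi> x))\<^sup>2)) \<in> borel_measurable ?Q"
      proof -
        define D where "D = (\<lambda>x. ?p k x - ?\<psi> x)"
        have [measurable]: "D \<in> borel_measurable ?Q"
          unfolding D_def by (rule L2_fun_measurable[OF L2_fun_diff[OF p \<psi>L]])
        have "(\<lambda>x. ennreal ((norm (D x))\<^sup>2)) \<in> borel_measurable ?Q" by measurable
        then show ?thesis by (simp only: D_def)
      qed
      have z: "step_process (n k) (\<tau> k) (\<phi> k) s \<omega> = 0" if "s \<notin> {a..b}" for s \<omega>
        unfolding step_process_def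
      proof (rule sum.neutral, safe)
        fix j assume "j < n k"
        from step_integrandD[OF step a this] that show "indicat_real {\<tau> k j<..\<tau> k (Suc j)} s *\<^sub>R \<phi> k j \<omega> = 0"
          by (auto simp: indicator_def)
      qed
      have "(\<integral>\<^sup>+x. ennreal ((norm (?p k x - ?\<psi> x))\<^sup>2) \<partial>?Q) = (\<integral>\<^sup>+\<omega>. (\<integral>\<^sup>+s.
           ennreal ((norm (?p k (s, \<omega>) - ?\<psi> (s, \<omega>)))\<^sup>2) \<partial>lborel) \<partial>M)"
        by (rule nn_integral_time_swap[OF m, symmetric])
      also have "\<dots> = (\<integral>\<^sup>+\<omega>. (\<integral>\<^sup>+s\<in>{a..b}.
           ennreal ((norm (\<psi> s \<omega> - step_process (n k) (\<tau> k) (\<phi> k) s \<omega>))\<^sup>2) \<partial>lborel) \<partial>M)"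
        by (intro nn_integral_cong) (auto simp: indicator_def z norm_minus_commute)
      finally show ?thesis .
    qed
    then show "(\<lambda>k. \<integral>\<^sup>+x. ennreal ((norm (?p k x - ?\<psi> x))\<^sup>2) \<partial>?Q) \<longlonglongrightarrow> 0"
      using lim1 by simp
  qed
  moreover have "L2_tendsto M ?i I"
  proof (rule L2_tendsto_nn_integral[OF i])
    have "\<forall>\<^sub>F k in sequentially. (\<integral>\<^sup>+\<omega>. ennreal ((I \<omega> - ?i k \<omega>)\<^sup>2) \<partial>M) < 1"
      using lim2 by (rule order_tendstoD) simp
    then obtain k where k: "(\<integral>\<^sup>+\<omega>. ennreal ((I \<omega> - ?i k \<omega>)\<^sup>2) \<partial>M) < 1"
      by (auto simp: eventually_sequentially)
    have im: "?i k \<in> borel_measurable M" using i[of k] unfolding L2_fun_def by blast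
    have dm: "(\<lambda>\<omega>. I \<omega> - ?i k \<omega>) \<in> borel_measurable M"
      using I im by (rule borel_measurable_diff)
    have "integrable M (\<lambda>\<omega>. (norm (I \<omega> - ?i k \<omega>))\<^sup>2)"
    proof (rule integrableI_bounded)
      show "(\<lambda>\<omega>. (norm (I \<omega> - ?i k \<omega>))\<^sup>2) \<in> borel_measurable M"
        by (rule borel_measurable_power[OF measurable_compose[OF dm borel_measurable_norm]])
      show "(\<integral>\<^sup>+\<omega>. ennreal (norm ((norm (I \<omega> - ?i k \<omega>))\<^sup>2)) \<partial>M) < \<infinity>"
        using k by (simp add: order.strict_trans[OF k])
    qed
    with dm have "L2_fun M (\<lambda>\<omega>. I \<omega> - ?i k \<omega>)" unfolding L2_fun_def by blast
    from L2_fun_add[OF this i[of k]] show "L2_fun M I" by simp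
    have "(\<integral>\<^sup>+\<omega>. ennreal ((norm (?i k \<omega> - I \<omega>))\<^sup>2) \<partial>M) = (\<integral>\<^sup>+\<omega>. ennreal ((I \<omega> - ?i k \<omega>)\<^sup>2) \<partial>M)" for k
      by (simp add: power2_commute)
    then show "(\<lambda>k. \<integral>\<^sup>+\<omega>. ennreal ((norm (?i k \<omega> - I \<omega>))\<^sup>2) \<partial>M) \<longlonglongrightarrow> 0"
      using lim2 by simp
  qed
  ultimately show ?thesis by (rule that[OF step])
qed

lemma L2_fun_ito:
  fixes \<psi> :: "real \<Rightarrow> 'w \<Rightarrow> real^'d"
  assumes "has_ito_integral M B a b \<psi> I" "0 \<le> a"
  shows "L2_fun M I"
  by (rule has_ito_integral_approx[OF assms]) (simp add: L2_tendsto_def)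

lemma expectation_ito:
  fixes \<psi> :: "real \<Rightarrow> 'w \<Rightarrow> real^'d"
  assumes ito: "has_ito_integral M B a b \<psi> I" and a: "0 \<le> a" and g: "L2_F a g"
  shows "expectation (\<lambda>\<omega>. g \<omega> * I \<omega>) = 0"
proof -
  obtain n \<tau> \<phi> where step: "\<And>k. step_integrand M F a b (n k) (\<tau> k) (\<phi> k)"
    and "L2_tendsto (lborel \<Otimes>\<^sub>M M) (\<lambda>k x. step_process (n k) (\<tau> k) (\<phi> k) (fst x) (snd x))
      (\<lambda>x. indicat_real {a..b} (fst x) *\<^sub>R \<psi> (fst x) (snd x))"
    and lim: "L2_tendsto M (\<lambda>k. step_ito_integral B (n k) (\<tau> k) (\<phi> k)) I"
    by (rule has_ito_integral_approx[OF ito a]) (rule that)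
  have g': "L2_fun M g" using g by (simp add: L2_F_def)
  have "(\<lambda>k. expectation (\<lambda>\<omega>. g \<omega> * step_ito_integral B (n k) (\<tau> k) (\<phi> k) \<omega>)) \<longlonglongrightarrow> expectation (\<lambda>\<omega>. g \<omega> * I \<omega>)"
    using tendsto_integral_inner_L2[OF L2_tendsto_const[OF g'] lim] by simp
  then show ?thesis
    by (simp add: expectation_step_ito_integral[OF step a g] LIMSEQ_const_iff)
qed

text \<open>The isometry, polarised to two integrands and localised to an event of the past.\<close>

lemma ito_isometry:
  fixes \<psi> \<psi>' :: "real \<Rightarrow> 'w \<Rightarrow> real^'d"
  assumes ito: "has_ito_integral M B a b \<psi> I" and ito': "has_ito_integral M B a b \<psi>' I'"
    and a: "0 \<le> a" and A: "A \<in> sets (F a)"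
  shows "expectation (\<lambda>\<omega>. indicat_real A \<omega> * (I \<omega> * I' \<omega>)) =
    pint M {a..b} (\<lambda>s \<omega>. indicat_real A \<omega> * (\<psi> s \<omega> \<bullet> \<psi>' s \<omega>))"
proof -
  let ?Q = "lborel \<Otimes>\<^sub>M M"
  let ?\<psi> = "\<lambda>x. indicat_real {a..b} (fst x) *\<^sub>R \<psi> (fst x) (snd x)"
  let ?\<psi>' = "\<lambda>x. indicat_real {a..b} (fst x) *\<^sub>R \<psi>' (fst x) (snd x)"
  obtain n \<tau> \<phi> where step: "\<And>k. step_integrand M F a b (n k) (\<tau> k) (\<phi> k)"
    and l: "L2_tendsto ?Q (\<lambda>k x. step_process (n k) (\<tau> k) (\<phi> k) (fst x) (snd x)) ?\<psi>"
    and lI: "L2_tendsto M (\<lambda>k. step_ito_integral B (n k) (\<tau> k) (\<phi> k)) I"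
    by (rule has_ito_integral_approx[OF ito a]) (rule that)
  obtain n' \<tau>' \<phi>' where step': "\<And>k. step_integrand M F a b (n' k) (\<tau>' k) (\<phi>' k)"
    and l': "L2_tendsto ?Q (\<lambda>k x. step_process (n' k) (\<tau>' k) (\<phi>' k) (fst x) (snd x)) ?\<psi>'"
    and lI': "L2_tendsto M (\<lambda>k. step_ito_integral B (n' k) (\<tau>' k) (\<phi>' k)) I'"
    by (rule has_ito_integral_approx[OF ito' a]) (rule that)
  let ?X = "\<lambda>k. expectation (\<lambda>\<omega>. indicat_real A \<omega> *
    (step_ito_integral B (n k) (\<tau> k) (\<phi> k) \<omega> * step_ito_integral B (n' k) (\<tau>' k) (\<phi>' k) \<omega>))"
  have Am: "indicat_real A \<in> borel_measurable M" and A1: "\<bar>indicat_real A \<omega>\<bar> \<le> 1" for \<omega>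
    using sets_F_M[OF A] by (auto simp: indicator_def)
  have "L2_tendsto M (\<lambda>k \<omega>. indicat_real A \<omega> *\<^sub>R step_ito_integral B (n k) (\<tau> k) (\<phi> k) \<omega>) (\<lambda>\<omega>. indicat_real A \<omega> *\<^sub>R I \<omega>)"
    by (rule L2_tendsto_bounded_scaleR[OF lI Am A1])
  from tendsto_integral_inner_L2[OF this lI']
  have 1: "?X \<longlonglongrightarrow> expectation (\<lambda>\<omega>. indicat_real A \<omega> * (I \<omega> * I' \<omega>))"
    by (simp add: mult.assoc)
  have Am': "(\<lambda>x. indicat_real A (snd x)) \<in> borel_measurable ?Q" using Am by measurable
  have "L2_tendsto ?Q (\<lambda>k x. indicat_real A (snd x) *\<^sub>R step_process (n k) (\<tau> k) (\<phi> k) (fst x) (snd x))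
      (\<lambda>x. indicat_real A (snd x) *\<^sub>R ?\<psi> x)"
    by (rule L2_tendsto_bounded_scaleR[OF l Am' A1])
  from tendsto_integral_inner_L2[OF this l']
  have "(\<lambda>k. \<integral>x. indicat_real A (snd x) * (step_process (n k) (\<tau> k) (\<phi> k) (fst x) (snd x) \<bullet>
      step_process (n' k) (\<tau>' k) (\<phi>' k) (fst x) (snd x)) \<partial>?Q) \<longlonglongrightarrow>
      (\<integral>x. (indicat_real A (snd x) *\<^sub>R ?\<psi> x) \<bullet> ?\<psi>' x \<partial>?Q)"
    by (simp only: inner_scaleR_left)
  then have 2: "?X \<longlonglongrightarrow> (\<integral>x. (indicat_real A (snd x) *\<^sub>R ?\<psi> x) \<bullet> ?\<psi>' x \<partial>?Q)"
    by (simp only: step_ito_isometry[OF step a step' a A order_refl order_refl])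
  have "(\<integral>x. (indicat_real A (snd x) *\<^sub>R ?\<psi> x) \<bullet> ?\<psi>' x \<partial>?Q) =
      pint M {a..b} (\<lambda>s \<omega>. indicat_real A \<omega> * (\<psi> s \<omega> \<bullet> \<psi>' s \<omega>))"
    unfolding pint_def by (intro Bochner_Integration.integral_cong) (auto simp: indicator_def)
  with LIMSEQ_unique[OF 1 2] show ?thesis by simp
qed

text \<open>Steps that begin after \<open>r\<close> are set to zero: they become empty intervals at \<open>r\<close>, and their values need not be
\<open>F\<^sub>r\<close>-measurable.\<close>

lemma step_integrand_truncate:
  assumes step: "step_integrand M F a b n \<tau> \<phi>" and r: "a \<le> r"
  shows "step_integrand M F a r n (\<lambda>i. min (\<tau> i) r) (\<lambda>i \<omega>. if \<tau> i \<le> r then \<phi> i \<omega> else 0)"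
  unfolding step_integrand_def
proof (intro conjI allI impI)
  fix i assume "i \<le> n"
  then show "min (\<tau> i) r \<in> {a..r}" using step r by (auto simp: step_integrand_def)
next
  fix i assume i: "i < n"
  show "min (\<tau> i) r \<le> min (\<tau> (Suc i)) r" using step i by (auto simp: step_integrand_def intro: min.mono)
  show "(\<lambda>\<omega>. if \<tau> i \<le> r then \<phi> i \<omega> else 0) \<in> borel_measurable (F (min (\<tau> i) r))"
    using step i by (cases "\<tau> i \<le> r") (auto simp: step_integrand_def min_def)
  obtain K where "\<forall>\<omega>\<in>space M. norm (\<phi> i \<omega>) \<le> K" using step i by (auto simp: step_integrand_def)
  then show "\<exists>K. \<forall>\<omega>\<in>space M. norm (if \<tau> i \<le> r then \<phi> i \<omega> else 0) \<le> K"
    by (intro exI[of _ "max K 0"]) auto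
qed

lemma step_process_truncate:
  assumes step: "step_integrand M F a b n \<tau> \<phi>" and s: "a \<le> r"
  shows "step_process n (\<lambda>i. min (\<tau> i) r) (\<lambda>i \<omega>. if \<tau> i \<le> r then \<phi> i \<omega> else 0) s \<omega> =
    indicat_real {..r} s *\<^sub>R step_process n \<tau> \<phi> s \<omega>"
  unfolding step_process_def scaleR_sum_right
  by (intro sum.cong refl) (auto simp: indicator_def)

text \<open>The removed increments lie after \<open>r\<close> and are orthogonal to \<open>L\<^sup>2(F\<^sub>r)\<close>.\<close>

lemma expectation_step_ito_truncate:
  assumes step: "step_integrand M F a b n \<tau> \<phi>" and a: "0 \<le> a" and r: "a \<le> r" and g: "L2_F r g"
  shows "expectation (\<lambda>\<omega>. g \<omega> * step_ito_integral B n \<tau> \<phi> \<omega>) =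
    expectation (\<lambda>\<omega>. g \<omega> * step_ito_integral B n (\<lambda>i. min (\<tau> i) r) (\<lambda>i \<omega>. if \<tau> i \<le> r then \<phi> i \<omega> else 0) \<omega>)"
proof -
  let ?\<phi> = "\<lambda>i \<omega>. if \<tau> i \<le> r then \<phi> i \<omega> else 0"
  let ?\<tau> = "\<lambda>i. min (\<tau> i) r"
  note tr = step_integrand_truncate[OF step r]
  have g': "L2_fun M g" using g by (simp add: L2_F_def)
  have i1: "integrable M (\<lambda>\<omega>. g \<omega> * (\<phi> i \<omega> \<bullet> (B (\<tau> (Suc i)) \<omega> - B (\<tau> i) \<omega>)))" if "i < n" for i
    using step_integrandD[OF step a that] by (intro integrable_mult_L2[OF g'] L2_fun_inner_incr) auto
  have i2: "integrable M (\<lambda>\<omega>. g \<omega> * (?\<phi> i \<omega> \<bullet> (B (?\<tau> (Suc i)) \<omega> - B (?\<tau> i) \<omega>)))" if "i < n" for i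
    using step_integrandD[OF tr a that] by (intro integrable_mult_L2[OF g'] L2_fun_inner_incr) auto
  have "expectation (\<lambda>\<omega>. g \<omega> * (\<phi> i \<omega> \<bullet> (B (\<tau> (Suc i)) \<omega> - B (\<tau> i) \<omega>))) =
      expectation (\<lambda>\<omega>. g \<omega> * (?\<phi> i \<omega> \<bullet> (B (?\<tau> (Suc i)) \<omega> - B (?\<tau> i) \<omega>)))" if i: "i < n" for i
  proof -
    note D = step_integrandD[OF step a i]
    consider "\<tau> (Suc i) \<le> r" | "\<tau> i \<le> r" "r < \<tau> (Suc i)" | "r < \<tau> i" by linarith
    then show ?thesis
    proof cases
      case 1
      then show ?thesis using D(4) by (simp add: min_def)
    next
      case 2
      have b: "bounded_F r (\<phi> i)" using D(1) 2(1) by (rule bounded_F_mono)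
      have z: "expectation (\<lambda>\<omega>. g \<omega> * (\<phi> i \<omega> \<bullet> (B (\<tau> (Suc i)) \<omega> - B r \<omega>))) = 0"
        using a r 2 by (intro expectation_inner_incr[OF _ _ b g]) auto
      have "expectation (\<lambda>\<omega>. g \<omega> * (\<phi> i \<omega> \<bullet> (B (\<tau> (Suc i)) \<omega> - B (\<tau> i) \<omega>))) =
          expectation (\<lambda>\<omega>. g \<omega> * (\<phi> i \<omega> \<bullet> (B (\<tau> (Suc i)) \<omega> - B r \<omega>)) + g \<omega> * (\<phi> i \<omega> \<bullet> (B r \<omega> - B (\<tau> i) \<omega>)))"
        by (simp add: inner_diff_right algebra_simps)
      also have "\<dots> = expectation (\<lambda>\<omega>. g \<omega> * (\<phi> i \<omega> \<bullet> (B r \<omega> - B (\<tau> i) \<omega>)))"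
        using a r 2 D by (subst Bochner_Integration.integral_add)
          (auto intro!: integrable_mult_L2[OF g'] L2_fun_inner_incr[OF _ _ b] simp: z)
      finally show ?thesis using 2 by (simp add: min_def)
    next
      case 3
      have "L2_F (\<tau> i) g" using g 3 by (auto intro: L2_F_mono)
      from expectation_inner_incr[OF D(2,4,1) this] show ?thesis using 3 by simp
    qed
  qed
  then show ?thesis
    using i1 i2 by (simp add: step_ito_integral_def sum_distrib_left Bochner_Integration.integral_sum)
qed

lemma step_ito_isometry_diff:
  fixes \<phi> \<phi>' :: "nat \<Rightarrow> 'w \<Rightarrow> real^'d"
  assumes step: "step_integrand M F a b n \<tau> \<phi>" and step': "step_integrand M F a b n' \<tau>' \<phi>'" and a: "0 \<le> a"
  shows "expectation (\<lambda>\<omega>. (norm (step_ito_integral B n \<tau> \<phi> \<omega> - step_ito_integral B n' \<tau>' \<phi>' \<omega>))\<^sup>2) =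
    (\<integral>x. (norm (step_process n \<tau> \<phi> (fst x) (snd x) - step_process n' \<tau>' \<phi>' (fst x) (snd x)))\<^sup>2 \<partial>(lborel \<Otimes>\<^sub>M M))"
proof -
  let ?Q = "lborel \<Otimes>\<^sub>M M"
  let ?i = "step_ito_integral B n \<tau> \<phi>" and ?i' = "step_ito_integral B n' \<tau>' \<phi>'"
  let ?p = "\<lambda>x. step_process n \<tau> \<phi> (fst x) (snd x)" and ?p' = "\<lambda>x. step_process n' \<tau>' \<phi>' (fst x) (snd x)"
  have top: "space M \<in> sets (F a)" using sets.top[of "F a"] by simp
  have iso: "expectation (\<lambda>\<omega>. step_ito_integral B m \<rho> \<theta> \<omega> * step_ito_integral B m' \<rho>' \<theta>' \<omega>) =
      (\<integral>x. step_process m \<rho> \<theta> (fst x) (snd x) \<bullet> step_process m' \<rho>' \<theta>' (fst x) (snd x) \<partial>?Q)"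
    if "step_integrand M F a b m \<rho> \<theta>" "step_integrand M F a b m' \<rho>' \<theta>'" for m m' \<rho> \<rho>' and \<theta> \<theta>' :: "nat \<Rightarrow> 'w \<Rightarrow> real^'d"
  proof -
    have "(\<integral>x. indicat_real (space M) (snd x) * (step_process m \<rho> \<theta> (fst x) (snd x) \<bullet> step_process m' \<rho>' \<theta>' (fst x) (snd x)) \<partial>?Q)
      = (\<integral>x. step_process m \<rho> \<theta> (fst x) (snd x) \<bullet> step_process m' \<rho>' \<theta>' (fst x) (snd x) \<partial>?Q)"
      by (intro Bochner_Integration.integral_cong) (auto simp: space_pair_measure)
    moreover have "expectation (\<lambda>\<omega>. indicat_real (space M) \<omega> * (step_ito_integral B m \<rho> \<theta> \<omega> * step_ito_integral B m' \<rho>' \<theta>' \<omega>))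
      = expectation (\<lambda>\<omega>. step_ito_integral B m \<rho> \<theta> \<omega> * step_ito_integral B m' \<rho>' \<theta>' \<omega>)"
      by (intro Bochner_Integration.integral_cong) auto
    ultimately show ?thesis
      using step_ito_isometry[OF that(1) a that(2) a top order_refl order_refl] by simp
  qed
  have i: "L2_fun M ?i" "L2_fun M ?i'" and p: "L2_fun ?Q ?p" "L2_fun ?Q ?p'"
    by (rule L2_step_ito_integral[OF step a], rule L2_step_ito_integral[OF step' a],
        rule L2_step_process[OF step a], rule L2_step_process[OF step' a])
  have "expectation (\<lambda>\<omega>. (norm (?i \<omega> - ?i' \<omega>))\<^sup>2) = expectation (\<lambda>\<omega>. ?i \<omega> * ?i \<omega> - 2 * (?i \<omega> * ?i' \<omega>) + ?i' \<omega> * ?i' \<omega>)"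
    by (simp add: power2_eq_square algebra_simps)
  also have "\<dots> = expectation (\<lambda>\<omega>. ?i \<omega> * ?i \<omega>) - 2 * expectation (\<lambda>\<omega>. ?i \<omega> * ?i' \<omega>) + expectation (\<lambda>\<omega>. ?i' \<omega> * ?i' \<omega>)"
    using integrable_mult_L2[OF i(1) i(1)] integrable_mult_L2[OF i(1) i(2)] integrable_mult_L2[OF i(2) i(2)]
    by simp
  also have "\<dots> = (\<integral>x. ?p x \<bullet> ?p x \<partial>?Q) - 2 * (\<integral>x. ?p x \<bullet> ?p' x \<partial>?Q) + (\<integral>x. ?p' x \<bullet> ?p' x \<partial>?Q)"
    unfolding iso[OF step step] iso[OF step step'] iso[OF step' step'] ..
  also have "\<dots> = (\<integral>x. ?p x \<bullet> ?p x - 2 * (?p x \<bullet> ?p' x) + ?p' x \<bullet> ?p' x \<partial>?Q)"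
    using integrable_inner_L2[OF p(1) p(1)] integrable_inner_L2[OF p(1) p(2)] integrable_inner_L2[OF p(2) p(2)]
    by (simp del: dot_square_norm)
  also have "\<dots> = (\<integral>x. (norm (?p x - ?p' x))\<^sup>2 \<partial>?Q)"
    unfolding power2_norm_eq_inner
    by (intro Bochner_Integration.integral_cong refl)
       (simp add: inner_diff_left inner_diff_right inner_commute del: dot_square_norm)
  finally show ?thesis .
qed

lemma tendsto_integral_diff_L2:
  fixes f g :: "nat \<Rightarrow> 'c \<Rightarrow> 'b::euclidean_space"
  assumes f: "L2_tendsto N f h" and g: "L2_tendsto N g h"
  shows "(\<lambda>k. \<integral>x. (norm (f k x - g k x))\<^sup>2 \<partial>N) \<longlonglongrightarrow> 0"
proof -
  have L: "L2_fun N (f k)" "L2_fun N (g k)" for k using f g by (auto simp: L2_tendsto_def)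
  have "(\<integral>x. (norm (f k x - g k x))\<^sup>2 \<partial>N) =
      (\<integral>x. f k x \<bullet> f k x \<partial>N) - 2 * (\<integral>x. f k x \<bullet> g k x \<partial>N) + (\<integral>x. g k x \<bullet> g k x \<partial>N)" for k
  proof -
    have "(\<integral>x. (norm (f k x - g k x))\<^sup>2 \<partial>N) = (\<integral>x. f k x \<bullet> f k x - 2 * (f k x \<bullet> g k x) + g k x \<bullet> g k x \<partial>N)"
      unfolding power2_norm_eq_inner
      by (intro Bochner_Integration.integral_cong refl)
         (simp add: inner_diff_left inner_diff_right inner_commute del: dot_square_norm)
    then show ?thesis
      using integrable_inner_L2[OF L(1)[of k] L(1)[of k]] integrable_inner_L2[OF L(1)[of k] L(2)[of k]]
        integrable_inner_L2[OF L(2)[of k] L(2)[of k]]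
      by (simp del: dot_square_norm)
  qed
  moreover have "(\<lambda>k. (\<integral>x. f k x \<bullet> f k x \<partial>N) - 2 * (\<integral>x. f k x \<bullet> g k x \<partial>N) + (\<integral>x. g k x \<bullet> g k x \<partial>N))
      \<longlonglongrightarrow> (\<integral>x. h x \<bullet> h x \<partial>N) - 2 * (\<integral>x. h x \<bullet> h x \<partial>N) + (\<integral>x. h x \<bullet> h x \<partial>N)"
    by (intro tendsto_intros tendsto_integral_inner_L2 f g)
  ultimately show ?thesis by simp
qed

text \<open>The martingale property.  The two integrals come as limits of unrelated sequences of step integrals.
Truncation at \<open>r\<close> turns the first sequence into one on \<open>[a, r]\<close>; its integrands have the same limit there as
those of the second sequence, so by the isometry its integrals converge to \<open>J\<close>.\<close>

lemma expectation_ito_restrict: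
  fixes \<psi> :: "real \<Rightarrow> 'w \<Rightarrow> real^'d"
  assumes ito: "has_ito_integral M B a b \<psi> I" and ito': "has_ito_integral M B a r \<psi> J"
    and a: "0 \<le> a" and r: "a \<le> r" "r \<le> b" and g: "L2_F r g"
  shows "expectation (\<lambda>\<omega>. g \<omega> * I \<omega>) = expectation (\<lambda>\<omega>. g \<omega> * J \<omega>)"
proof -
  let ?Q = "lborel \<Otimes>\<^sub>M M"
  obtain n \<tau> \<phi> where step: "\<And>k. step_integrand M F a b (n k) (\<tau> k) (\<phi> k)"
    and l: "L2_tendsto ?Q (\<lambda>k x. step_process (n k) (\<tau> k) (\<phi> k) (fst x) (snd x))
      (\<lambda>x. indicat_real {a..b} (fst x) *\<^sub>R \<psi> (fst x) (snd x))"
    and lI: "L2_tendsto M (\<lambda>k. step_ito_integral B (n k) (\<tau> k) (\<phi> k)) I"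
    by (rule has_ito_integral_approx[OF ito a]) (rule that)
  obtain n' \<tau>' \<phi>' where step': "\<And>k. step_integrand M F a r (n' k) (\<tau>' k) (\<phi>' k)"
    and l': "L2_tendsto ?Q (\<lambda>k x. step_process (n' k) (\<tau>' k) (\<phi>' k) (fst x) (snd x))
      (\<lambda>x. indicat_real {a..r} (fst x) *\<^sub>R \<psi> (fst x) (snd x))"
    and lJ: "L2_tendsto M (\<lambda>k. step_ito_integral B (n' k) (\<tau>' k) (\<phi>' k)) J"
    by (rule has_ito_integral_approx[OF ito' a]) (rule that)
  define \<rho> where "\<rho> k = (\<lambda>i. min (\<tau> k i) r)" for k
  define \<theta> where "\<theta> k = (\<lambda>i \<omega>. if \<tau> k i \<le> r then \<phi> k i \<omega> else 0)" for k
  have tr: "step_integrand M F a r (n k) (\<rho> k) (\<theta> k)" for k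
    unfolding \<rho>_def \<theta>_def by (rule step_integrand_truncate[OF step r(1)])
  have trp: "step_process (n k) (\<rho> k) (\<theta> k) s \<omega> = indicat_real {..r} s *\<^sub>R step_process (n k) (\<tau> k) (\<phi> k) s \<omega>" for k s \<omega>
    unfolding \<rho>_def \<theta>_def by (rule step_process_truncate[OF step r(1)])
  have "L2_tendsto ?Q (\<lambda>k x. indicat_real {..r} (fst x) *\<^sub>R step_process (n k) (\<tau> k) (\<phi> k) (fst x) (snd x))
      (\<lambda>x. indicat_real {..r} (fst x) *\<^sub>R (indicat_real {a..b} (fst x) *\<^sub>R \<psi> (fst x) (snd x)))"
    by (rule L2_tendsto_bounded_scaleR[OF l, where K = 1]) (auto simp: indicator_def)
  moreover have "(\<lambda>x. indicat_real {..r} (fst x) *\<^sub>R (indicat_real {a..b} (fst x) *\<^sub>R \<psi> (fst x) (snd x))) =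
      (\<lambda>x. indicat_real {a..r} (fst x) *\<^sub>R \<psi> (fst x) (snd x))"
    using r(2) by (auto simp: fun_eq_iff indicator_def)
  ultimately have lt: "L2_tendsto ?Q (\<lambda>k x. step_process (n k) (\<rho> k) (\<theta> k) (fst x) (snd x))
      (\<lambda>x. indicat_real {a..r} (fst x) *\<^sub>R \<psi> (fst x) (snd x))"
    by (simp only: trp)
  have "L2_tendsto M (\<lambda>k. step_ito_integral B (n k) (\<rho> k) (\<theta> k)) J"
  proof (rule L2_tendsto_triangle[OF lJ])
    show "L2_fun M (step_ito_integral B (n k) (\<rho> k) (\<theta> k))" for k
      by (rule L2_step_ito_integral[OF tr a])
    show "(\<lambda>k. expectation (\<lambda>\<omega>. (norm (step_ito_integral B (n k) (\<rho> k) (\<theta> k) \<omega> -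
        step_ito_integral B (n' k) (\<tau>' k) (\<phi>' k) \<omega>))\<^sup>2)) \<longlonglongrightarrow> 0"
      unfolding step_ito_isometry_diff[OF tr step' a] by (rule tendsto_integral_diff_L2[OF lt l'])
  qed
  note lt' = this
  have g': "L2_fun M g" using g by (simp add: L2_F_def)
  have 1: "(\<lambda>k. expectation (\<lambda>\<omega>. g \<omega> * step_ito_integral B (n k) (\<rho> k) (\<theta> k) \<omega>)) \<longlonglongrightarrow> expectation (\<lambda>\<omega>. g \<omega> * J \<omega>)"
    using tendsto_integral_inner_L2[OF L2_tendsto_const[OF g'] lt'] by simp
  have 2: "(\<lambda>k. expectation (\<lambda>\<omega>. g \<omega> * step_ito_integral B (n k) (\<tau> k) (\<phi> k) \<omega>)) \<longlonglongrightarrow> expectation (\<lambda>\<omega>. g \<omega> * I \<omega>)"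
    using tendsto_integral_inner_L2[OF L2_tendsto_const[OF g'] lI] by simp
  have "expectation (\<lambda>\<omega>. g \<omega> * step_ito_integral B (n k) (\<tau> k) (\<phi> k) \<omega>) =
      expectation (\<lambda>\<omega>. g \<omega> * step_ito_integral B (n k) (\<rho> k) (\<theta> k) \<omega>)" for k
    unfolding \<rho>_def \<theta>_def by (rule expectation_step_ito_truncate[OF step a r(1) g])
  with 2 have "(\<lambda>k. expectation (\<lambda>\<omega>. g \<omega> * step_ito_integral B (n k) (\<rho> k) (\<theta> k) \<omega>)) \<longlonglongrightarrow> expectation (\<lambda>\<omega>. g \<omega> * I \<omega>)"
    by simp
  from LIMSEQ_unique[OF this 1] show ?thesis .
qed

end

section \<open>The product rule in expectation\<close>

context brownian_motion
begin

lemma sq_on_one: "sq_on M {a..b} (\<lambda>s \<omega>. 1::real)"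
  by (rule sq_on_const) (simp add: L2_fun_def)

lemma int_on_of_sq_on:
  fixes a :: "real \<Rightarrow> 'w \<Rightarrow> real"
  assumes "sq_on M {t..T} a"
  shows "int_on M {t..T} a"
  using int_on_mult[OF assms sq_on_one] by simp

lemma L2_fun_LINT:
  fixes a :: "real \<Rightarrow> 'w \<Rightarrow> real"
  assumes a: "sq_on M {t..T} a"
  shows "L2_fun M (\<lambda>\<omega>. LINT s:{t..T}|lborel. a s \<omega>)"
proof (rule L2_fun_bound[OF L2_fun_LINT_abs[OF a]])
  note i = int_on_of_sq_on[OF a]
  show "(\<lambda>\<omega>. LINT s:{t..T}|lborel. a s \<omega>) \<in> borel_measurable M"
    using integrable_LINT_int_on[OF i] by (rule borel_measurable_integrable)
  show "AE \<omega> in M. norm (LINT s:{t..T}|lborel. a s \<omega>) \<le> 1 * norm (LINT s:{t..T}|lborel. \<bar>a s \<omega>\<bar>)"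
    using AE_set_integrable_int_on[OF i]
  proof eventually_elim
    case (elim \<omega>)
    from set_integral_norm_bound[OF elim] show ?case by simp
  qed
qed

text \<open>\<open>X\<close> is the integral of \<open>a\<close> plus a martingale.  The martingale property is stated as orthogonality to
\<open>L\<^sup>2(F\<^sub>s)\<close> of its increment over \<open>[s, T]\<close>; in this form it involves neither the martingale as a process
nor conditional expectations, and forward and backward equations have it alike.\<close>

definition has_drift :: "real \<Rightarrow> real \<Rightarrow> (real \<Rightarrow> 'w \<Rightarrow> real) \<Rightarrow> (real \<Rightarrow> 'w \<Rightarrow> real) \<Rightarrow> bool" where
  "has_drift t T X a \<longleftrightarrow> sq_on M {t..T} X \<and> sq_on M {t..T} a \<and>
     (\<forall>s\<in>{t..T}. L2_F s (X s) \<and> a s \<in> borel_measurable (F s) \<and>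
       (\<forall>g. L2_F s g \<longrightarrow> expectation (\<lambda>\<omega>. g \<omega> * (X T \<omega> - X s \<omega> - (LINT r:{s..T}|lborel. a r \<omega>))) = 0))"

lemma bdd_on_indicator: "A \<in> sets (F t) \<Longrightarrow> S \<in> sets borel \<Longrightarrow> bdd_on M S (\<lambda>s. indicat_real A)"
  by (rule bdd_on_const[where K = 1]) (auto dest: sets_F_M simp: indicator_def)

text \<open>Against an adapted process \<open>f\<close>, the value \<open>X\<^sub>s\<close> may be replaced by \<open>X\<^sub>T - \<integral>\<^sub>s\<^sup>T a\<^sub>r dr\<close>, as the
difference is orthogonal to \<open>L\<^sup>2(F\<^sub>s)\<close>.\<close>

lemma pint_mult_drift:
  assumes X: "has_drift t T X a" and f: "sq_on M {t..T} f" "\<And>s. s \<in> {t..T} \<Longrightarrow> f s \<in> borel_measurable (F s)"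
    and A: "A \<in> sets (F t)" and tT: "t \<le> T"
  shows "pint M {t..T} (\<lambda>s \<omega>. indicat_real A \<omega> * f s \<omega> * X s \<omega>) =
    expectation (\<lambda>\<omega>. indicat_real A \<omega> * (X T \<omega> * (LINT s:{t..T}|lborel. f s \<omega>))) -
    pint M {t..T} (\<lambda>s \<omega>. indicat_real A \<omega> * f s \<omega> * (LINT r:{s..T}|lborel. a r \<omega>))"
proof -
  let ?tail = "\<lambda>s \<omega>. LINT r:{s..T}|lborel. a r \<omega>"
  have sX: "sq_on M {t..T} X" and sa: "sq_on M {t..T} a" using X by (auto simp: has_drift_def)
  have XT: "L2_fun M (X T)" using X tT by (auto simp: has_drift_def L2_F_def)
  have sXT: "sq_on M {t..T} (\<lambda>s. X T)" by (rule sq_on_const[OF XT])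
  have sf: "sq_on M {t..T} (\<lambda>s \<omega>. indicat_real A \<omega> * f s \<omega>)"
    by (rule sq_on_mult_bdd[OF bdd_on_indicator[OF A] f(1)]) simp
  note st = sq_on_LINT_tail[OF sa]
  have "pint M {t..T} (\<lambda>s \<omega>. indicat_real A \<omega> * f s \<omega> * X s \<omega>) =
      pint M {t..T} (\<lambda>s \<omega>. indicat_real A \<omega> * f s \<omega> * X T \<omega> - indicat_real A \<omega> * f s \<omega> * ?tail s \<omega>)"
  proof (rule pint_cong_expectation)
    show "int_on M {t..T} (\<lambda>s \<omega>. indicat_real A \<omega> * f s \<omega> * X s \<omega>)" by (rule int_on_mult[OF sf sX])
    show "int_on M {t..T} (\<lambda>s \<omega>. indicat_real A \<omega> * f s \<omega> * X T \<omega> - indicat_real A \<omega> * f s \<omega> * ?tail s \<omega>)"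
      by (rule int_on_diff[OF int_on_mult[OF sf sXT] int_on_mult[OF sf st]])
    show "AE s in lborel. s \<in> {t..T} \<longrightarrow> expectation (\<lambda>\<omega>. indicat_real A \<omega> * f s \<omega> * X s \<omega>) =
        expectation (\<lambda>\<omega>. indicat_real A \<omega> * f s \<omega> * X T \<omega> - indicat_real A \<omega> * f s \<omega> * ?tail s \<omega>)"
      using sq_on_AE_L2[OF f(1)]
    proof eventually_elim
      case (elim s)
      show ?case
      proof
        assume s: "s \<in> {t..T}"
        have fs: "L2_F s (f s)" using elim s f(2)[OF s] by (simp add: L2_F_def)
        have g: "L2_F s (\<lambda>\<omega>. indicat_real A \<omega> * f s \<omega>)"
          using s by (intro L2_F_bounded_mult[OF bounded_F_indicator fs] sets_F_mono[OF A]) auto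
        have gL: "L2_fun M (\<lambda>\<omega>. indicat_real A \<omega> * f s \<omega>)" using g by (simp add: L2_F_def)
        have Xs: "L2_fun M (X s)" using X s by (auto simp: has_drift_def L2_F_def)
        have tl: "L2_fun M (?tail s)"
          using s by (intro L2_fun_LINT sq_on_subset[OF sa]) auto
        have "expectation (\<lambda>\<omega>. indicat_real A \<omega> * f s \<omega> * (X T \<omega> - X s \<omega> - ?tail s \<omega>)) = 0"
          using X s g unfolding has_drift_def by blast
        moreover have "expectation (\<lambda>\<omega>. indicat_real A \<omega> * f s \<omega> * (X T \<omega> - X s \<omega> - ?tail s \<omega>)) =
            expectation (\<lambda>\<omega>. (indicat_real A \<omega> * f s \<omega> * X T \<omega> - indicat_real A \<omega> * f s \<omega> * ?tail s \<omega>) - indicat_real A \<omega> * f s \<omega> * X s \<omega>)"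
          by (intro Bochner_Integration.integral_cong refl) (simp add: right_diff_distrib)
        moreover have "\<dots> = expectation (\<lambda>\<omega>. indicat_real A \<omega> * f s \<omega> * X T \<omega> - indicat_real A \<omega> * f s \<omega> * ?tail s \<omega>)
            - expectation (\<lambda>\<omega>. indicat_real A \<omega> * f s \<omega> * X s \<omega>)"
          by (intro Bochner_Integration.integral_diff Bochner_Integration.integrable_diff integrable_mult_L2[OF gL] XT tl Xs)
        ultimately show "expectation (\<lambda>\<omega>. indicat_real A \<omega> * f s \<omega> * X s \<omega>) =
          expectation (\<lambda>\<omega>. indicat_real A \<omega> * f s \<omega> * X T \<omega> - indicat_real A \<omega> * f s \<omega> * ?tail s \<omega>)"
          by linarith
      qed
    qed
  qed
  also have "\<dots> = pint M {t..T} (\<lambda>s \<omega>. indicat_real A \<omega> * f s \<omega> * X T \<omega>)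
      - pint M {t..T} (\<lambda>s \<omega>. indicat_real A \<omega> * f s \<omega> * ?tail s \<omega>)"
    by (rule pint_diff[OF int_on_mult[OF sf sXT] int_on_mult[OF sf st]])
  also have "pint M {t..T} (\<lambda>s \<omega>. indicat_real A \<omega> * f s \<omega> * X T \<omega>) =
      expectation (\<lambda>\<omega>. indicat_real A \<omega> * (X T \<omega> * (LINT s:{t..T}|lborel. f s \<omega>)))"
    unfolding pint_eq_LINT[OF int_on_mult[OF sf sXT]]
    by (intro Bochner_Integration.integral_cong refl)
       (simp add: set_integral_mult_left set_integral_mult_right mult_ac)
  finally show ?thesis .
qed

text \<open>Both drift integrals are rewritten with the terminal values, their tails are added with lemma \<open>LINT_triangle\<close>,
and the product \<open>m n\<close> of the martingale increments is expanded.  The mixed terms \<open>Y\<^sub>t m\<close> and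
\<open>X\<^sub>t n\<close> have expectation zero.\<close>

lemma product_rule:
  assumes X: "has_drift t T X a" and Y: "has_drift t T Y f" and A: "A \<in> sets (F t)" and tT: "t \<le> T"
  defines "m \<equiv> \<lambda>\<omega>. X T \<omega> - X t \<omega> - (LINT s:{t..T}|lborel. a s \<omega>)"
    and "n \<equiv> \<lambda>\<omega>. Y T \<omega> - Y t \<omega> - (LINT s:{t..T}|lborel. f s \<omega>)"
  shows "expectation (\<lambda>\<omega>. indicat_real A \<omega> * (X T \<omega> * Y T \<omega>)) - expectation (\<lambda>\<omega>. indicat_real A \<omega> * (X t \<omega> * Y t \<omega>)) =
    pint M {t..T} (\<lambda>s \<omega>. indicat_real A \<omega> * (a s \<omega> * Y s \<omega>)) +
    pint M {t..T} (\<lambda>s \<omega>. indicat_real A \<omega> * (f s \<omega> * X s \<omega>)) +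
    expectation (\<lambda>\<omega>. indicat_real A \<omega> * (m \<omega> * n \<omega>))"
proof -
  have sX: "sq_on M {t..T} X" "sq_on M {t..T} a" and sY: "sq_on M {t..T} Y" "sq_on M {t..T} f"
    using X Y by (auto simp: has_drift_def)
  have am: "a s \<in> borel_measurable (F s)" and fm: "f s \<in> borel_measurable (F s)" if "s \<in> {t..T}" for s
    using X Y that unfolding has_drift_def by blast+
  have XF: "L2_F s (X s)" and YF: "L2_F s (Y s)" if "s \<in> {t..T}" for s
    using X Y that unfolding has_drift_def by blast+
  let ?A = "\<lambda>\<omega>. LINT s:{t..T}|lborel. a s \<omega>" and ?F = "\<lambda>\<omega>. LINT s:{t..T}|lborel. f s \<omega>"
  let ?ta = "\<lambda>s \<omega>. LINT r:{s..T}|lborel. a r \<omega>" and ?tf = "\<lambda>s \<omega>. LINT r:{s..T}|lborel. f r \<omega>"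
  have L: "L2_fun M (X T)" "L2_fun M (X t)" "L2_fun M (Y T)" "L2_fun M (Y t)" "L2_fun M ?A" "L2_fun M ?F"
    using XF[of T] XF[of t] YF[of T] YF[of t] tT L2_fun_LINT[OF sX(2)] L2_fun_LINT[OF sY(2)]
    by (simp_all add: L2_F_def)
  have Lm: "L2_fun M m" and Ln: "L2_fun M n"
    unfolding m_def n_def by (intro L2_fun_diff L)+
  define E where "E h = expectation (\<lambda>\<omega>. indicat_real A \<omega> * h \<omega>)" for h
  have iA: "integrable M (\<lambda>\<omega>. indicat_real A \<omega> * (f \<omega> * g \<omega>))" if "L2_fun M f" "L2_fun M g" for f g
    using integrable_mult_L2[OF L2_fun_bounded_mult[OF bounded_F_indicator[OF A] that(1)] that(2)]
    by (simp add: mult.assoc)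
  have tails: "pint M {t..T} (\<lambda>s \<omega>. indicat_real A \<omega> * f s \<omega> * ?ta s \<omega>) + pint M {t..T} (\<lambda>s \<omega>. indicat_real A \<omega> * a s \<omega> * ?tf s \<omega>)
      = E (\<lambda>\<omega>. ?A \<omega> * ?F \<omega>)"
  proof -
    have s1: "sq_on M {t..T} (\<lambda>s \<omega>. indicat_real A \<omega> * f s \<omega>)" "sq_on M {t..T} (\<lambda>s \<omega>. indicat_real A \<omega> * a s \<omega>)"
      by (rule sq_on_mult_bdd[OF bdd_on_indicator[OF A] sY(2)], simp, rule sq_on_mult_bdd[OF bdd_on_indicator[OF A] sX(2)], simp)
    note i1 = int_on_mult[OF s1(1) sq_on_LINT_tail[OF sX(2)]] and i2 = int_on_mult[OF s1(2) sq_on_LINT_tail[OF sY(2)]]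
    have "pint M {t..T} (\<lambda>s \<omega>. indicat_real A \<omega> * f s \<omega> * ?ta s \<omega>) + pint M {t..T} (\<lambda>s \<omega>. indicat_real A \<omega> * a s \<omega> * ?tf s \<omega>)
      = expectation (\<lambda>\<omega>. (LINT s:{t..T}|lborel. indicat_real A \<omega> * f s \<omega> * ?ta s \<omega>) + (LINT s:{t..T}|lborel. indicat_real A \<omega> * a s \<omega> * ?tf s \<omega>))"
      unfolding pint_eq_LINT[OF i1] pint_eq_LINT[OF i2]
      by (rule Bochner_Integration.integral_add[symmetric, OF integrable_LINT_int_on[OF i1] integrable_LINT_int_on[OF i2]])
    also have "\<dots> = E (\<lambda>\<omega>. ?A \<omega> * ?F \<omega>)"
      unfolding E_def
    proof (rule integral_cong_AE)
      show "(\<lambda>\<omega>. (LINT s:{t..T}|lborel. indicat_real A \<omega> * f s \<omega> * ?ta s \<omega>) + (LINT s:{t..T}|lborel. indicat_real A \<omega> * a s \<omega> * ?tf s \<omega>)) \<in> borel_measurable M"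
        using integrable_LINT_int_on[OF i1] integrable_LINT_int_on[OF i2]
        by (intro borel_measurable_add borel_measurable_integrable)
      show "(\<lambda>\<omega>. indicat_real A \<omega> * (?A \<omega> * ?F \<omega>)) \<in> borel_measurable M"
        using iA[OF L(5,6)] by (rule borel_measurable_integrable)
      show "AE \<omega> in M. (LINT s:{t..T}|lborel. indicat_real A \<omega> * f s \<omega> * ?ta s \<omega>) + (LINT s:{t..T}|lborel. indicat_real A \<omega> * a s \<omega> * ?tf s \<omega>)
          = indicat_real A \<omega> * (?A \<omega> * ?F \<omega>)"
        using AE_set_integrable_int_on[OF int_on_of_sq_on[OF sX(2)]] AE_set_integrable_int_on[OF int_on_of_sq_on[OF sY(2)]]
      proof eventually_elim
        case (elim \<omega>)
        have "(LINT s:{t..T}|lborel. indicat_real A \<omega> * f s \<omega> * ?ta s \<omega>) = indicat_real A \<omega> * (LINT s:{t..T}|lborel. f s \<omega> * ?ta s \<omega>)"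
          "(LINT s:{t..T}|lborel. indicat_real A \<omega> * a s \<omega> * ?tf s \<omega>) = indicat_real A \<omega> * (LINT s:{t..T}|lborel. a s \<omega> * ?tf s \<omega>)"
          by (simp_all add: mult.assoc)
        then show ?case
          using LINT_triangle[OF elim] by (simp only: distrib_left[symmetric])
      qed
    qed
    finally show ?thesis .
  qed
  have p1: "pint M {t..T} (\<lambda>s \<omega>. indicat_real A \<omega> * (f s \<omega> * X s \<omega>)) =
      E (\<lambda>\<omega>. X T \<omega> * ?F \<omega>) - pint M {t..T} (\<lambda>s \<omega>. indicat_real A \<omega> * f s \<omega> * ?ta s \<omega>)"
    using pint_mult_drift[OF X sY(2) fm A tT] by (simp add: E_def mult.assoc)
  have p2: "pint M {t..T} (\<lambda>s \<omega>. indicat_real A \<omega> * (a s \<omega> * Y s \<omega>)) =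
      E (\<lambda>\<omega>. Y T \<omega> * ?A \<omega>) - pint M {t..T} (\<lambda>s \<omega>. indicat_real A \<omega> * a s \<omega> * ?tf s \<omega>)"
    using pint_mult_drift[OF Y sX(2) am A tT] by (simp add: E_def mult.assoc)
  have t: "t \<in> {t..T}" using tT by simp
  have z1: "E (\<lambda>\<omega>. Y t \<omega> * m \<omega>) = 0"
  proof -
    have "L2_F t (\<lambda>\<omega>. indicat_real A \<omega> * Y t \<omega>)"
      by (rule L2_F_bounded_mult[OF bounded_F_indicator[OF A] YF[OF t]])
    then have "expectation (\<lambda>\<omega>. indicat_real A \<omega> * Y t \<omega> * (X T \<omega> - X t \<omega> - ?A \<omega>)) = 0"
      using X t unfolding has_drift_def by blast
    then show ?thesis unfolding E_def m_def by (simp only: mult.assoc)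
  qed
  have z2: "E (\<lambda>\<omega>. X t \<omega> * n \<omega>) = 0"
  proof -
    have "L2_F t (\<lambda>\<omega>. indicat_real A \<omega> * X t \<omega>)"
      by (rule L2_F_bounded_mult[OF bounded_F_indicator[OF A] XF[OF t]])
    then have "expectation (\<lambda>\<omega>. indicat_real A \<omega> * X t \<omega> * (Y T \<omega> - Y t \<omega> - ?F \<omega>)) = 0"
      using Y t unfolding has_drift_def by blast
    then show ?thesis unfolding E_def n_def by (simp only: mult.assoc)
  qed
  have "E (\<lambda>\<omega>. X T \<omega> * Y T \<omega>) = expectation (\<lambda>\<omega>. indicat_real A \<omega> * (X t \<omega> * Y t \<omega>) +
      indicat_real A \<omega> * (X T \<omega> * ?F \<omega>) + indicat_real A \<omega> * (Y T \<omega> * ?A \<omega>) - indicat_real A \<omega> * (?A \<omega> * ?F \<omega>) +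
      indicat_real A \<omega> * (m \<omega> * n \<omega>) + indicat_real A \<omega> * (Y t \<omega> * m \<omega>) + indicat_real A \<omega> * (X t \<omega> * n \<omega>))"
    unfolding E_def by (intro Bochner_Integration.integral_cong refl) (simp add: m_def n_def algebra_simps)
  also have "\<dots> = E (\<lambda>\<omega>. X t \<omega> * Y t \<omega>) + E (\<lambda>\<omega>. X T \<omega> * ?F \<omega>) + E (\<lambda>\<omega>. Y T \<omega> * ?A \<omega>) - E (\<lambda>\<omega>. ?A \<omega> * ?F \<omega>) +
      E (\<lambda>\<omega>. m \<omega> * n \<omega>) + E (\<lambda>\<omega>. Y t \<omega> * m \<omega>) + E (\<lambda>\<omega>. X t \<omega> * n \<omega>)"
    unfolding E_def
    using iA[OF L(2,4)] iA[OF L(1,6)] iA[OF L(3,5)] iA[OF L(5,6)] iA[OF Lm Ln] iA[OF L(4) Lm] iA[OF L(2) Ln]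
    by (simp only: Bochner_Integration.integral_add Bochner_Integration.integral_diff
        Bochner_Integration.integrable_add Bochner_Integration.integrable_diff)
  finally show ?thesis
    using z1 z2 tails p1 p2 unfolding E_def by linarith
qed

end

section \<open>Conditional expectation processes\<close>

context brownian_motion
begin

lemma cond_exp_subalgebra: "sigma_finite_subalgebra M (F s)"
  by (rule finite_measure_subalgebra_is_sigma_finite)
     (simp add: finite_measure_subalgebra_def finite_measure_subalgebra_axioms_def subalgebra_F finite_measure_axioms)

text \<open>Jensen's inequality for the square.\<close>

lemma expectation_real_cond_exp_square_le:
  assumes G: "L2_fun M G"
  shows "L2_fun M (real_cond_exp M (F s) G)"
    "expectation (\<lambda>\<omega>. (real_cond_exp M (F s) G \<omega>)\<^sup>2) \<le> expectation (\<lambda>\<omega>. (G \<omega>)\<^sup>2)"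
proof -
  interpret S: sigma_finite_subalgebra M "F s" by (rule cond_exp_subalgebra)
  have 1: "L2_fun M (\<lambda>\<omega>. 1::real)" by (simp add: L2_fun_def)
  have Gi: "integrable M G" using integrable_mult_L2[OF G 1] by simp
  have G2: "integrable M (\<lambda>\<omega>. (G \<omega>)\<^sup>2)" using G by (simp add: L2_fun_def)
  have cv: "convex_on UNIV (\<lambda>x::real. x\<^sup>2)" by (rule convex_power2)
  have bm: "(\<lambda>x::real. x\<^sup>2) \<in> borel_measurable borel" by measurable
  have i: "integrable M (\<lambda>\<omega>. (real_cond_exp M (F s) G \<omega>)\<^sup>2)"
    by (rule S.integrable_convex_cond_exp[OF Gi, where I = UNIV and q = "\<lambda>x. x\<^sup>2"]) (use G2 cv bm in auto)
  have "real_cond_exp M (F s) G \<in> borel_measurable M"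
    using S.real_cond_exp_int(1)[OF Gi] by (rule borel_measurable_integrable)
  with i show "L2_fun M (real_cond_exp M (F s) G)" by (simp add: L2_fun_def)
  have "AE \<omega> in M. (real_cond_exp M (F s) G \<omega>)\<^sup>2 \<le> real_cond_exp M (F s) (\<lambda>\<omega>. (G \<omega>)\<^sup>2) \<omega>"
    by (rule S.real_cond_exp_jensens_inequality(2)[OF Gi, where I = UNIV and q = "\<lambda>x. x\<^sup>2"]) (use G2 cv bm in auto)
  then have "expectation (\<lambda>\<omega>. (real_cond_exp M (F s) G \<omega>)\<^sup>2) \<le> expectation (real_cond_exp M (F s) (\<lambda>\<omega>. (G \<omega>)\<^sup>2))"
    by (rule integral_mono_AE[OF i S.real_cond_exp_int(1)[OF G2]])
  then show "expectation (\<lambda>\<omega>. (real_cond_exp M (F s) G \<omega>)\<^sup>2) \<le> expectation (\<lambda>\<omega>. (G \<omega>)\<^sup>2)"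
    by (simp only: S.real_cond_exp_int(2)[OF G2])
qed

text \<open>The process is a version of the conditional expectation at almost every time, and each conditional expectation is a
contraction for the norm of square integrable functions.\<close>

lemma sq_on_cond_exp_process:
  fixes G V :: "real \<Rightarrow> 'w \<Rightarrow> real"
  assumes V: "cond_exp_process M F a b G V" and G: "sq_on M {a..b} G"
  shows "sq_on M {a..b} V"
proof -
  let ?Q = "lborel \<Otimes>\<^sub>M M"
  let ?V = "\<lambda>x. indicat_real {a..b} (fst x) *\<^sub>R V (fst x) (snd x)"
  let ?G = "\<lambda>x. indicat_real {a..b} (fst x) *\<^sub>R G (fst x) (snd x)"
  have Vm: "?V \<in> borel_measurable ?Q"
    using meas_on_of_prog[of F a b V M] V subalgebra_F unfolding cond_exp_process_def meas_on_def by blast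
  have Gm: "?G \<in> borel_measurable ?Q" and Gi: "integrable ?Q (\<lambda>x. (norm (?G x))\<^sup>2)"
    using G by (simp_all add: sq_on_def L2_fun_def)
  have ae: "AE s in lborel. s \<in> {a..b} \<longrightarrow> (AE \<omega> in M. V s \<omega> = real_cond_exp M (F s) (G s) \<omega>)"
    using V by (simp add: cond_exp_process_def)
  have le: "AE s in lborel. (\<integral>\<^sup>+\<omega>. ennreal ((norm (?V (s, \<omega>)))\<^sup>2) \<partial>M) \<le> (\<integral>\<^sup>+\<omega>. ennreal ((norm (?G (s, \<omega>)))\<^sup>2) \<partial>M)"
    using ae sq_on_AE_L2[OF G]
  proof eventually_elim
    case (elim s)
    show ?case
    proof (cases "s \<in> {a..b}")
      case True
      let ?R = "real_cond_exp M (F s) (G s)"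
      have Gs: "L2_fun M (G s)" and eq: "AE \<omega> in M. V s \<omega> = ?R \<omega>" using elim True by auto
      note R = expectation_real_cond_exp_square_le[OF Gs, of s]
      have "(\<integral>\<^sup>+\<omega>. ennreal ((norm (?V (s, \<omega>)))\<^sup>2) \<partial>M) = (\<integral>\<^sup>+\<omega>. ennreal ((?R \<omega>)\<^sup>2) \<partial>M)"
        using eq True by (intro nn_integral_cong_AE) (auto simp: indicator_def)
      also have "\<dots> = ennreal (expectation (\<lambda>\<omega>. (?R \<omega>)\<^sup>2))"
        using R(1) by (intro nn_integral_eq_integral) (auto simp: L2_fun_def)
      also have "\<dots> \<le> ennreal (expectation (\<lambda>\<omega>. (G s \<omega>)\<^sup>2))" using R(2) by (rule ennreal_leI)
      also have "\<dots> = (\<integral>\<^sup>+\<omega>. ennreal ((G s \<omega>)\<^sup>2) \<partial>M)"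
        using Gs by (intro nn_integral_eq_integral[symmetric]) (auto simp: L2_fun_def)
      also have "\<dots> = (\<integral>\<^sup>+\<omega>. ennreal ((norm (?G (s, \<omega>)))\<^sup>2) \<partial>M)" using True by simp
      finally show ?thesis .
    qed auto
  qed
  have m2: "(\<lambda>x. ennreal ((norm (H x))\<^sup>2)) \<in> borel_measurable ?Q" if "H \<in> borel_measurable ?Q" for H :: "real \<times> 'w \<Rightarrow> real"
    using that by measurable
  have "(\<integral>\<^sup>+x. ennreal ((norm (?V x))\<^sup>2) \<partial>?Q) = (\<integral>\<^sup>+s. (\<integral>\<^sup>+\<omega>. ennreal ((norm (?V (s, \<omega>)))\<^sup>2) \<partial>M) \<partial>lborel)"
    by (rule nn_integral_fst[OF m2[OF Vm], symmetric])
  also have "\<dots> \<le> (\<integral>\<^sup>+s. (\<integral>\<^sup>+\<omega>. ennreal ((norm (?G (s, \<omega>)))\<^sup>2) \<partial>M) \<partial>lborel)"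
    by (rule nn_integral_mono_AE[OF le])
  also have "\<dots> = (\<integral>\<^sup>+x. ennreal ((norm (?G x))\<^sup>2) \<partial>?Q)"
    by (rule nn_integral_fst[OF m2[OF Gm]])
  also have "\<dots> < \<infinity>" using Gi unfolding integrable_iff_bounded by simp
  finally have fin: "(\<integral>\<^sup>+x. ennreal ((norm (?V x))\<^sup>2) \<partial>?Q) < \<infinity>" .
  have "integrable ?Q (\<lambda>x. (norm (?V x))\<^sup>2)"
  proof (rule integrableI_bounded)
    show "(\<lambda>x. (norm (?V x))\<^sup>2) \<in> borel_measurable ?Q"
      by (rule borel_measurable_power[OF measurable_compose[OF Vm borel_measurable_norm]])
    show "(\<integral>\<^sup>+x. ennreal (norm ((norm (?V x))\<^sup>2)) \<partial>?Q) < \<infinity>" using fin by simp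
  qed
  with Vm show ?thesis unfolding sq_on_def L2_fun_def by blast
qed

text \<open>Against an adapted process \<open>g\<close>, the conditional expectation may be dropped.\<close>

lemma pint_cond_exp_process:
  fixes G V g :: "real \<Rightarrow> 'w \<Rightarrow> 'b::euclidean_space"
  assumes V: "cond_exp_process M F a b G V" and G: "sq_on M {a..b} G" and sV: "sq_on M {c..b} V"
    and g: "sq_on M {c..b} g" "\<And>s. s \<in> {c..b} \<Longrightarrow> g s \<in> borel_measurable (F s)" and ac: "a \<le> c"
  shows "pint M {c..b} (\<lambda>s \<omega>. g s \<omega> \<bullet> V s \<omega>) = pint M {c..b} (\<lambda>s \<omega>. g s \<omega> \<bullet> G s \<omega>)"
proof (rule pint_cong_expectation)
  have sG: "sq_on M {c..b} G" by (rule sq_on_subset[OF G]) (use ac in auto)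
  show "int_on M {c..b} (\<lambda>s \<omega>. g s \<omega> \<bullet> V s \<omega>)" "int_on M {c..b} (\<lambda>s \<omega>. g s \<omega> \<bullet> G s \<omega>)"
    by (rule int_on_inner[OF g(1) sV], rule int_on_inner[OF g(1) sG])
  have ae: "AE s in lborel. s \<in> {a..b} \<longrightarrow>
      (AE \<omega> in M. \<forall>i\<in>Basis. V s \<omega> \<bullet> i = real_cond_exp M (F s) (\<lambda>\<omega>'. G s \<omega>' \<bullet> i) \<omega>)"
    using V by (simp add: cond_exp_process_def)
  show "AE s in lborel. s \<in> {c..b} \<longrightarrow> expectation (\<lambda>\<omega>. g s \<omega> \<bullet> V s \<omega>) = expectation (\<lambda>\<omega>. g s \<omega> \<bullet> G s \<omega>)"
    using ae sq_on_AE_L2[OF sG] sq_on_AE_L2[OF g(1)] sq_on_AE_L2[OF sV]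
  proof eventually_elim
    case (elim s)
    show ?case
    proof
      assume s: "s \<in> {c..b}"
      interpret S: sigma_finite_subalgebra M "F s" by (rule cond_exp_subalgebra)
      have L: "L2_fun M (G s)" "L2_fun M (g s)" "L2_fun M (V s)" using elim s by auto
      have gm: "g s \<in> borel_measurable (F s)" by (rule g(2)[OF s])
      let ?R = "\<lambda>i. real_cond_exp M (F s) (\<lambda>\<omega>'. G s \<omega>' \<bullet> i)"
      have eq: "AE \<omega> in M. \<forall>i\<in>Basis. V s \<omega> \<bullet> i = ?R i \<omega>" using elim s ac by auto
      have comp: "L2_fun M (\<lambda>\<omega>. h \<omega> \<bullet> i)" if "L2_fun M h" "i \<in> Basis" for h :: "'w \<Rightarrow> 'b" and i
      proof (rule L2_fun_bound[OF that(1), where K = 1])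
        have [measurable]: "h \<in> borel_measurable M" by (rule L2_fun_measurable[OF that(1)])
        show "(\<lambda>\<omega>. h \<omega> \<bullet> i) \<in> borel_measurable M" by measurable
        show "AE \<omega> in M. norm (h \<omega> \<bullet> i) \<le> 1 * norm (h \<omega>)" using Basis_le_norm[OF that(2)] by simp
      qed
      have gi: "(\<lambda>\<omega>. g s \<omega> \<bullet> i) \<in> borel_measurable (F s)" for i
        using gm by measurable
      have ii: "integrable M (\<lambda>\<omega>. (g s \<omega> \<bullet> i) * (G s \<omega> \<bullet> i))" if "i \<in> Basis" for i
        by (rule integrable_mult_L2[OF comp[OF L(2) that] comp[OF L(1) that]])
      have Gim: "(\<lambda>\<omega>. G s \<omega> \<bullet> i) \<in> borel_measurable M" if "i \<in> Basis" for i
        by (rule L2_fun_measurable[OF comp[OF L(1) that]])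
      note R = S.real_cond_exp_intg[OF ii gi Gim]
      have "expectation (\<lambda>\<omega>. g s \<omega> \<bullet> V s \<omega>) = expectation (\<lambda>\<omega>. \<Sum>i\<in>Basis. (g s \<omega> \<bullet> i) * ?R i \<omega>)"
      proof (rule integral_cong_AE)
        show "(\<lambda>\<omega>. g s \<omega> \<bullet> V s \<omega>) \<in> borel_measurable M"
          using integrable_inner_L2[OF L(2,3)] by (rule borel_measurable_integrable)
        show "(\<lambda>\<omega>. \<Sum>i\<in>Basis. (g s \<omega> \<bullet> i) * ?R i \<omega>) \<in> borel_measurable M"
          by (intro borel_measurable_integrable Bochner_Integration.integrable_sum R(1))
        show "AE \<omega> in M. g s \<omega> \<bullet> V s \<omega> = (\<Sum>i\<in>Basis. (g s \<omega> \<bullet> i) * ?R i \<omega>)"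
          using eq by eventually_elim (simp add: euclidean_inner[of "g s _" "V s _"])
      qed
      also have "\<dots> = (\<Sum>i\<in>Basis. expectation (\<lambda>\<omega>. (g s \<omega> \<bullet> i) * ?R i \<omega>))"
        by (rule Bochner_Integration.integral_sum[OF R(1)])
      also have "\<dots> = (\<Sum>i\<in>Basis. expectation (\<lambda>\<omega>. (g s \<omega> \<bullet> i) * (G s \<omega> \<bullet> i)))"
        by (intro sum.cong refl R(2))
      also have "\<dots> = expectation (\<lambda>\<omega>. \<Sum>i\<in>Basis. (g s \<omega> \<bullet> i) * (G s \<omega> \<bullet> i))"
        by (rule Bochner_Integration.integral_sum[OF ii, symmetric])
      also have "\<dots> = expectation (\<lambda>\<omega>. g s \<omega> \<bullet> G s \<omega>)"
        by (simp only: euclidean_inner[symmetric])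
      finally show "expectation (\<lambda>\<omega>. g s \<omega> \<bullet> V s \<omega>) = expectation (\<lambda>\<omega>. g s \<omega> \<bullet> G s \<omega>)" .
    qed
  qed
qed

section \<open>Drift and martingale part of the two solutions\<close>

lemma L2_F_of_S2_proc:
  assumes "S2_proc M F a b X" "s \<in> {a..b}"
  shows "L2_F s (X s)"
  using adapted_of_prog[of F a b X s] L2_fun_of_S2_proc[OF assms subalgebra_F] assms
  by (simp add: L2_F_def S2_proc_def L2_proc_def)

lemma sq_on_of_S2_proc: "S2_proc M F a b X \<Longrightarrow> sq_on M {a..b} X"
  using sq_on_of_L2_proc[OF _ subalgebra_F] by (auto simp: S2_proc_def)

text \<open>\<open>X\<^sub>T - X\<^sub>s - \<integral>\<^sub>s\<^sup>T a\<^sub>r dr\<close> is the difference of the stochastic integrals over \<open>[t, T]\<close> and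
\<open>[t, s]\<close>, to which the martingale property applies.\<close>

lemma has_drift_forward:
  fixes \<alpha> :: "real \<Rightarrow> 'w \<Rightarrow> real^'d"
  assumes X: "S2_proc M F t T X" and a: "sq_on M {t..T} a" "\<And>s. s \<in> {t..T} \<Longrightarrow> a s \<in> borel_measurable (F s)"
    and eq: "\<And>r. r \<in> {t<..T} \<Longrightarrow> \<exists>I. has_ito_integral M B t r \<alpha> I \<and>
      (AE \<omega> in M. X r \<omega> = X t \<omega> + (LINT s:{t..r}|lborel. a s \<omega>) + I \<omega>)"
    and t: "0 \<le> t" "t < T"
  shows "has_drift t T X a"
  unfolding has_drift_def
proof (intro conjI ballI allI impI a(1) sq_on_of_S2_proc[OF X])
  fix s assume s: "s \<in> {t..T}"
  show "L2_F s (X s)" by (rule L2_F_of_S2_proc[OF X s])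
  show "a s \<in> borel_measurable (F s)" by (rule a(2)[OF s])
  fix g assume g: "L2_F s g"
  let ?D = "\<lambda>\<omega>. X T \<omega> - X s \<omega> - (LINT r:{s..T}|lborel. a r \<omega>)"
  have gL: "L2_fun M g" using g by (simp add: L2_F_def)
  obtain I where I: "has_ito_integral M B t T \<alpha> I"
    and IT: "AE \<omega> in M. X T \<omega> = X t \<omega> + (LINT s:{t..T}|lborel. a s \<omega>) + I \<omega>"
    using eq[of T] t by auto
  have IL: "L2_fun M I" by (rule L2_fun_ito[OF I t(1)])
  have DL: "L2_fun M ?D"
  proof -
    have "L2_fun M (X T)" "L2_fun M (X s)"
      using L2_F_of_S2_proc[OF X, of T] L2_F_of_S2_proc[OF X s] t by (auto simp: L2_F_def)
    moreover have "L2_fun M (\<lambda>\<omega>. LINT r:{s..T}|lborel. a r \<omega>)"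
      by (rule L2_fun_LINT[OF sq_on_subset[OF a(1)]]) (use s in auto)
    ultimately show ?thesis by (intro L2_fun_diff)
  qed
  show "expectation (\<lambda>\<omega>. g \<omega> * ?D \<omega>) = 0"
  proof (cases "s = t")
    case True
    have "expectation (\<lambda>\<omega>. g \<omega> * ?D \<omega>) = expectation (\<lambda>\<omega>. g \<omega> * I \<omega>)"
    proof (rule integral_cong_AE)
      show "AE \<omega> in M. g \<omega> * ?D \<omega> = g \<omega> * I \<omega>"
        using IT by eventually_elim (simp add: True)
    qed (use integrable_mult_L2[OF gL DL] integrable_mult_L2[OF gL IL] in \<open>auto intro: borel_measurable_integrable\<close>)
    then show ?thesis using expectation_ito[OF I t(1)] g True by simp
  next
    case False
    then obtain J where J: "has_ito_integral M B t s \<alpha> J"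
      and Js: "AE \<omega> in M. X s \<omega> = X t \<omega> + (LINT s:{t..s}|lborel. a s \<omega>) + J \<omega>"
      using eq[of s] s by auto
    have JL: "L2_fun M J" by (rule L2_fun_ito[OF J t(1)])
    have "expectation (\<lambda>\<omega>. g \<omega> * ?D \<omega>) = expectation (\<lambda>\<omega>. g \<omega> * I \<omega> - g \<omega> * J \<omega>)"
    proof (rule integral_cong_AE)
      show "AE \<omega> in M. g \<omega> * ?D \<omega> = g \<omega> * I \<omega> - g \<omega> * J \<omega>"
        using IT Js AE_set_integrable_int_on[OF int_on_of_sq_on[OF a(1)]]
      proof eventually_elim
        case (elim \<omega>)
        have "(LINT s:{t..T}|lborel. a s \<omega>) = (LINT s:{t..s}|lborel. a s \<omega>) + (LINT s:{s..T}|lborel. a s \<omega>)"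
          using elim(3) s by (intro LINT_split) auto
        then show ?case using elim(1,2) by (simp add: right_diff_distrib[symmetric])
      qed
    qed (use integrable_mult_L2[OF gL DL] Bochner_Integration.integrable_diff[OF integrable_mult_L2[OF gL IL] integrable_mult_L2[OF gL JL]]
        in \<open>auto intro: borel_measurable_integrable\<close>)
    also have "\<dots> = expectation (\<lambda>\<omega>. g \<omega> * I \<omega>) - expectation (\<lambda>\<omega>. g \<omega> * J \<omega>)"
      by (rule Bochner_Integration.integral_diff[OF integrable_mult_L2[OF gL IL] integrable_mult_L2[OF gL JL]])
    also have "\<dots> = 0" using expectation_ito_restrict[OF I J t(1) _ _ g] s by simp
    finally show ?thesis .
  qed
qed

text \<open>Here the stochastic integral over \<open>[s, T]\<close> is given directly, and its orthogonality to \<open>L\<^sup>2(F\<^sub>s)\<close>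
suffices.\<close>

lemma has_drift_backward:
  fixes Z :: "real \<Rightarrow> 'w \<Rightarrow> real^'d"
  assumes Y: "S2_proc M F 0 T Y" and f: "sq_on M {t..T} f" "\<And>s. s \<in> {t..T} \<Longrightarrow> f s \<in> borel_measurable (F s)"
    and eq: "\<And>s. s \<in> {t..<T} \<Longrightarrow> \<exists>I. has_ito_integral M B s T Z I \<and>
      (AE \<omega> in M. Y s \<omega> = Y T \<omega> + (LINT r:{s..T}|lborel. f r \<omega>) - I \<omega>)"
    and t: "0 \<le> t" "t < T"
  shows "has_drift t T Y (\<lambda>s \<omega>. - f s \<omega>)"
  unfolding has_drift_def
proof (intro conjI ballI allI impI sq_on_uminus f(1))
  show "sq_on M {t..T} Y" by (rule sq_on_subset[OF sq_on_of_S2_proc[OF Y]]) (use t in auto)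
  fix s assume s: "s \<in> {t..T}"
  then have s0: "s \<in> {0..T}" using t by auto
  show "L2_F s (Y s)" by (rule L2_F_of_S2_proc[OF Y s0])
  show "(\<lambda>\<omega>. - f s \<omega>) \<in> borel_measurable (F s)" using f(2)[OF s] by (rule borel_measurable_uminus)
  fix g assume g: "L2_F s g"
  let ?D = "\<lambda>\<omega>. Y T \<omega> - Y s \<omega> - (LINT r:{s..T}|lborel. - f r \<omega>)"
  have gL: "L2_fun M g" using g by (simp add: L2_F_def)
  show "expectation (\<lambda>\<omega>. g \<omega> * ?D \<omega>) = 0"
  proof (cases "s = T")
    case True then show ?thesis unfolding True LINT_singleton by simp
  next
    case False
    then obtain I where I: "has_ito_integral M B s T Z I"
      and Is: "AE \<omega> in M. Y s \<omega> = Y T \<omega> + (LINT r:{s..T}|lborel. f r \<omega>) - I \<omega>"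
      using eq[of s] s by auto
    have s': "0 \<le> s" using s t by auto
    have IL: "L2_fun M I" by (rule L2_fun_ito[OF I s'])
    have DL: "L2_fun M ?D"
    proof -
      have "L2_fun M (Y T)" "L2_fun M (Y s)"
        using L2_F_of_S2_proc[OF Y, of T] L2_F_of_S2_proc[OF Y s0] t by (auto simp: L2_F_def)
      moreover have "L2_fun M (\<lambda>\<omega>. LINT r:{s..T}|lborel. - f r \<omega>)"
        by (rule L2_fun_LINT[OF sq_on_uminus[OF sq_on_subset[OF f(1)]]]) (use s in auto)
      ultimately show ?thesis by (intro L2_fun_diff)
    qed
    have "expectation (\<lambda>\<omega>. g \<omega> * ?D \<omega>) = expectation (\<lambda>\<omega>. g \<omega> * I \<omega>)"
    proof (rule integral_cong_AE)
      show "AE \<omega> in M. g \<omega> * ?D \<omega> = g \<omega> * I \<omega>"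
        using Is by eventually_elim (simp add: set_lebesgue_integral_def)
    qed (use integrable_mult_L2[OF gL DL] integrable_mult_L2[OF gL IL] in \<open>auto intro: borel_measurable_integrable\<close>)
    then show ?thesis using expectation_ito[OF I s' g] by simp
  qed
qed

lemma ito_product_rule:
  fixes \<alpha> Z :: "real \<Rightarrow> 'w \<Rightarrow> real^'d"
  assumes X: "has_drift t T X a" and Y: "has_drift t T Y f" and A: "A \<in> sets (F t)" and t: "0 \<le> t" "t < T"
    and I: "has_ito_integral M B t T \<alpha> I" "AE \<omega> in M. X T \<omega> - X t \<omega> - (LINT s:{t..T}|lborel. a s \<omega>) = I \<omega>"
    and J: "has_ito_integral M B t T Z J" "AE \<omega> in M. Y T \<omega> - Y t \<omega> - (LINT s:{t..T}|lborel. f s \<omega>) = J \<omega>"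
  shows "expectation (\<lambda>\<omega>. indicat_real A \<omega> * (X T \<omega> * Y T \<omega>)) - expectation (\<lambda>\<omega>. indicat_real A \<omega> * (X t \<omega> * Y t \<omega>)) =
    pint M {t..T} (\<lambda>s \<omega>. indicat_real A \<omega> * (a s \<omega> * Y s \<omega>)) +
    pint M {t..T} (\<lambda>s \<omega>. indicat_real A \<omega> * (f s \<omega> * X s \<omega>)) +
    pint M {t..T} (\<lambda>s \<omega>. indicat_real A \<omega> * (\<alpha> s \<omega> \<bullet> Z s \<omega>))"
proof -
  let ?m = "\<lambda>\<omega>. X T \<omega> - X t \<omega> - (LINT s:{t..T}|lborel. a s \<omega>)"
  let ?n = "\<lambda>\<omega>. Y T \<omega> - Y t \<omega> - (LINT s:{t..T}|lborel. f s \<omega>)"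
  have L: "L2_fun M ?m" "L2_fun M ?n"
  proof -
    have "L2_fun M (X T)" "L2_fun M (X t)" "L2_fun M (Y T)" "L2_fun M (Y t)"
      using X Y t by (auto simp: has_drift_def L2_F_def)
    moreover have "L2_fun M (\<lambda>\<omega>. LINT s:{t..T}|lborel. a s \<omega>)" "L2_fun M (\<lambda>\<omega>. LINT s:{t..T}|lborel. f s \<omega>)"
      using X Y by (auto simp: has_drift_def intro: L2_fun_LINT)
    ultimately have "L2_fun M ?m \<and> L2_fun M ?n" by (intro conjI L2_fun_diff)
    then show "L2_fun M ?m" "L2_fun M ?n" by blast+
  qed
  have IL: "L2_fun M I" "L2_fun M J" by (rule L2_fun_ito[OF I(1) t(1)], rule L2_fun_ito[OF J(1) t(1)])
  have int: "integrable M (\<lambda>\<omega>. indicat_real A \<omega> * (f \<omega> * g \<omega>))" if "L2_fun M f" "L2_fun M g" for f g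
    using integrable_mult_L2[OF L2_fun_bounded_mult[OF bounded_F_indicator[OF A] that(1)] that(2)]
    by (simp add: mult.assoc)
  have "expectation (\<lambda>\<omega>. indicat_real A \<omega> * (?m \<omega> * ?n \<omega>)) = expectation (\<lambda>\<omega>. indicat_real A \<omega> * (I \<omega> * J \<omega>))"
  proof (rule integral_cong_AE)
    show "AE \<omega> in M. indicat_real A \<omega> * (?m \<omega> * ?n \<omega>) = indicat_real A \<omega> * (I \<omega> * J \<omega>)"
      using I(2) J(2) by eventually_elim simp
  qed (use int[OF L] int[OF IL] in \<open>auto intro: borel_measurable_integrable\<close>)
  also have "\<dots> = pint M {t..T} (\<lambda>s \<omega>. indicat_real A \<omega> * (\<alpha> s \<omega> \<bullet> Z s \<omega>))"
    by (rule ito_isometry[OF I(1) J(1) t(1) A])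
  finally show ?thesis using product_rule[OF X Y A] t by simp
qed

section \<open>Triviality of the initial sigma-algebra\<close>

text \<open>The only generators of \<open>F\<^sub>0\<close> are null sets and events of \<open>B\<^sub>0\<close>, which is almost surely \<open>0\<close>.\<close>

lemma F_zero_trivial:
  assumes "C \<in> sets (F 0)"
  shows "(AE \<omega> in M. \<omega> \<in> C) \<or> (AE \<omega> in M. \<omega> \<notin> C)"
proof -
  have "C \<in> sigma_sets (space M) (F_gen 0)" using assms by (simp add: sets_F)
  then show ?thesis
  proof induction
    case (Basic C)
    then consider (B) A where "C = B 0 -` A \<inter> space M" | (null) "C \<in> null_sets M"
      by (force simp: F_gen_def)
    then show ?case
    proof cases
      case B
      show ?thesis
      proof (cases "0 \<in> A")
        case True
        have "AE \<omega> in M. \<omega> \<in> C"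
          using B_zero AE_space by eventually_elim (simp add: B True)
        then show ?thesis ..
      next
        case False
        have "AE \<omega> in M. \<omega> \<notin> C"
          using B_zero by eventually_elim (simp add: B False)
        then show ?thesis ..
      qed
    next
      case null then show ?thesis using AE_not_in by blast
    qed
  next
    case Empty then show ?case by simp
  next
    case (Compl C)
    from Compl.IH show ?case
    proof
      assume *: "AE \<omega> in M. \<omega> \<in> C"
      have "AE \<omega> in M. \<omega> \<notin> space M - C" using * by eventually_elim simp
      then show ?thesis ..
    next
      assume *: "AE \<omega> in M. \<omega> \<notin> C"
      have "AE \<omega> in M. \<omega> \<in> space M - C" using * AE_space by eventually_elim simp
      then show ?thesis ..
    qed
  next
    case (Union C)
    show ?case
    proof (cases "\<exists>i. AE \<omega> in M. \<omega> \<in> C i")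
      case True
      then obtain i where "AE \<omega> in M. \<omega> \<in> C i" ..
      then have "AE \<omega> in M. \<omega> \<in> (\<Union>i. C i)" by eventually_elim blast
      then show ?thesis ..
    next
      case False
      then have "\<forall>i. AE \<omega> in M. \<omega> \<notin> C i" using Union.IH by blast
      then have "AE \<omega> in M. \<forall>i. \<omega> \<notin> C i" by (simp add: AE_all_countable)
      then have "AE \<omega> in M. \<omega> \<notin> (\<Union>i. C i)" by eventually_elim blast
      then show ?thesis ..
    qed
  qed
qed

lemma real_cond_exp_F_zero:
  assumes H: "integrable M H"
  shows "AE \<omega> in M. real_cond_exp M (F 0) H \<omega> = expectation H"
proof -
  interpret S: sigma_finite_subalgebra M "F 0" by (rule cond_exp_subalgebra)
  show ?thesis
  proof (rule S.real_cond_exp_charact[OF _ H])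
    show "integrable M (\<lambda>\<omega>. expectation H)" by simp
    show "(\<lambda>\<omega>. expectation H) \<in> borel_measurable (F 0)" by simp
    fix C assume C: "C \<in> sets (F 0)"
    have Cm: "C \<in> events" by (rule sets_F_M[OF C])
    have Hm: "H \<in> borel_measurable M" using H by (rule borel_measurable_integrable)
    have "(\<integral>\<omega>\<in>C. h \<omega> \<partial>M) = expectation h" if "AE \<omega> in M. \<omega> \<in> C" "h \<in> borel_measurable M" for h :: "'w \<Rightarrow> real"
      unfolding set_lebesgue_integral_def
    proof (rule integral_cong_AE)
      show "AE \<omega> in M. indicat_real C \<omega> *\<^sub>R h \<omega> = h \<omega>" using that(1) by eventually_elim simp
    qed (use that(2) Cm in measurable)
    moreover have "(\<integral>\<omega>\<in>C. h \<omega> \<partial>M) = 0" if "AE \<omega> in M. \<omega> \<notin> C" for h :: "'w \<Rightarrow> real"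
      unfolding set_lebesgue_integral_def
    proof (rule integral_eq_zero_AE)
      show "AE \<omega> in M. indicat_real C \<omega> *\<^sub>R h \<omega> = 0" using that(1) by eventually_elim simp
    qed
    ultimately show "(\<integral>\<omega>\<in>C. H \<omega> \<partial>M) = (\<integral>\<omega>\<in>C. expectation H \<partial>M)"
      using F_zero_trivial[OF C] Hm by (auto simp: prob_space)
  qed
qed

end

section \<open>Duality of the backward and the forward equation\<close>

locale anticipated_bsde = brownian_motion M B
  for M :: "'w measure" and B :: "real \<Rightarrow> 'w \<Rightarrow> real ^ 'd" +
  fixes T l u :: real
    and \<xi> b b_bar b_low c Y :: "real \<Rightarrow> 'w \<Rightarrow> real"
    and \<eta> \<sigma> \<sigma>_bar \<sigma>_low Z :: "real \<Rightarrow> 'w \<Rightarrow> real ^ 'd"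
  assumes T0: "T > 0" and T: "0 \<le> l" "0 \<le> u"
    and xi_data: "L2_proc M F T (T + u) \<xi>" and eta_data: "L2_proc M F T (T + u) \<eta>"
    and b_data: "L2_proc M F 0 (T + u + l) b" "unif_bounded M 0 (T + u + l) b"
    and b_bar_data: "L2_proc M F 0 (T + u + l) b_bar" "unif_bounded M 0 (T + u + l) b_bar"
    and b_low_data: "L2_proc M F 0 (T + u + l) b_low" "unif_bounded M 0 (T + u + l) b_low"
    and c_data: "L2_proc M F 0 (T + u + l) c"
    and sigma_data: "L2_proc M F 0 (T + u + l) \<sigma>" "unif_bounded M 0 (T + u + l) \<sigma>"
    and sigma_bar_data: "L2_proc M F 0 (T + u + l) \<sigma>_bar" "unif_bounded M 0 (T + u + l) \<sigma>_bar"
    and sigma_low_data: "L2_proc M F 0 (T + u + l) \<sigma>_low" "unif_bounded M 0 (T + u + l) \<sigma>_low"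
    and bsde: "bsde_solution M B T l u b b_bar b_low \<sigma> \<sigma>_bar \<sigma>_low c \<xi> \<eta> Y Z"
begin

text \<open>The product rule for \<open>X\<close> and \<open>Y\<close>, with all terms that occur twice cancelled.  In the proof, \<open>P\<close> collects
the products with a factor \<open>X\<^sub>s\<^sub>-\<^sub>u\<close> and \<open>q\<close> those with a factor \<open>Y\<^sub>s\<^sub>-\<^sub>l\<close> or \<open>Z\<^sub>s\<^sub>-\<^sub>l\<close>.
Each of them occurs once over \<open>[t, T]\<close> and once, from an advanced term, over an interval translated by
\<open>u\<close> or \<open>l\<close>.\<close>

lemma duality:
  fixes X :: "real \<Rightarrow> 'w \<Rightarrow> real"
  assumes t: "0 \<le> t" "t < T"
    and sde: "sde_solution M B T l u b b_bar b_low \<sigma> \<sigma>_bar \<sigma>_low t X"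
  defines "p \<equiv> \<lambda>s \<omega>. X (s - u) \<omega> * (b_low s \<omega> * \<xi> s \<omega> + \<sigma>_low s \<omega> \<bullet> \<eta> s \<omega>)"
    and "q \<equiv> \<lambda>s \<omega>. X s \<omega> * (b_bar s \<omega> * Y (s - l) \<omega> + \<sigma>_bar s \<omega> \<bullet> Z (s - l) \<omega>)"
  shows "L2_F t (Y t)" "L2_F T (X T)" "L2_F T (Y T)"
    "int_on M {T..T + u} p" "int_on M {t..t + l} q" "int_on M {t..T} (\<lambda>s \<omega>. c s \<omega> * X s \<omega>)"
    "int_on M {t..t + l} (\<lambda>s \<omega>. X s \<omega> * b_bar s \<omega>)"
    "\<And>A. A \<in> sets (F t) \<Longrightarrow> expectation (\<lambda>\<omega>. indicat_real A \<omega> * Y t \<omega>) =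
      expectation (\<lambda>\<omega>. indicat_real A \<omega> * (X T \<omega> * \<xi> T \<omega>)) +
      pint M {T..T + u} (\<lambda>s \<omega>. indicat_real A \<omega> * p s \<omega>) + pint M {t..t + l} (\<lambda>s \<omega>. indicat_real A \<omega> * q s \<omega>) +
      pint M {t..T} (\<lambda>s \<omega>. indicat_real A \<omega> * (c s \<omega> * X s \<omega>))"
proof -
  have YS: "S2_proc M F 0 T Y" and ZL: "L2_proc M F 0 T Z"
    and Yxi: "\<And>s \<omega>. s \<in> {T..T + u} \<Longrightarrow> \<omega> \<in> space M \<Longrightarrow> Y s \<omega> = \<xi> s \<omega>"
    and Zeta: "\<And>s \<omega>. s \<in> {T..T + u} \<Longrightarrow> \<omega> \<in> space M \<Longrightarrow> Z s \<omega> = \<eta> s \<omega>"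
    and Yneg: "\<And>s \<omega>. s \<in> {- l..<0} \<Longrightarrow> \<omega> \<in> space M \<Longrightarrow> Y s \<omega> = Y 0 \<omega>"
    and Zneg: "\<And>s \<omega>. s \<in> {- l..<0} \<Longrightarrow> \<omega> \<in> space M \<Longrightarrow> Z s \<omega> = 0"
    using bsde unfolding bsde_solution_def by blast+
  obtain V1 W1 where V1: "cond_exp_process M F 0 T (\<lambda>s \<omega>. b_low (s + u) \<omega> * Y (s + u) \<omega>) V1"
    and W1: "cond_exp_process M F 0 T (\<lambda>s \<omega>. \<sigma>_low (s + u) \<omega> \<bullet> Z (s + u) \<omega>) W1"
    and Yeq: "\<And>s. s \<in> {0..<T} \<Longrightarrow> \<exists>I. has_ito_integral M B s T Z I \<and>
           (AE \<omega> in M. Y s \<omega> = \<xi> T \<omega>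
              + (LINT r:{s..T}|lborel.
                   b r \<omega> * Y r \<omega> + b_bar r \<omega> * Y (r - l) \<omega> + V1 r \<omega>
                   + \<sigma> r \<omega> \<bullet> Z r \<omega> + \<sigma>_bar r \<omega> \<bullet> Z (r - l) \<omega> + W1 r \<omega> + c r \<omega>)
              - I \<omega>)"
    using bsde unfolding bsde_solution_def by blast
  have XS: "S2_proc M F t T X"
    and X1: "\<And>\<omega>. \<omega> \<in> space M \<Longrightarrow> X t \<omega> = 1"
    and Xpos: "\<And>s \<omega>. s \<in> {T<..T + l} \<Longrightarrow> \<omega> \<in> space M \<Longrightarrow> X s \<omega> = 0"
    and Xneg: "\<And>s \<omega>. s \<in> {t - u..<t} \<Longrightarrow> \<omega> \<in> space M \<Longrightarrow> X s \<omega> = 0"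
    using sde unfolding sde_solution_def by blast+
  obtain V2 W2 where V2: "cond_exp_process M F t T (\<lambda>s \<omega>. b_bar (s + l) \<omega> * X (s + l) \<omega>) V2"
    and W2: "cond_exp_process M F t T (\<lambda>s \<omega>. X (s + l) \<omega> *\<^sub>R \<sigma>_bar (s + l) \<omega>) W2"
    and Xeq: "\<And>r. r \<in> {t<..T} \<Longrightarrow> \<exists>I. has_ito_integral M B t r
             (\<lambda>s \<omega>. X s \<omega> *\<^sub>R \<sigma> s \<omega> + X (s - u) \<omega> *\<^sub>R \<sigma>_low s \<omega> + W2 s \<omega>) I \<and>
           (AE \<omega> in M. X r \<omega> = X t \<omega>
              + (LINT s:{t..r}|lborel. b s \<omega> * X s \<omega> + b_low s \<omega> * X (s - u) \<omega> + V2 s \<omega>)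
              + I \<omega>)"
    using sde unfolding sde_solution_def by blast
  define \<alpha> where "\<alpha> = (\<lambda>s \<omega>. X s \<omega> *\<^sub>R \<sigma> s \<omega> + X (s - u) \<omega> *\<^sub>R \<sigma>_low s \<omega> + W2 s \<omega>)"
  define a where "a = (\<lambda>s \<omega>. b s \<omega> * X s \<omega> + b_low s \<omega> * X (s - u) \<omega> + V2 s \<omega>)"
  define f where "f = (\<lambda>r \<omega>. b r \<omega> * Y r \<omega> + b_bar r \<omega> * Y (r - l) \<omega> + V1 r \<omega>
                   + \<sigma> r \<omega> \<bullet> Z r \<omega> + \<sigma>_bar r \<omega> \<bullet> Z (r - l) \<omega> + W1 r \<omega> + c r \<omega>)"

  \<comment> \<open>the processes on their full time ranges\<close>
  have sX: "sq_on M {t - u..T + l} X"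
  proof -
    have "sq_on M {t - u..<t} X" by (rule sq_on_cong[THEN iffD2, OF Xneg sq_on_zero])
    moreover have "sq_on M {T<..T + l} X" by (rule sq_on_cong[THEN iffD2, OF Xpos sq_on_zero])
    ultimately have "sq_on M (({t - u..<t} \<union> {t..T}) \<union> {T<..T + l}) X"
      using sq_on_of_S2_proc[OF XS] by (intro sq_on_Un) auto
    also have "({t - u..<t} \<union> {t..T}) \<union> {T<..T + l} = {t - u..T + l}" using T t by auto
    finally show ?thesis .
  qed
  have Y0: "L2_F 0 (Y 0)" by (rule L2_F_of_S2_proc[OF YS]) (use t in auto)
  have sY: "sq_on M {- l..T + u} Y"
  proof -
    have "sq_on M {- l..<0} (\<lambda>s. Y 0)"
      by (rule sq_on_subset[OF sq_on_const[of _ "- l" 0]]) (use Y0 in \<open>auto simp: L2_F_def\<close>)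
    then have "sq_on M {- l..<0} Y"
      using sq_on_cong[of "{- l..<0}" M Y "\<lambda>s. Y 0", OF Yneg] by simp
    moreover have "sq_on M {T..T + u} Y"
      by (rule sq_on_cong[THEN iffD2, OF Yxi sq_on_of_L2_proc[OF xi_data subalgebra_F]])
    ultimately have "sq_on M (({- l..<0} \<union> {0..T}) \<union> {T..T + u}) Y"
      using sq_on_of_S2_proc[OF YS] by (intro sq_on_Un) auto
    also have "({- l..<0} \<union> {0..T}) \<union> {T..T + u} = {- l..T + u}" using T t by auto
    finally show ?thesis .
  qed
  have sZ: "sq_on M {- l..T + u} Z"
  proof -
    have "sq_on M {- l..<0} Z" by (rule sq_on_cong[THEN iffD2, OF Zneg sq_on_zero])
    moreover have "sq_on M {T..T + u} Z"
      by (rule sq_on_cong[THEN iffD2, OF Zeta sq_on_of_L2_proc[OF eta_data subalgebra_F]])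
    ultimately have "sq_on M (({- l..<0} \<union> {0..T}) \<union> {T..T + u}) Z"
      using sq_on_of_L2_proc[OF ZL subalgebra_F] by (intro sq_on_Un) auto
    also have "({- l..<0} \<union> {0..T}) \<union> {T..T + u} = {- l..T + u}" using T t by auto
    finally show ?thesis .
  qed
  note sXs = sq_on_subset[OF sX] and sYs = sq_on_subset[OF sY] and sZs = sq_on_subset[OF sZ]
  have bdd: "bdd_on M {x..y} \<psi>"
    if "L2_proc M F 0 (T + u + l) \<psi>" "unif_bounded M 0 (T + u + l) \<psi>" "0 \<le> x" "y \<le> T + u + l"
    for \<psi> :: "real \<Rightarrow> 'w \<Rightarrow> 'e::euclidean_space" and x y
    by (rule bdd_on_subset[OF bdd_on_of_prog[OF _ subalgebra_F that(2)]]) (use that in \<open>auto simp: L2_proc_def\<close>)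

  \<comment> \<open>adaptedness of the shifted processes\<close>
  have adX: "X s \<in> borel_measurable (F r)" if "s \<in> {t - u..T}" "s \<le> r" for s r
  proof (cases "s < t")
    case True
    show ?thesis
    proof (rule measurable_F_cong[OF _ borel_measurable_const[of 0]])
      show "X s \<omega> = 0" if "\<omega> \<in> space M" for \<omega> by (rule Xneg[OF _ that]) (use True \<open>s \<in> {t - u..T}\<close> in auto)
    qed
  next
    case False
    then have "L2_F s (X s)" using that by (intro L2_F_of_S2_proc[OF XS]) auto
    then show ?thesis using L2_F_mono[of s "X s" r] that(2) unfolding L2_F_def by blast
  qed
  have adY: "Y s \<in> borel_measurable (F r)" if "s \<in> {- l..T}" "s \<le> r" "0 \<le> r" for s r
  proof (cases "s < 0")
    case True
    have Y0r: "Y 0 \<in> borel_measurable (F r)" using L2_F_mono[OF Y0 that(3)] unfolding L2_F_def by blast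
    show ?thesis
    proof (rule measurable_F_cong[OF _ Y0r])
      show "Y s \<omega> = Y 0 \<omega>" if "\<omega> \<in> space M" for \<omega> by (rule Yneg[OF _ that]) (use True \<open>s \<in> {- l..T}\<close> in auto)
    qed
  next
    case False
    then have "L2_F s (Y s)" using that by (intro L2_F_of_S2_proc[OF YS]) auto
    then show ?thesis using L2_F_mono[of s "Y s" r] that(2) unfolding L2_F_def by blast
  qed
  have adZ: "Z s \<in> borel_measurable (F r)" if "s \<in> {- l..T}" "s \<le> r" for s r
  proof (cases "s < 0")
    case True
    show ?thesis
    proof (rule measurable_F_cong[OF _ borel_measurable_const[of 0]])
      show "Z s \<omega> = 0" if "\<omega> \<in> space M" for \<omega> by (rule Zneg[OF _ that]) (use True \<open>s \<in> {- l..T}\<close> in auto)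
    qed
  next
    case False
    have "Z s \<in> borel_measurable (F s)"
      by (rule adapted_of_prog[of F 0 T]) (use ZL False that in \<open>auto simp: L2_proc_def\<close>)
    then show ?thesis using that(2) by (rule measurable_F_mono)
  qed
  have adC: "\<psi> s \<in> borel_measurable (F s)" if "L2_proc M F 0 (T + u + l) \<psi>" "s \<in> {t..T}"
    for \<psi> :: "real \<Rightarrow> 'w \<Rightarrow> 'e::euclidean_space" and s
    by (rule adapted_of_prog[of F 0 "T + u + l"]) (use that t T in \<open>auto simp: L2_proc_def\<close>)
  have adV: "V s \<in> borel_measurable (F s)" if "cond_exp_process M F r T G V" "r \<le> t" "s \<in> {t..T}"
    for G V :: "real \<Rightarrow> 'w \<Rightarrow> 'e::euclidean_space" and r s
    by (rule adapted_of_prog[of F r T]) (use that in \<open>auto simp: cond_exp_process_def\<close>)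

  \<comment> \<open>square integrability of all terms\<close>
  have sYl: "sq_on M {t..T + l} (\<lambda>s. Y (s - l))" and sZl: "sq_on M {t..T + l} (\<lambda>s. Z (s - l))"
    by (rule sq_on_shift[OF sYs], use t T in auto, rule sq_on_shift[OF sZs], use t T in auto)
  have sXu: "sq_on M {t..T + u} (\<lambda>s. X (s - u))"
    by (rule sq_on_shift[OF sXs]) (use t T in auto)
  have G1: "sq_on M {0..T} (\<lambda>s \<omega>. b_low (s + u) \<omega> * Y (s + u) \<omega>)"
  proof -
    have "sq_on M {0 + u..T + u} (\<lambda>s \<omega>. b_low s \<omega> * Y s \<omega>)"
      by (rule sq_on_mult_bdd[OF bdd[OF b_low_data] sYs]) (use T t in auto)
    then show ?thesis using sq_on_shift[of 0 "- u" T] by simp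
  qed
  have G2: "sq_on M {0..T} (\<lambda>s \<omega>. \<sigma>_low (s + u) \<omega> \<bullet> Z (s + u) \<omega>)"
  proof -
    have "sq_on M {0 + u..T + u} (\<lambda>s \<omega>. \<sigma>_low s \<omega> \<bullet> Z s \<omega>)"
      by (rule sq_on_inner_bdd[OF bdd[OF sigma_low_data] sZs]) (use T t in auto)
    then show ?thesis using sq_on_shift[of 0 "- u" T] by simp
  qed
  have G3: "sq_on M {t..T} (\<lambda>s \<omega>. b_bar (s + l) \<omega> * X (s + l) \<omega>)"
  proof -
    have "sq_on M {t + l..T + l} (\<lambda>s \<omega>. b_bar s \<omega> * X s \<omega>)"
      by (rule sq_on_mult_bdd[OF bdd[OF b_bar_data] sXs]) (use T t in auto)
    then show ?thesis using sq_on_shift[of t "- l" T] by simp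
  qed
  have G4: "sq_on M {t..T} (\<lambda>s \<omega>. X (s + l) \<omega> *\<^sub>R \<sigma>_bar (s + l) \<omega>)"
  proof -
    have "sq_on M {t + l..T + l} (\<lambda>s \<omega>. X s \<omega> *\<^sub>R \<sigma>_bar s \<omega>)"
      by (rule sq_on_scaleR_bdd[OF sXs bdd[OF sigma_bar_data]]) (use T t in auto)
    then show ?thesis using sq_on_shift[of t "- l" T] by simp
  qed
  have sV1: "sq_on M {t..T} V1" and sW1: "sq_on M {t..T} W1"
    by (rule sq_on_subset[OF sq_on_cond_exp_process[OF V1 G1]], use t in auto,
        rule sq_on_subset[OF sq_on_cond_exp_process[OF W1 G2]], use t in auto)
  have sV2: "sq_on M {t..T} V2" by (rule sq_on_cond_exp_process[OF V2 G3])
  have X': "sq_on M {t..T} X" and Y': "sq_on M {t..T} Y" and Z': "sq_on M {t..T} Z"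
    and Xu': "sq_on M {t..T} (\<lambda>s. X (s - u))" and Yl': "sq_on M {t..T} (\<lambda>s. Y (s - l))"
    and Zl': "sq_on M {t..T} (\<lambda>s. Z (s - l))"
    using T t by (auto intro: sXs sYs sZs sq_on_subset[OF sXu] sq_on_subset[OF sYl] sq_on_subset[OF sZl])
  have c': "sq_on M {t..T} c"
    by (rule sq_on_subset[OF sq_on_of_L2_proc[OF c_data subalgebra_F]]) (use t T in auto)
  have tT: "0 \<le> t" "T \<le> T + u + l" using t T by auto
  note b' = bdd[OF b_data tT] and bbar' = bdd[OF b_bar_data tT] and blow' = bdd[OF b_low_data tT]
    and sig' = bdd[OF sigma_data tT] and sbar' = bdd[OF sigma_bar_data tT] and slow' = bdd[OF sigma_low_data tT]
  have sa: "sq_on M {t..T} a"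
    unfolding a_def by (intro sq_on_add sq_on_mult_bdd b' blow' X' Xu' sV2)
  have sf: "sq_on M {t..T} f"
    unfolding f_def by (intro sq_on_add sq_on_mult_bdd sq_on_inner_bdd b' bbar' sig' sbar' Y' Yl' Z' Zl' sV1 sW1 c')
  have ada: "a s \<in> borel_measurable (F s)" if s: "s \<in> {t..T}" for s
    unfolding a_def
    by (intro borel_measurable_add borel_measurable_times adC[OF b_data(1) s] adC[OF b_low_data(1) s] adV[OF V2 _ s] adX)
       (use s t T in auto)
  have adf: "f s \<in> borel_measurable (F s)" if s: "s \<in> {t..T}" for s
    unfolding f_def
    by (intro borel_measurable_add borel_measurable_times borel_measurable_inner adC[OF b_data(1) s] adC[OF b_bar_data(1) s]
        adC[OF sigma_data(1) s] adC[OF sigma_bar_data(1) s] adC[OF c_data s] adV[OF V1 _ s] adV[OF W1 _ s] adY adZ)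
       (use s t T in auto)

  \<comment> \<open>both solutions are drift processes with known martingale parts\<close>
  have Xeq': "\<exists>I. has_ito_integral M B t r \<alpha> I \<and> (AE \<omega> in M. X r \<omega> = X t \<omega> + (LINT s:{t..r}|lborel. a s \<omega>) + I \<omega>)"
    if "r \<in> {t<..T}" for r
    unfolding a_def \<alpha>_def by (rule Xeq[OF that])
  have driftX: "has_drift t T X a"
    by (rule has_drift_forward[OF XS sa ada Xeq' t])
  have YT: "Y T \<omega> = \<xi> T \<omega>" if "\<omega> \<in> space M" for \<omega> using Yxi that T by auto
  have Yeq': "\<exists>I. has_ito_integral M B s T Z I \<and> (AE \<omega> in M. Y s \<omega> = Y T \<omega> + (LINT r:{s..T}|lborel. f r \<omega>) - I \<omega>)"
    if s: "s \<in> {t..<T}" for s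
  proof -
    have "s \<in> {0..<T}" using s t by auto
    from Yeq[OF this] obtain I where I: "has_ito_integral M B s T Z I"
      and eq: "AE \<omega> in M. Y s \<omega> = \<xi> T \<omega> + (LINT r:{s..T}|lborel. f r \<omega>) - I \<omega>"
      unfolding f_def by blast
    have "AE \<omega> in M. Y s \<omega> = Y T \<omega> + (LINT r:{s..T}|lborel. f r \<omega>) - I \<omega>"
      using eq AE_space by eventually_elim (simp add: YT)
    with I show ?thesis by blast
  qed
  have driftY: "has_drift t T Y (\<lambda>s \<omega>. - f s \<omega>)"
    by (rule has_drift_backward[OF YS sf adf Yeq' t])
  obtain I where I: "has_ito_integral M B t T \<alpha> I"
    and Ieq: "AE \<omega> in M. X T \<omega> = X t \<omega> + (LINT s:{t..T}|lborel. a s \<omega>) + I \<omega>"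
    using Xeq'[of T] t by auto
  obtain J where J: "has_ito_integral M B t T Z J"
    and Jeq: "AE \<omega> in M. Y t \<omega> = Y T \<omega> + (LINT r:{t..T}|lborel. f r \<omega>) - J \<omega>"
    using Yeq'[of t] t by auto
  have I': "AE \<omega> in M. X T \<omega> - X t \<omega> - (LINT s:{t..T}|lborel. a s \<omega>) = I \<omega>"
    using Ieq by eventually_elim simp
  have J': "AE \<omega> in M. Y T \<omega> - Y t \<omega> - (LINT s:{t..T}|lborel. - f s \<omega>) = J \<omega>"
    using Jeq by eventually_elim (simp add: set_lebesgue_integral_def)
  have s\<alpha>: "sq_on M {t..T} \<alpha>"
    by (rule sq_on_of_L2_proc[OF _ subalgebra_F]) (use I in \<open>auto simp: has_ito_integral_def\<close>)
  have sW2: "sq_on M {t..T} W2"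
  proof -
    have "sq_on M {t..T} (\<lambda>s \<omega>. \<alpha> s \<omega> - (X s \<omega> *\<^sub>R \<sigma> s \<omega> + X (s - u) \<omega> *\<^sub>R \<sigma>_low s \<omega>))"
      by (intro sq_on_diff s\<alpha> sq_on_add sq_on_scaleR_bdd X' Xu' sig' slow')
    then show ?thesis by (simp add: \<alpha>_def)
  qed

  show "L2_F t (Y t)" "L2_F T (X T)" "L2_F T (Y T)"
    by (rule L2_F_of_S2_proc[OF YS], use t in auto, rule L2_F_of_S2_proc[OF XS], use t in auto,
        rule L2_F_of_S2_proc[OF YS], use t in auto)
  have iq: "int_on M {t..T + l} q"
    unfolding q_def
    by (intro int_on_mult sq_on_add sq_on_mult_bdd[OF bdd[OF b_bar_data]] sq_on_inner_bdd[OF bdd[OF sigma_bar_data]] sYl sZl sXs)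
       (use t T in auto)
  then show "int_on M {t..t + l} q" by (rule int_on_subset) (use t T in auto)
  show "int_on M {t..t + l} (\<lambda>s \<omega>. X s \<omega> * b_bar s \<omega>)"
    by (rule int_on_mult[OF sXs sq_on_subset[OF sq_on_of_L2_proc[OF b_bar_data(1) subalgebra_F]]]) (use t T in auto)
  show icX: "int_on M {t..T} (\<lambda>s \<omega>. c s \<omega> * X s \<omega>)" by (rule int_on_mult[OF c' X'])
  \<comment> \<open>on the whole interval \<open>p\<close> is written with \<open>Y, Z\<close> in place of their terminal data\<close>
  define P where "P = (\<lambda>s \<omega>. X (s - u) \<omega> * (b_low s \<omega> * Y s \<omega> + \<sigma>_low s \<omega> \<bullet> Z s \<omega>))"
  have iP: "int_on M {t..T + u} P"
    unfolding P_def
    by (intro int_on_mult sq_on_add sq_on_mult_bdd[OF bdd[OF b_low_data]] sq_on_inner_bdd[OF bdd[OF sigma_low_data]] sYs sZs sXu)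
       (use t T in auto)
  have Pp: "P s \<omega> = p s \<omega>" if "s \<in> {T..T + u}" "\<omega> \<in> space M" for s \<omega>
    using Yxi[OF that] Zeta[OF that] by (simp add: P_def p_def)
  have "int_on M {T..T + u} P" by (rule int_on_subset[OF iP]) (use t in auto)
  then show "int_on M {T..T + u} p" using int_on_cong[of "{T..T+u}" M P p] Pp by blast

  fix A assume A: "A \<in> sets (F t)"
  let ?iA = "indicat_real A"
  have bA: "bdd_on M {x..y} (\<lambda>s. ?iA)" for x y by (rule bdd_on_indicator[OF A]) simp
  have adA: "?iA \<in> borel_measurable (F s)" if "s \<in> {t..T}" for s
    by (rule borel_measurable_indicator[OF sets_F_mono[OF A]]) (use that in auto)
  have AX: "sq_on M {t..T} (\<lambda>s \<omega>. ?iA \<omega> * X s \<omega>)" and AY: "sq_on M {t..T} (\<lambda>s \<omega>. ?iA \<omega> * Y s \<omega>)"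
    by (rule sq_on_mult_bdd[OF bA X'], rule sq_on_mult_bdd[OF bA Y'])
  have AZ: "sq_on M {t..T} (\<lambda>s \<omega>. ?iA \<omega> *\<^sub>R Z s \<omega>)"
    by (rule sq_on_bound[OF Z', where K = 1], rule meas_on_scaleR[OF bdd_on_meas[OF bA] sq_on_meas[OF Z']])
       (auto simp: indicator_def)
  note iA = int_on_indicator[OF sets_F_M[OF A]]
  have adAX: "(\<lambda>\<omega>. ?iA \<omega> * X s \<omega>) \<in> borel_measurable (F s)" if s: "s \<in> {t..T}" for s
    by (intro borel_measurable_times adA[OF s] adX) (use s T in auto)
  have adAY: "(\<lambda>\<omega>. ?iA \<omega> * Y s \<omega>) \<in> borel_measurable (F s)" if s: "s \<in> {t..T}" for s
    by (intro borel_measurable_times adA[OF s] adY) (use s t T in auto)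
  have adAZ: "(\<lambda>\<omega>. ?iA \<omega> *\<^sub>R Z s \<omega>) \<in> borel_measurable (F s)" if s: "s \<in> {t..T}" for s
    by (intro borel_measurable_scaleR adA[OF s] adZ) (use s t T in auto)

  \<comment> \<open>the conditional expectations are removed one by one\<close>
  note sG1 = sq_on_subset[OF G1, of "{t..T}"] and sG2 = sq_on_subset[OF G2, of "{t..T}"]
  have eV1: "pint M {t..T} (\<lambda>s \<omega>. ?iA \<omega> * X s \<omega> * V1 s \<omega>) =
      pint M {t..T} (\<lambda>s \<omega>. ?iA \<omega> * X s \<omega> * (b_low (s + u) \<omega> * Y (s + u) \<omega>))"
    using pint_cond_exp_process[OF V1 G1 sV1 AX adAX t(1)] by simp
  have eW1: "pint M {t..T} (\<lambda>s \<omega>. ?iA \<omega> * X s \<omega> * W1 s \<omega>) =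
      pint M {t..T} (\<lambda>s \<omega>. ?iA \<omega> * X s \<omega> * (\<sigma>_low (s + u) \<omega> \<bullet> Z (s + u) \<omega>))"
    using pint_cond_exp_process[OF W1 G2 sW1 AX adAX t(1)] by simp
  have eV2: "pint M {t..T} (\<lambda>s \<omega>. ?iA \<omega> * Y s \<omega> * V2 s \<omega>) =
      pint M {t..T} (\<lambda>s \<omega>. ?iA \<omega> * Y s \<omega> * (b_bar (s + l) \<omega> * X (s + l) \<omega>))"
    using pint_cond_exp_process[OF V2 G3 sV2 AY adAY order_refl] by simp
  have eW2: "pint M {t..T} (\<lambda>s \<omega>. (?iA \<omega> *\<^sub>R Z s \<omega>) \<bullet> W2 s \<omega>) =
      pint M {t..T} (\<lambda>s \<omega>. (?iA \<omega> *\<^sub>R Z s \<omega>) \<bullet> (X (s + l) \<omega> *\<^sub>R \<sigma>_bar (s + l) \<omega>))"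
    by (rule pint_cond_exp_process[OF W2 G4 sW2 AZ adAZ order_refl])
  note iV1 = int_on_mult[OF AX sV1] and iW1 = int_on_mult[OF AX sW1] and iV2 = int_on_mult[OF AY sV2]
    and iW2 = int_on_inner[OF AZ sW2]
  \<comment> \<open>the advanced terms, translated in time, are integrals of \<open>P\<close> and \<open>q\<close>\<close>
  have P1: "pint M {t..T} (\<lambda>s \<omega>. ?iA \<omega> * X s \<omega> * V1 s \<omega>) + pint M {t..T} (\<lambda>s \<omega>. ?iA \<omega> * X s \<omega> * W1 s \<omega>) =
      pint M {t + u..T + u} (\<lambda>s \<omega>. ?iA \<omega> * P s \<omega>)"
  proof -
    have "pint M {t..T} (\<lambda>s \<omega>. ?iA \<omega> * X s \<omega> * V1 s \<omega>) + pint M {t..T} (\<lambda>s \<omega>. ?iA \<omega> * X s \<omega> * W1 s \<omega>) =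
        pint M {t..T} (\<lambda>s \<omega>. ?iA \<omega> * X s \<omega> * (b_low (s + u) \<omega> * Y (s + u) \<omega>) + ?iA \<omega> * X s \<omega> * (\<sigma>_low (s + u) \<omega> \<bullet> Z (s + u) \<omega>))"
      unfolding eV1 eW1 using t by (intro pint_add[symmetric] int_on_mult AX sG1 sG2) auto
    also have "\<dots> = pint M {t..T} (\<lambda>s. (\<lambda>r \<omega>. ?iA \<omega> * P r \<omega>) (s - (- u)))"
      by (rule pint_cong) (simp add: P_def algebra_simps)
    also have "\<dots> = pint M {t - (- u)..T - (- u)} (\<lambda>s \<omega>. ?iA \<omega> * P s \<omega>)"
      by (rule pint_shift[OF iA[OF int_on_subset[OF iP]]]) (use T t in auto)
    finally show ?thesis by simp
  qed
  have P2: "pint M {t..T} (\<lambda>s \<omega>. ?iA \<omega> * P s \<omega>) + pint M {T..T + u} (\<lambda>s \<omega>. ?iA \<omega> * P s \<omega>) =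
      pint M {t + u..T + u} (\<lambda>s \<omega>. ?iA \<omega> * P s \<omega>)"
  proof -
    have "pint M {t..t + u} (\<lambda>s \<omega>. ?iA \<omega> * P s \<omega>) = 0"
      by (rule pint_zero) (simp add: P_def Xneg)
    then show ?thesis
      using pint_split[OF iA[OF iP], of T] pint_split[OF iA[OF iP], of "t + u"] T t by simp
  qed
  have Q1: "pint M {t..T} (\<lambda>s \<omega>. ?iA \<omega> * Y s \<omega> * V2 s \<omega>) + pint M {t..T} (\<lambda>s \<omega>. (?iA \<omega> *\<^sub>R Z s \<omega>) \<bullet> W2 s \<omega>) =
      pint M {t + l..T + l} (\<lambda>s \<omega>. ?iA \<omega> * q s \<omega>)"
  proof -
    have "pint M {t..T} (\<lambda>s \<omega>. ?iA \<omega> * Y s \<omega> * V2 s \<omega>) + pint M {t..T} (\<lambda>s \<omega>. (?iA \<omega> *\<^sub>R Z s \<omega>) \<bullet> W2 s \<omega>) =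
        pint M {t..T} (\<lambda>s \<omega>. ?iA \<omega> * Y s \<omega> * (b_bar (s + l) \<omega> * X (s + l) \<omega>) + (?iA \<omega> *\<^sub>R Z s \<omega>) \<bullet> (X (s + l) \<omega> *\<^sub>R \<sigma>_bar (s + l) \<omega>))"
      unfolding eV2 eW2 by (rule pint_add[OF int_on_mult[OF AY G3] int_on_inner[OF AZ G4], symmetric])
    also have "\<dots> = pint M {t..T} (\<lambda>s. (\<lambda>r \<omega>. ?iA \<omega> * q r \<omega>) (s - (- l)))"
      by (rule pint_cong) (simp add: q_def algebra_simps inner_commute)
    also have "\<dots> = pint M {t - (- l)..T - (- l)} (\<lambda>s \<omega>. ?iA \<omega> * q s \<omega>)"
      by (rule pint_shift[OF iA[OF int_on_subset[OF iq]]]) (use T t in auto)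
    finally show ?thesis by simp
  qed
  have Q2: "pint M {t..T} (\<lambda>s \<omega>. ?iA \<omega> * q s \<omega>) =
      pint M {t..t + l} (\<lambda>s \<omega>. ?iA \<omega> * q s \<omega>) + pint M {t + l..T + l} (\<lambda>s \<omega>. ?iA \<omega> * q s \<omega>)"
  proof -
    have "pint M {T..T + l} (\<lambda>s \<omega>. ?iA \<omega> * q s \<omega>) = 0"
      by (rule pint_zero) (simp add: q_def Xpos)
    then show ?thesis
      using pint_split[OF iA[OF iq], of T] pint_split[OF iA[OF iq], of "t + l"] T t by simp
  qed
  have pP: "pint M {T..T + u} (\<lambda>s \<omega>. ?iA \<omega> * P s \<omega>) = pint M {T..T + u} (\<lambda>s \<omega>. ?iA \<omega> * p s \<omega>)"
    by (rule pint_cong) (simp add: Pp)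

  \<comment> \<open>the product rule, with all cancelling terms collected\<close>
  have i\<alpha>Z: "int_on M {t..T} (\<lambda>s \<omega>. ?iA \<omega> * (\<alpha> s \<omega> \<bullet> Z s \<omega>))" by (rule iA[OF int_on_inner[OF s\<alpha> Z']])
  have iaY: "int_on M {t..T} (\<lambda>s \<omega>. ?iA \<omega> * (a s \<omega> * Y s \<omega>))" by (rule iA[OF int_on_mult[OF sa Y']])
  have ifX: "int_on M {t..T} (\<lambda>s \<omega>. ?iA \<omega> * (- f s \<omega> * X s \<omega>))" by (rule iA[OF int_on_mult[OF sq_on_uminus[OF sf] X']])
  have iP': "int_on M {t..T} (\<lambda>s \<omega>. ?iA \<omega> * P s \<omega>)" by (rule iA[OF int_on_subset[OF iP]]) (use T in auto)
  have iq': "int_on M {t..T} (\<lambda>s \<omega>. ?iA \<omega> * q s \<omega>)" by (rule iA[OF int_on_subset[OF iq]]) (use T in auto)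
  note icX' = iA[OF icX]
  have "pint M {t..T} (\<lambda>s \<omega>. ?iA \<omega> * (a s \<omega> * Y s \<omega>)) + pint M {t..T} (\<lambda>s \<omega>. ?iA \<omega> * (- f s \<omega> * X s \<omega>)) +
      pint M {t..T} (\<lambda>s \<omega>. ?iA \<omega> * (\<alpha> s \<omega> \<bullet> Z s \<omega>)) =
      pint M {t..T} (\<lambda>s \<omega>. ?iA \<omega> * (a s \<omega> * Y s \<omega>) + ?iA \<omega> * (- f s \<omega> * X s \<omega>) + ?iA \<omega> * (\<alpha> s \<omega> \<bullet> Z s \<omega>))"
    by (simp only: pint_add[OF int_on_add[OF iaY ifX] i\<alpha>Z] pint_add[OF iaY ifX])
  also have "\<dots> = pint M {t..T} (\<lambda>s \<omega>. ?iA \<omega> * P s \<omega> + ?iA \<omega> * Y s \<omega> * V2 s \<omega> + (?iA \<omega> *\<^sub>R Z s \<omega>) \<bullet> W2 s \<omega>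
      - ?iA \<omega> * X s \<omega> * V1 s \<omega> - ?iA \<omega> * X s \<omega> * W1 s \<omega> - ?iA \<omega> * q s \<omega> - ?iA \<omega> * (c s \<omega> * X s \<omega>))"
    by (rule pint_cong) (simp add: a_def f_def \<alpha>_def P_def q_def inner_add_left inner_commute algebra_simps)
  also have "\<dots> = pint M {t..T} (\<lambda>s \<omega>. ?iA \<omega> * P s \<omega>) + pint M {t..T} (\<lambda>s \<omega>. ?iA \<omega> * Y s \<omega> * V2 s \<omega>)
      + pint M {t..T} (\<lambda>s \<omega>. (?iA \<omega> *\<^sub>R Z s \<omega>) \<bullet> W2 s \<omega>) - pint M {t..T} (\<lambda>s \<omega>. ?iA \<omega> * X s \<omega> * V1 s \<omega>)
      - pint M {t..T} (\<lambda>s \<omega>. ?iA \<omega> * X s \<omega> * W1 s \<omega>) - pint M {t..T} (\<lambda>s \<omega>. ?iA \<omega> * q s \<omega>)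
      - pint M {t..T} (\<lambda>s \<omega>. ?iA \<omega> * (c s \<omega> * X s \<omega>))"
    by (simp only: pint_add pint_diff int_on_add int_on_diff iP' iq' icX' iV1 iW1 iV2 iW2)
  finally have "pint M {t..T} (\<lambda>s \<omega>. ?iA \<omega> * (a s \<omega> * Y s \<omega>)) + pint M {t..T} (\<lambda>s \<omega>. ?iA \<omega> * (- f s \<omega> * X s \<omega>)) +
      pint M {t..T} (\<lambda>s \<omega>. ?iA \<omega> * (\<alpha> s \<omega> \<bullet> Z s \<omega>)) =
      - pint M {T..T + u} (\<lambda>s \<omega>. ?iA \<omega> * p s \<omega>) - pint M {t..t + l} (\<lambda>s \<omega>. ?iA \<omega> * q s \<omega>)
      - pint M {t..T} (\<lambda>s \<omega>. ?iA \<omega> * (c s \<omega> * X s \<omega>))"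
    using P1 P2 Q1 Q2 pP by linarith
  moreover have "expectation (\<lambda>\<omega>. ?iA \<omega> * (X T \<omega> * Y T \<omega>)) = expectation (\<lambda>\<omega>. ?iA \<omega> * (X T \<omega> * \<xi> T \<omega>))"
    by (intro Bochner_Integration.integral_cong refl) (simp add: YT)
  moreover have "expectation (\<lambda>\<omega>. ?iA \<omega> * (X t \<omega> * Y t \<omega>)) = expectation (\<lambda>\<omega>. ?iA \<omega> * Y t \<omega>)"
    by (intro Bochner_Integration.integral_cong refl) (simp add: X1)
  ultimately show "expectation (\<lambda>\<omega>. ?iA \<omega> * Y t \<omega>) = expectation (\<lambda>\<omega>. ?iA \<omega> * (X T \<omega> * \<xi> T \<omega>)) +
      pint M {T..T + u} (\<lambda>s \<omega>. ?iA \<omega> * p s \<omega>) + pint M {t..t + l} (\<lambda>s \<omega>. ?iA \<omega> * q s \<omega>) +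
      pint M {t..T} (\<lambda>s \<omega>. ?iA \<omega> * (c s \<omega> * X s \<omega>))"
    using ito_product_rule[OF driftX driftY A t I I' J J'] by linarith
qed

text \<open>The random variable whose conditional expectation is \<open>Y\<^sub>t\<close>.\<close>

definition payoff :: "real \<Rightarrow> (real \<Rightarrow> 'w \<Rightarrow> real) \<Rightarrow> 'w \<Rightarrow> real" where
  "payoff t X \<omega> = X T \<omega> * \<xi> T \<omega>
     + (LINT s:{T..T + u}|lborel. X (s - u) \<omega> * (b_low s \<omega> * \<xi> s \<omega> + \<sigma>_low s \<omega> \<bullet> \<eta> s \<omega>))
     + (LINT s:{t..t + l}|lborel. X s \<omega> * (b_bar s \<omega> * Y (s - l) \<omega> + \<sigma>_bar s \<omega> \<bullet> Z (s - l) \<omega>))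
     + (LINT s:{t..T}|lborel. c s \<omega> * X s \<omega>)"

lemma YT: "\<omega> \<in> space M \<Longrightarrow> Y T \<omega> = \<xi> T \<omega>"
  using bsde T unfolding bsde_solution_def by auto

lemma YS: "S2_proc M F 0 T Y"
  using bsde unfolding bsde_solution_def by blast

text \<open>For \<open>t < T\<close> this is the duality.  At \<open>t = T\<close> there is no equation to integrate by parts, but the payoff
reduces to \<open>\<xi>\<^sub>T\<close> because \<open>X\<close> vanishes on both sides of \<open>T\<close>.\<close>

lemma
  assumes t: "0 \<le> t" "t \<le> T"
    and sde: "sde_solution M B T l u b b_bar b_low \<sigma> \<sigma>_bar \<sigma>_low t X"
  shows integrable_payoff: "integrable M (payoff t X)"
    and expectation_payoff: "A \<in> sets (F t) \<Longrightarrow>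
      expectation (\<lambda>\<omega>. indicat_real A \<omega> * Y t \<omega>) = expectation (\<lambda>\<omega>. indicat_real A \<omega> * payoff t X \<omega>)"
proof -
  have "integrable M (payoff t X) \<and> (\<forall>A\<in>sets (F t).
      expectation (\<lambda>\<omega>. indicat_real A \<omega> * Y t \<omega>) = expectation (\<lambda>\<omega>. indicat_real A \<omega> * payoff t X \<omega>))"
  proof (cases "t = T")
    case True
    have X1: "\<And>\<omega>. \<omega> \<in> space M \<Longrightarrow> X T \<omega> = 1"
      and Xpos: "\<And>s \<omega>. s \<in> {T<..T + l} \<Longrightarrow> \<omega> \<in> space M \<Longrightarrow> X s \<omega> = 0"
      and Xneg: "\<And>s \<omega>. s \<in> {T - u..<T} \<Longrightarrow> \<omega> \<in> space M \<Longrightarrow> X s \<omega> = 0"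
      using sde unfolding sde_solution_def True by blast+
    have eq: "payoff t X \<omega> = Y t \<omega>" if "\<omega> \<in> space M" for \<omega>
    proof -
      have "(LINT s:{T..T + u}|lborel. X (s - u) \<omega> * (b_low s \<omega> * \<xi> s \<omega> + \<sigma>_low s \<omega> \<bullet> \<eta> s \<omega>)) = 0"
        by (rule LINT_zero) (simp add: Xneg that)
      moreover have "(LINT s:{T..T + l}|lborel. X s \<omega> * (b_bar s \<omega> * Y (s - l) \<omega> + \<sigma>_bar s \<omega> \<bullet> Z (s - l) \<omega>)) = 0"
        by (rule LINT_zero) (simp add: Xpos that)
      ultimately show ?thesis
        unfolding payoff_def True LINT_singleton by (simp add: X1 YT that)
    qed
    have "L2_F T (Y T)" by (rule L2_F_of_S2_proc[OF YS]) (use T0 in auto)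
    then have "L2_fun M (Y T)" by (simp add: L2_F_def)
    from integrable_mult_L2[OF this, of "\<lambda>_. 1"] have "integrable M (Y t)" by (simp add: True L2_fun_def)
    then have "integrable M (payoff t X)"
      by (rule Bochner_Integration.integrable_cong[THEN iffD1, OF refl, rotated]) (simp add: eq)
    moreover have "expectation (\<lambda>\<omega>. indicat_real A \<omega> * Y t \<omega>) = expectation (\<lambda>\<omega>. indicat_real A \<omega> * payoff t X \<omega>)" for A
      by (intro Bochner_Integration.integral_cong refl) (simp add: eq)
    ultimately show ?thesis by blast
  next
    case False
    then have tT: "t < T" using t by simp
    note D = duality[OF t(1) tT sde]
    let ?p = "\<lambda>\<omega>. LINT s:{T..T + u}|lborel. X (s - u) \<omega> * (b_low s \<omega> * \<xi> s \<omega> + \<sigma>_low s \<omega> \<bullet> \<eta> s \<omega>)"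
    let ?q = "\<lambda>\<omega>. LINT s:{t..t + l}|lborel. X s \<omega> * (b_bar s \<omega> * Y (s - l) \<omega> + \<sigma>_bar s \<omega> \<bullet> Z (s - l) \<omega>)"
    let ?c = "\<lambda>\<omega>. LINT s:{t..T}|lborel. c s \<omega> * X s \<omega>"
    have "L2_fun M (X T)" "L2_fun M (Y T)" using D(2,3) by (auto simp: L2_F_def)
    from integrable_mult_L2[OF this] have iX: "integrable M (\<lambda>\<omega>. X T \<omega> * \<xi> T \<omega>)"
      by (rule Bochner_Integration.integrable_cong[THEN iffD1, OF refl, rotated]) (simp add: YT)
    note ip = integrable_LINT_int_on[OF D(4)] and iq = integrable_LINT_int_on[OF D(5)] and ic = integrable_LINT_int_on[OF D(6)]
    have int: "integrable M (payoff t X)"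
      unfolding payoff_def[abs_def] by (intro Bochner_Integration.integrable_add iX ip iq ic)
    have "expectation (\<lambda>\<omega>. indicat_real A \<omega> * Y t \<omega>) = expectation (\<lambda>\<omega>. indicat_real A \<omega> * payoff t X \<omega>)"
      if A: "A \<in> sets (F t)" for A
    proof -
      have Aev: "A \<in> events" by (rule sets_F_M[OF A])
      have ind: "integrable M (\<lambda>\<omega>. indicat_real A \<omega> * h \<omega>)" if "integrable M h" for h
        using integrable_mult_indicator[OF Aev that] by simp
      have pe: "pint M S (\<lambda>s \<omega>. indicat_real A \<omega> * h s \<omega>) = expectation (\<lambda>\<omega>. indicat_real A \<omega> * (LINT s:S|lborel. h s \<omega>))"
        if "int_on M S h" for S h
        using pint_eq_LINT[OF int_on_indicator[OF Aev that]] by simp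
      have "expectation (\<lambda>\<omega>. indicat_real A \<omega> * payoff t X \<omega>) =
          expectation (\<lambda>\<omega>. indicat_real A \<omega> * (X T \<omega> * \<xi> T \<omega>) + indicat_real A \<omega> * ?p \<omega> + indicat_real A \<omega> * ?q \<omega> + indicat_real A \<omega> * ?c \<omega>)"
        by (simp only: payoff_def distrib_left)
      also have "\<dots> = expectation (\<lambda>\<omega>. indicat_real A \<omega> * (X T \<omega> * \<xi> T \<omega>)) + expectation (\<lambda>\<omega>. indicat_real A \<omega> * ?p \<omega>)
          + expectation (\<lambda>\<omega>. indicat_real A \<omega> * ?q \<omega>) + expectation (\<lambda>\<omega>. indicat_real A \<omega> * ?c \<omega>)"
        using ind[OF iX] ind[OF ip] ind[OF iq] ind[OF ic]
        by (simp only: Bochner_Integration.integral_add Bochner_Integration.integrable_add)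
      also have "\<dots> = expectation (\<lambda>\<omega>. indicat_real A \<omega> * Y t \<omega>)"
        unfolding pe[OF D(4), symmetric] pe[OF D(5), symmetric] pe[OF D(6), symmetric] by (rule D(8)[OF A, symmetric])
      finally show ?thesis ..
    qed
    with int show ?thesis by blast
  qed
  then show "integrable M (payoff t X)"
    "A \<in> sets (F t) \<Longrightarrow> expectation (\<lambda>\<omega>. indicat_real A \<omega> * Y t \<omega>) = expectation (\<lambda>\<omega>. indicat_real A \<omega> * payoff t X \<omega>)"
    by blast+
qed

lemma representation:
  assumes t: "0 \<le> t" "t \<le> T"
    and sde: "sde_solution M B T l u b b_bar b_low \<sigma> \<sigma>_bar \<sigma>_low t X"
  shows "AE \<omega> in M. Y t \<omega> = real_cond_exp M (F t) (payoff t X) \<omega>"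
proof -
  interpret S: sigma_finite_subalgebra M "F t" by (rule cond_exp_subalgebra)
  have Yt: "L2_F t (Y t)" by (rule L2_F_of_S2_proc[OF YS]) (use t in auto)
  then have "L2_fun M (Y t)" by (simp add: L2_F_def)
  from integrable_mult_L2[OF this, of "\<lambda>_. 1"] have Yi: "integrable M (Y t)" by (simp add: L2_fun_def)
  have "AE \<omega> in M. real_cond_exp M (F t) (payoff t X) \<omega> = Y t \<omega>"
  proof (rule S.real_cond_exp_charact[OF _ integrable_payoff[OF t sde] Yi])
    show "Y t \<in> borel_measurable (F t)" using Yt by (simp add: L2_F_def)
    show "(\<integral>\<omega>\<in>A. payoff t X \<omega> \<partial>M) = (\<integral>\<omega>\<in>A. Y t \<omega> \<partial>M)" if "A \<in> sets (F t)" for A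
      using expectation_payoff[OF t sde that] by (simp add: set_lebesgue_integral_def)
  qed
  then show ?thesis by eventually_elim simp
qed

text \<open>Since \<open>Y\<^sub>0\<close> is a constant \<open>y\<close>, the integral over \<open>[0, l]\<close> in the payoff has expectation
\<open>y \<kappa>\<close>, and the representation at time \<open>0\<close> reads \<open>y = E[R] + y \<kappa>\<close> with \<open>R\<close> the remaining terms.\<close>

lemma initial_value:
  assumes sde: "sde_solution M B T l u b b_bar b_low \<sigma> \<sigma>_bar \<sigma>_low 0 X"
  defines "\<kappa> \<equiv> (LINT \<omega>|M. (LINT s:{0..l}|lborel. X s \<omega> * b_bar s \<omega>))"
  assumes \<kappa>: "\<kappa> \<noteq> 1"
  shows "AE \<omega> in M. Y 0 \<omega> = inverse (1 - \<kappa>) * (LINT \<omega>|M. X T \<omega> * \<xi> T \<omega>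
      + (LINT s:{T..T + u}|lborel. X (s - u) \<omega> * (b_low s \<omega> * \<xi> s \<omega> + \<sigma>_low s \<omega> \<bullet> \<eta> s \<omega>))
      + (LINT s:{0..T}|lborel. c s \<omega> * X s \<omega>))"
proof -
  have T': "0 \<le> T" using T0 by simp
  note D = duality[OF order_refl T0 sde]
  let ?q = "\<lambda>\<omega>. LINT s:{0..0 + l}|lborel. X s \<omega> * (b_bar s \<omega> * Y (s - l) \<omega> + \<sigma>_bar s \<omega> \<bullet> Z (s - l) \<omega>)"
  let ?k = "\<lambda>\<omega>. LINT s:{0..l}|lborel. X s \<omega> * b_bar s \<omega>"
  let ?R = "\<lambda>\<omega>. X T \<omega> * \<xi> T \<omega>
      + (LINT s:{T..T + u}|lborel. X (s - u) \<omega> * (b_low s \<omega> * \<xi> s \<omega> + \<sigma>_low s \<omega> \<bullet> \<eta> s \<omega>))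
      + (LINT s:{0..T}|lborel. c s \<omega> * X s \<omega>)"
  define y where "y = expectation (payoff 0 X)"
  have y: "AE \<omega> in M. Y 0 \<omega> = y"
    using representation[OF order_refl T' sde] real_cond_exp_F_zero[OF integrable_payoff[OF order_refl T' sde]]
    unfolding y_def by eventually_elim simp
  have Yneg: "\<And>s \<omega>. s \<in> {- l..<0} \<Longrightarrow> \<omega> \<in> space M \<Longrightarrow> Y s \<omega> = Y 0 \<omega>"
    and Zneg: "\<And>s \<omega>. s \<in> {- l..<0} \<Longrightarrow> \<omega> \<in> space M \<Longrightarrow> Z s \<omega> = 0"
    using bsde unfolding bsde_solution_def by blast+
  have q: "?q \<omega> = Y 0 \<omega> * ?k \<omega>" if \<omega>: "\<omega> \<in> space M" for \<omega>
  proof -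
    have "?q \<omega> = (\<integral>s. Y 0 \<omega> * (indicat_real {0..l} s *\<^sub>R (X s \<omega> * b_bar s \<omega>)) \<partial>lborel)"
      unfolding set_lebesgue_integral_def
      \<comment> \<open>at \<open>s = l\<close> the delayed values are \<open>Y 0\<close> and \<open>Z 0\<close>, and the latter need not vanish\<close>
    proof (rule integral_discrete_difference[where X = "{l}"])
      fix s assume "s \<notin> {l}"
      then show "indicat_real {0..0 + l} s *\<^sub>R (X s \<omega> * (b_bar s \<omega> * Y (s - l) \<omega> + \<sigma>_bar s \<omega> \<bullet> Z (s - l) \<omega>)) =
          Y 0 \<omega> * (indicat_real {0..l} s *\<^sub>R (X s \<omega> * b_bar s \<omega>))"
        using Yneg[of "s - l" \<omega>] Zneg[of "s - l" \<omega>] \<omega> by (auto simp: indicator_def)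
    qed auto
    then show ?thesis by (simp add: set_lebesgue_integral_def)
  qed
  have ik: "integrable M ?k" using integrable_LINT_int_on[OF D(7)] by simp
  have iq: "integrable M ?q" by (rule integrable_LINT_int_on[OF D(5)])
  have "expectation ?q = expectation (\<lambda>\<omega>. y * ?k \<omega>)"
  proof (rule integral_cong_AE)
    show "AE \<omega> in M. ?q \<omega> = y * ?k \<omega>" using y AE_space by eventually_elim (simp only: q)
  qed (use iq ik in \<open>auto intro: borel_measurable_integrable\<close>)
  then have Eq: "expectation ?q = y * \<kappa>" by (simp add: \<kappa>_def)
  have "expectation ?R = expectation (\<lambda>\<omega>. payoff 0 X \<omega> - ?q \<omega>)"
    by (intro Bochner_Integration.integral_cong refl) (simp add: payoff_def)
  also have "\<dots> = expectation (payoff 0 X) - expectation ?q"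
    by (rule Bochner_Integration.integral_diff[OF integrable_payoff[OF order_refl T' sde] iq])
  also have "\<dots> = y - y * \<kappa>" by (simp only: Eq y_def)
  finally have "y = inverse (1 - \<kappa>) * expectation ?R" using \<kappa> by (simp add: field_simps)
  with y show ?thesis by simp
qed

end

theorem theorem4p1:
  fixes M :: "'w measure" and B :: "real \<Rightarrow> 'w \<Rightarrow> real ^ 'd"
    and T l u :: real
    and \<xi> b b_bar b_low c Y :: "real \<Rightarrow> 'w \<Rightarrow> real"
    and \<eta> \<sigma> \<sigma>_bar \<sigma>_low Z :: "real \<Rightarrow> 'w \<Rightarrow> real ^ 'd"
  defines "F \<equiv> aug_filtration M B"
  assumes "prob_space M" and "complete_measure M" and "standard_brownian_motion M B"
    and "T > 0" and "l \<ge> 0" and "u \<ge> 0"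
    and "L2_proc M F T (T + u) \<xi>" and "L2_proc M F T (T + u) \<eta>" and "L2_rv M (F T) (\<xi> T)"
    and "L2_proc M F 0 (T + u + l) b" and "unif_bounded M 0 (T + u + l) b"
    and "L2_proc M F 0 (T + u + l) b_bar" and "unif_bounded M 0 (T + u + l) b_bar"
    and "L2_proc M F 0 (T + u + l) b_low" and "unif_bounded M 0 (T + u + l) b_low"
    and "L2_proc M F 0 (T + u + l) c" and "unif_bounded M 0 (T + u + l) c"
    and "L2_proc M F 0 (T + u + l) \<sigma>" and "unif_bounded M 0 (T + u + l) \<sigma>"
    and "L2_proc M F 0 (T + u + l) \<sigma>_bar" and "unif_bounded M 0 (T + u + l) \<sigma>_bar"
    and "L2_proc M F 0 (T + u + l) \<sigma>_low" and "unif_bounded M 0 (T + u + l) \<sigma>_low"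
    and "bsde_unique_solution M B T l u b b_bar b_low \<sigma> \<sigma>_bar \<sigma>_low c \<xi> \<eta> Y Z"
  shows "(\<forall>t\<in>{0..T}. \<forall>X.
           sde_unique_solution M B T l u b b_bar b_low \<sigma> \<sigma>_bar \<sigma>_low t X \<longrightarrow>
           (AE \<omega> in M. Y t \<omega> = real_cond_exp M (F t) (\<lambda>\<omega>.
              X T \<omega> * \<xi> T \<omega>
              + (LINT s:{T..T + u}|lborel. X (s - u) \<omega> * (b_low s \<omega> * \<xi> s \<omega> + \<sigma>_low s \<omega> \<bullet> \<eta> s \<omega>))
              + (LINT s:{t..t + l}|lborel. X s \<omega> * (b_bar s \<omega> * Y (s - l) \<omega> + \<sigma>_bar s \<omega> \<bullet> Z (s - l) \<omega>))
              + (LINT s:{t..T}|lborel. c s \<omega> * X s \<omega>)) \<omega>))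
         \<and> (\<forall>X. sde_unique_solution M B T l u b b_bar b_low \<sigma> \<sigma>_bar \<sigma>_low 0 X \<longrightarrow>
           (LINT \<omega>|M. (LINT s:{0..l}|lborel. X s \<omega> * b_bar s \<omega>)) \<noteq> 1 \<longrightarrow>
           (AE \<omega> in M. Y 0 \<omega> =
              inverse (1 - (LINT \<omega>|M. (LINT s:{0..l}|lborel. X s \<omega> * b_bar s \<omega>)))
              * (LINT \<omega>|M. X T \<omega> * \<xi> T \<omega>
                   + (LINT s:{T..T + u}|lborel. X (s - u) \<omega> * (b_low s \<omega> * \<xi> s \<omega> + \<sigma>_low s \<omega> \<bullet> \<eta> s \<omega>))
                   + (LINT s:{0..T}|lborel. c s \<omega> * X s \<omega>))))"
proof -
  note A = assms(8-24)[unfolded assms(1)]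
  have sol: "bsde_solution M B T l u b b_bar b_low \<sigma> \<sigma>_bar \<sigma>_low c \<xi> \<eta> Y Z"
    using assms(25) unfolding bsde_unique_solution_def by (rule conjunct1)
  have "brownian_motion M B"
    using assms(2,4) by (rule brownian_motion.intro[OF _ brownian_motion_axioms.intro])
  then interpret anticipated_bsde M B T l u \<xi> b b_bar b_low c Y \<eta> \<sigma> \<sigma>_bar \<sigma>_low Z
    by (rule anticipated_bsde.intro[OF _ anticipated_bsde_axioms.intro[OF assms(5-7) A(1,2,4-10,12-17) sol]])
  show ?thesis
    unfolding assms(1)
  proof (intro conjI ballI allI impI)
    fix t X assume t: "t \<in> {0..T}" and X: "sde_unique_solution M B T l u b b_bar b_low \<sigma> \<sigma>_bar \<sigma>_low t X"
    have sde: "sde_solution M B T l u b b_bar b_low \<sigma> \<sigma>_bar \<sigma>_low t X"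
      using X unfolding sde_unique_solution_def by (rule conjunct1)
    have t': "0 \<le> t" "t \<le> T" using t by auto
    from representation[OF t' sde] show "AE \<omega> in M. Y t \<omega> = real_cond_exp M (aug_filtration M B t) (\<lambda>\<omega>.
        X T \<omega> * \<xi> T \<omega>
        + (LINT s:{T..T + u}|lborel. X (s - u) \<omega> * (b_low s \<omega> * \<xi> s \<omega> + \<sigma>_low s \<omega> \<bullet> \<eta> s \<omega>))
        + (LINT s:{t..t + l}|lborel. X s \<omega> * (b_bar s \<omega> * Y (s - l) \<omega> + \<sigma>_bar s \<omega> \<bullet> Z (s - l) \<omega>))
        + (LINT s:{t..T}|lborel. c s \<omega> * X s \<omega>)) \<omega>"
      unfolding payoff_def[abs_def] .
  next
    fix X assume X: "sde_unique_solution M B T l u b b_bar b_low \<sigma> \<sigma>_bar \<sigma>_low 0 X"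
      and \<kappa>: "(LINT \<omega>|M. (LINT s:{0..l}|lborel. X s \<omega> * b_bar s \<omega>)) \<noteq> 1"
    have "sde_solution M B T l u b b_bar b_low \<sigma> \<sigma>_bar \<sigma>_low 0 X"
      using X unfolding sde_unique_solution_def by (rule conjunct1)
    from initial_value[OF this \<kappa>]
    show "AE \<omega> in M. Y 0 \<omega> =
        inverse (1 - (LINT \<omega>|M. (LINT s:{0..l}|lborel. X s \<omega> * b_bar s \<omega>)))
        * (LINT \<omega>|M. X T \<omega> * \<xi> T \<omega>
             + (LINT s:{T..T + u}|lborel. X (s - u) \<omega> * (b_low s \<omega> * \<xi> s \<omega> + \<sigma>_low s \<omega> \<bullet> \<eta> s \<omega>))
             + (LINT s:{0..T}|lborel. c s \<omega> * X s \<omega>))" .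
  qed
qed

end
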